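(* Let $\mathbf{k}$ be an algebraically closed field, let $r,s\geq 1$ and let $\Lambda=\mathbf{k}S_{(r,s)}/I$ be a $2$-representation-finite $(r,s)$-star algebra. If the underlying graph $\overline{B_\Lambda}$ of the quiver $B_\Lambda$ is semi-regular of bidegree $(\Sigma_1,\Sigma_2)$, then (a) $r\Sigma_1=s\Sigma_2$, and (b) $\Sigma_1\Sigma_2+r+s-r\Sigma_1\in\{1,2,3,4\}$.
   Context: The star quiver $S_{(r,s)}$ has vertices $x_1,\dots,x_r,z,y_1,\dots,y_s$ and arrows $a_i:x_i\to z$ ($1\le i\le r$), $b_j:z\to y_j$ ($1\le j\le s$). The path "first $a_i$, then $b_j$" is written $a_ib_j$. An $(r,s)$-star algebra is a bound quiver algebra $\Lambda=\mathbf{k}S_{(r,s)}/I$ with $I$ an admissible ideal; such an $I$ is automatically generated by a set of paths $a_ib_j$. The quiver $B_\Lambda$ has vertex set $\{x_1,\dots,x_r,y_1,\dots,y_s\}$ and one arrow $\beta_{ji}:y_j\to x_i$ for each pair $(i,j)$ with $a_ib_j\notin I$. Its underlying graph $\overline{B_\Lambda}$ is bipartite with parts $\{x_i\}$ and $\{y_j\}$. It is semi-regular of bidegree $(\Sigma_1,\Sigma_2)$ ($\Sigma_1,\Sigma_2$ nonnegative integers) if every $x_i$ has degree $\Sigma_1$ and every $y_j$ has degree $\Sigma_2$. A finite-dimensional algebra $\Lambda$ of global dimension at most $n$ is $n$-representation-finite if for every indecomposable projective (right) $\Lambda$-module $P$ there is some $i\ge 0$ such that $\nu_n^{-i}(P)$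 is an indecomposable injective $\Lambda$-module, where $\nu$ is the derived Nakayama functor (the Serre functor) of $D^b(\mathrm{mod}\,\Lambda)$ and $\nu_n=\nu\circ[-n]$. *)

theory Defs
  imports
    "HOL-Computational_Algebra.Polynomial"
    "HOL-Library.Function_Algebras"
    "Graph_Theory.Arc_Walk"
    "HOL-Algebra.Module"
    "HOL-Algebra.QuotRing"
    "HOL-Algebra.Ideal_Product"
begin

section \<open>Finite-dimensional algebras\<close>

definition scalars :: "'k::field ring" where
  "scalars = \<lparr>carrier = UNIV, mult = (*), one = 1, zero = 0, add = (+)\<rparr>"

text \<open>
  The HOL-Algebra locale \<open>algebra\<close> is restricted to commutative algebras; here the ring need
  not be commutative.
\<close>

definition fd_algebra :: "('k::field, 'a) module \<Rightarrow> bool" where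
  "fd_algebra A \<longleftrightarrow>
     ring A \<and> module scalars A \<and>
     (\<forall>c. \<forall>a\<in>carrier A. \<forall>b\<in>carrier A.
        (c \<odot>\<^bsub>A\<^esub> a) \<otimes>\<^bsub>A\<^esub> b = c \<odot>\<^bsub>A\<^esub> (a \<otimes>\<^bsub>A\<^esub> b) \<and>
        a \<otimes>\<^bsub>A\<^esub> (c \<odot>\<^bsub>A\<^esub> b) = c \<odot>\<^bsub>A\<^esub> (a \<otimes>\<^bsub>A\<^esub> b)) \<and>
     (\<exists>B. finite B \<and> B \<subseteq> carrier A \<and>
        (\<forall>a\<in>carrier A. \<exists>c. a = finsum A (\<lambda>b. c b \<odot>\<^bsub>A\<^esub> b) B))"


section \<open>Finite-dimensional right modules\<close>

text \<open>
  The underlying vector space of a module is a subspace of a space of functions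
  \<open>'i \<Rightarrow> 'k\<close> with pointwise operations. Every finite-dimensional vector space embeds into
  \<open>nat \<Rightarrow> 'k\<close>, so the modules with \<open>'i = nat\<close> represent all isomorphism classes of
  finite-dimensional modules, and wherever one quantifies over the category of all
  finite-dimensional modules the index type \<open>nat\<close> is used. Other index types occur because the
  Nakayama functor, which is built from function spaces, changes the index type.
\<close>

definition fscale :: "'k::field \<Rightarrow> ('i \<Rightarrow> 'k) \<Rightarrow> 'i \<Rightarrow> 'k" where
  "fscale c v = (\<lambda>i. c * v i)"

global_interpretation fun_vs: vector_space "fscale :: 'k::field \<Rightarrow> ('i \<Rightarrow> 'k) \<Rightarrow> 'i \<Rightarrow> 'k"
  by unfold_locales (auto simp: fscale_def fun_eq_iff algebra_simps)

record ('k, 'a, 'i) rmodule =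
  elems :: "('i \<Rightarrow> 'k) set"
  ract :: "('i \<Rightarrow> 'k) \<Rightarrow> 'a \<Rightarrow> ('i \<Rightarrow> 'k)"

definition right_module :: "('k::field, 'a) module \<Rightarrow> ('k, 'a, 'i) rmodule \<Rightarrow> bool" where
  "right_module A M \<longleftrightarrow>
     fun_vs.subspace (elems M) \<and>
     (\<exists>B. finite B \<and> elems M = fun_vs.span B) \<and>
     (\<forall>v\<in>elems M. \<forall>a\<in>carrier A. ract M v a \<in> elems M) \<and>
     (\<forall>v\<in>elems M. \<forall>w\<in>elems M. \<forall>a\<in>carrier A. ract M (v + w) a = ract M v a + ract M w a) \<and>
     (\<forall>v\<in>elems M. \<forall>a\<in>carrier A. \<forall>b\<in>carrier A.
        ract M v (a \<oplus>\<^bsub>A\<^esub> b) = ract M v a + ract M v b) \<and>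
     (\<forall>c. \<forall>v\<in>elems M. \<forall>a\<in>carrier A.
        ract M (fscale c v) a = fscale c (ract M v a) \<and>
        ract M v (c \<odot>\<^bsub>A\<^esub> a) = fscale c (ract M v a)) \<and>
     (\<forall>v\<in>elems M. ract M v \<one>\<^bsub>A\<^esub> = v) \<and>
     (\<forall>v\<in>elems M. \<forall>a\<in>carrier A. \<forall>b\<in>carrier A.
        ract M v (a \<otimes>\<^bsub>A\<^esub> b) = ract M (ract M v a) b)"

text \<open>Only the values of a homomorphism on the elements of its source are relevant.\<close>

definition module_hom ::
  "('k::field, 'a) module \<Rightarrow> ('k, 'a, 'i) rmodule \<Rightarrow> ('k, 'a, 'j) rmodule \<Rightarrow>
     (('i \<Rightarrow> 'k) \<Rightarrow> ('j \<Rightarrow> 'k)) set" where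
  "module_hom A M N =
     {h. (\<forall>v\<in>elems M. h v \<in> elems N) \<and>
         (\<forall>v\<in>elems M. \<forall>w\<in>elems M. h (v + w) = h v + h w) \<and>
         (\<forall>c. \<forall>v\<in>elems M. h (fscale c v) = fscale c (h v)) \<and>
         (\<forall>v\<in>elems M. \<forall>a\<in>carrier A. h (ract M v a) = ract N (h v) a)}"

definition projective_module :: "('k::field, 'a) module \<Rightarrow> ('k, 'a, nat) rmodule \<Rightarrow> bool" where
  "projective_module A P \<longleftrightarrow> right_module A P \<and>
     (\<forall>(M :: ('k, 'a, nat) rmodule) (N :: ('k, 'a, nat) rmodule). \<forall>g h.
        right_module A M \<and> right_module A N \<and>
        g \<in> module_hom A M N \<and> g ` elems M = elems N \<and> h \<in> module_hom A P N \<longrightarrow>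
        (\<exists>l\<in>module_hom A P M. \<forall>v\<in>elems P. g (l v) = h v))"

definition injective_module :: "('k::field, 'a) module \<Rightarrow> ('k, 'a, nat) rmodule \<Rightarrow> bool" where
  "injective_module A J \<longleftrightarrow> right_module A J \<and>
     (\<forall>(M :: ('k, 'a, nat) rmodule) (N :: ('k, 'a, nat) rmodule). \<forall>g h.
        right_module A M \<and> right_module A N \<and>
        g \<in> module_hom A M N \<and> inj_on g (elems M) \<and> h \<in> module_hom A M J \<longrightarrow>
        (\<exists>l\<in>module_hom A N J. \<forall>v\<in>elems M. l (g v) = h v))"

definition submodule :: "('k::field, 'a) module \<Rightarrow> ('i \<Rightarrow> 'k) set \<Rightarrow> ('k, 'a, 'i) rmodule \<Rightarrow> bool"
  where
  "submodule A U M \<longleftrightarrow> fun_vs.subspace U \<and> U \<subseteq> elems M \<and>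
     (\<forall>u\<in>U. \<forall>a\<in>carrier A. ract M u a \<in> U)"

definition indecomposable_module :: "('k::field, 'a) module \<Rightarrow> ('k, 'a, 'i) rmodule \<Rightarrow> bool" where
  "indecomposable_module A M \<longleftrightarrow> right_module A M \<and> elems M \<noteq> {0} \<and>
     (\<forall>U V. submodule A U M \<and> submodule A V M \<and> U \<inter> V = {0} \<and>
        elems M = {u + v | u v. u \<in> U \<and> v \<in> V} \<longrightarrow> U = {0} \<or> V = {0})"


section \<open>The bounded derived category\<close>

record ('k, 'a, 'i) cplx =
  obj :: "int \<Rightarrow> ('k, 'a, 'i) rmodule"
  diff :: "int \<Rightarrow> ('i \<Rightarrow> 'k) \<Rightarrow> ('i \<Rightarrow> 'k)"

text \<open>Complexes are graded cohomologically: \<open>diff X m\<close> maps degree \<open>m\<close> to degree \<open>m + 1\<close>.\<close>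

definition bounded_complex :: "('k::field, 'a) module \<Rightarrow> ('k, 'a, 'i) cplx \<Rightarrow> bool" where
  "bounded_complex A X \<longleftrightarrow>
     (\<forall>m. right_module A (obj X m)) \<and>
     (\<forall>m. diff X m \<in> module_hom A (obj X m) (obj X (m + 1))) \<and>
     (\<forall>m. \<forall>v\<in>elems (obj X m). diff X (m + 1) (diff X m v) = 0) \<and>
     (\<exists>a b. \<forall>m. m < a \<or> b < m \<longrightarrow> elems (obj X m) = {0})"

definition cocycles :: "('k::field, 'a, 'i) cplx \<Rightarrow> int \<Rightarrow> ('i \<Rightarrow> 'k) set" where
  "cocycles X m = {v \<in> elems (obj X m). diff X m v = 0}"

definition coboundaries :: "('k::field, 'a, 'i) cplx \<Rightarrow> int \<Rightarrow> ('i \<Rightarrow> 'k) set" where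
  "coboundaries X m = diff X (m - 1) ` elems (obj X (m - 1))"

definition chain_map ::
  "('k::field, 'a) module \<Rightarrow> ('k, 'a, 'i) cplx \<Rightarrow> ('k, 'a, 'j) cplx \<Rightarrow>
     (int \<Rightarrow> ('i \<Rightarrow> 'k) \<Rightarrow> ('j \<Rightarrow> 'k)) \<Rightarrow> bool" where
  "chain_map A X Y f \<longleftrightarrow>
     (\<forall>m. f m \<in> module_hom A (obj X m) (obj Y m)) \<and>
     (\<forall>m. \<forall>v\<in>elems (obj X m). f (m + 1) (diff X m v) = diff Y m (f m v))"

text \<open>
  The two last conjuncts spell out that the induced map from
  \<open>cocycles X m / coboundaries X m\<close> to \<open>cocycles Y m / coboundaries Y m\<close> is injective and
  surjective.
\<close>

definition quasi_iso ::
  "('k::field, 'a) module \<Rightarrow> ('k, 'a, 'i) cplx \<Rightarrow> ('k, 'a, 'j) cplx \<Rightarrow>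
     (int \<Rightarrow> ('i \<Rightarrow> 'k) \<Rightarrow> ('j \<Rightarrow> 'k)) \<Rightarrow> bool" where
  "quasi_iso A X Y f \<longleftrightarrow> chain_map A X Y f \<and>
     (\<forall>m. \<forall>v\<in>cocycles X m. f m v \<in> coboundaries Y m \<longrightarrow> v \<in> coboundaries X m) \<and>
     (\<forall>m. \<forall>w\<in>cocycles Y m. \<exists>v\<in>cocycles X m. w - f m v \<in> coboundaries Y m)"

text \<open>
  Isomorphisms in the bounded derived category are the roofs \<open>X \<leftarrow> Z \<rightarrow> Y\<close> of two
  quasi-isomorphisms.
\<close>

definition derived_iso ::
  "('k::field, 'a) module \<Rightarrow> ('k, 'a, 'i) cplx \<Rightarrow> ('k, 'a, 'j) cplx \<Rightarrow> bool" where
  "derived_iso A X Y \<longleftrightarrow>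
     (\<exists>(Z :: ('k, 'a, nat) cplx) f g.
        bounded_complex A Z \<and> quasi_iso A Z X f \<and> quasi_iso A Z Y g)"

definition zero_module :: "('k::field, 'a, 'i) rmodule" where
  "zero_module = \<lparr>elems = {0}, ract = (\<lambda>v a. 0)\<rparr>"

definition stalk :: "('k::field, 'a, 'i) rmodule \<Rightarrow> ('k, 'a, 'i) cplx" where
  "stalk M = \<lparr>obj = (\<lambda>m. if m = 0 then M else zero_module), diff = (\<lambda>m v. 0)\<rparr>"

text \<open>\<open>shift k X\<close> is the complex \<open>X[k]\<close>.\<close>

definition shift :: "int \<Rightarrow> ('k::field, 'a, 'i) cplx \<Rightarrow> ('k, 'a, 'i) cplx" where
  "shift k X =
     \<lparr>obj = (\<lambda>m. obj X (m + k)),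
      diff = (\<lambda>m v. fscale (if even k then 1 else - 1) (diff X (m + k) v))\<rparr>"

text \<open>
  For a finite-dimensional algebra it makes no difference whether the global dimension is
  computed with all modules or with the finite-dimensional ones.
\<close>

definition global_dim_le :: "('k::field, 'a) module \<Rightarrow> nat \<Rightarrow> bool" where
  "global_dim_le A n \<longleftrightarrow>
     (\<forall>M :: ('k, 'a, nat) rmodule. right_module A M \<longrightarrow>
        (\<exists>(Q :: ('k, 'a, nat) cplx) f.
           bounded_complex A Q \<and> (\<forall>m. projective_module A (obj Q m)) \<and>
           (\<forall>m. m < - int n \<or> 0 < m \<longrightarrow> elems (obj Q m) = {0}) \<and>
           quasi_iso A Q (stalk M) f))"


section \<open>The Nakayama functor\<close>

text \<open>
  The Nakayama functor is \<open>D Hom\<^sub>A(-, A)\<close> with \<open>D = Hom\<^sub>k(-, k)\<close>. For a right module \<open>M\<close> the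
  space \<open>Hom\<^sub>A(M, A)\<close> is a left module by \<open>(a f)(v) = a f(v)\<close>, hence its dual is a right
  module by \<open>(\<phi> a)(f) = \<phi>(a f)\<close>. Functions are normalised outside of their domains
  (to \<open>undefined\<close> for \<open>Hom\<^sub>A(M, A)\<close> and to \<open>0\<close> for the linear forms), so that equality of
  homomorphisms and of linear forms is equality in HOL.
\<close>

definition hom_alg ::
  "('k::field, 'a) module \<Rightarrow> ('k, 'a, 'i) rmodule \<Rightarrow> (('i \<Rightarrow> 'k) \<Rightarrow> 'a) set" where
  "hom_alg A M =
     {f \<in> elems M \<rightarrow>\<^sub>E carrier A.
        (\<forall>v\<in>elems M. \<forall>w\<in>elems M. f (v + w) = f v \<oplus>\<^bsub>A\<^esub> f w) \<and>
        (\<forall>c. \<forall>v\<in>elems M. f (fscale c v) = c \<odot>\<^bsub>A\<^esub> f v) \<and>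
        (\<forall>v\<in>elems M. \<forall>a\<in>carrier A. f (ract M v a) = f v \<otimes>\<^bsub>A\<^esub> a)}"

definition nakayama_obj ::
  "('k::field, 'a) module \<Rightarrow> ('k, 'a, 'i) rmodule \<Rightarrow> ('k, 'a, ('i \<Rightarrow> 'k) \<Rightarrow> 'a) rmodule" where
  "nakayama_obj A M =
     \<lparr>elems =
        {\<phi>. (\<forall>f. f \<notin> hom_alg A M \<longrightarrow> \<phi> f = 0) \<and>
            (\<forall>f\<in>hom_alg A M. \<forall>g\<in>hom_alg A M.
               \<phi> (\<lambda>v\<in>elems M. f v \<oplus>\<^bsub>A\<^esub> g v) = \<phi> f + \<phi> g) \<and>
            (\<forall>c. \<forall>f\<in>hom_alg A M. \<phi> (\<lambda>v\<in>elems M. c \<odot>\<^bsub>A\<^esub> f v) = c * \<phi> f)},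
      ract = (\<lambda>\<phi> a f. if f \<in> hom_alg A M then \<phi> (\<lambda>v\<in>elems M. a \<otimes>\<^bsub>A\<^esub> f v) else 0)\<rparr>"

definition nakayama_map ::
  "('k::field, 'a) module \<Rightarrow> ('k, 'a, 'i) rmodule \<Rightarrow> ('k, 'a, 'j) rmodule \<Rightarrow>
     (('i \<Rightarrow> 'k) \<Rightarrow> ('j \<Rightarrow> 'k)) \<Rightarrow> ((('i \<Rightarrow> 'k) \<Rightarrow> 'a) \<Rightarrow> 'k) \<Rightarrow> ((('j \<Rightarrow> 'k) \<Rightarrow> 'a) \<Rightarrow> 'k)" where
  "nakayama_map A M N h \<phi> =
     (\<lambda>g. if g \<in> hom_alg A N then \<phi> (\<lambda>v\<in>elems M. g (h v)) else 0)"

definition nakayama_complex ::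
  "('k::field, 'a) module \<Rightarrow> ('k, 'a, 'i) cplx \<Rightarrow> ('k, 'a, ('i \<Rightarrow> 'k) \<Rightarrow> 'a) cplx" where
  "nakayama_complex A Q =
     \<lparr>obj = (\<lambda>m. nakayama_obj A (obj Q m)),
      diff = (\<lambda>m. nakayama_map A (obj Q m) (obj Q (m + 1)) (diff Q m))\<rparr>"

text \<open>
  \<open>derived_nakayama A X Y\<close> expresses \<open>\<nu> X \<cong> Y\<close> in the bounded derived category, where
  \<open>\<nu> = D RHom\<^sub>A(-, A)\<close> is computed on a bounded projective resolution \<open>Q\<close> of \<open>X\<close>. Such a
  resolution exists whenever the global dimension is finite.
\<close>

definition derived_nakayama ::
  "('k::field, 'a) module \<Rightarrow> ('k, 'a, nat) cplx \<Rightarrow> ('k, 'a, nat) cplx \<Rightarrow> bool" where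
  "derived_nakayama A X Y \<longleftrightarrow> bounded_complex A X \<and> bounded_complex A Y \<and>
     (\<exists>(Q :: ('k, 'a, nat) cplx) f.
        bounded_complex A Q \<and> (\<forall>m. projective_module A (obj Q m)) \<and>
        quasi_iso A Q X f \<and> derived_iso A (nakayama_complex A Q) Y)"

text \<open>\<open>\<nu>\<^sub>n = \<nu> \<circ> [-n]\<close>\<close>

definition nu :: "nat \<Rightarrow> ('k::field, 'a) module \<Rightarrow> ('k, 'a, nat) cplx \<Rightarrow> ('k, 'a, nat) cplx \<Rightarrow> bool"
  where
  "nu n A X Y \<longleftrightarrow> derived_nakayama A (shift (- int n) X) Y"

text \<open>
  \<open>nu_neg_power n A i X Y\<close> expresses \<open>\<nu>\<^sub>n\<^sup>-\<^sup>i X \<cong> Y\<close>. As \<open>\<nu>\<^sub>n\<close> is an autoequivalence, \<open>\<nu>\<^sub>n\<^sup>-\<^sup>1 W\<close> is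
  the object \<open>Y\<close>, unique up to isomorphism, with \<open>\<nu>\<^sub>n Y \<cong> W\<close>.
\<close>

primrec nu_neg_power ::
  "nat \<Rightarrow> ('k::field, 'a) module \<Rightarrow> nat \<Rightarrow> ('k, 'a, nat) cplx \<Rightarrow> ('k, 'a, nat) cplx \<Rightarrow> bool" where
  "nu_neg_power n A 0 X Y \<longleftrightarrow> bounded_complex A X \<and> bounded_complex A Y \<and> derived_iso A X Y"
| "nu_neg_power n A (Suc i) X Y \<longleftrightarrow> (\<exists>W. nu_neg_power n A i X W \<and> nu n A Y W)"

definition n_representation_finite :: "nat \<Rightarrow> ('k::field, 'a) module \<Rightarrow> bool" where
  "n_representation_finite n A \<longleftrightarrow> fd_algebra A \<and> global_dim_le A n \<and>
     (\<forall>P. projective_module A P \<and> indecomposable_module A P \<longrightarrow>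
        (\<exists>i J. injective_module A J \<and> indecomposable_module A J \<and>
               nu_neg_power n A i (stalk P) (stalk J)))"


section \<open>Bound quiver algebras\<close>

text \<open>
  A quiver is a directed multigraph; a path is a pair of its start vertex and its list of arrows
  in the order of traversal, and the product \<open>p q\<close> of paths is "first \<open>p\<close>, then \<open>q\<close>".
\<close>

type_synonym ('v, 'e) qpath = "'v \<times> 'e list"

definition qpaths :: "('v, 'e) pre_digraph \<Rightarrow> ('v, 'e) qpath set" where
  "qpaths G = {(u, p). \<exists>v. pre_digraph.awalk G u p v}"

definition path_mult ::
  "('v, 'e) pre_digraph \<Rightarrow> (('v, 'e) qpath \<Rightarrow> 'k::field) \<Rightarrow> (('v, 'e) qpath \<Rightarrow> 'k) \<Rightarrow>
     ('v, 'e) qpath \<Rightarrow> 'k" where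
  "path_mult G f g =
     (\<lambda>(u, p). \<Sum>k\<le>length p. f (u, take k p) * g (pre_digraph.awlast G u (take k p), drop k p))"

definition path_algebra ::
  "('v, 'e) pre_digraph \<Rightarrow> ('k::field, ('v, 'e) qpath \<Rightarrow> 'k) module" where
  "path_algebra G =
     \<lparr>carrier = {f. finite {p. f p \<noteq> 0} \<and> {p. f p \<noteq> 0} \<subseteq> qpaths G},
      mult = path_mult G,
      one = (\<lambda>(u, p). if u \<in> verts G \<and> p = [] then 1 else 0),
      zero = 0,
      add = (+),
      smult = fscale\<rparr>"

definition path_elem :: "('v, 'e) qpath \<Rightarrow> ('v, 'e) qpath \<Rightarrow> 'k::field" where
  "path_elem p = (\<lambda>q. if q = p then 1 else 0)"

definition arrow_ideal :: "('v, 'e) pre_digraph \<Rightarrow> (('v, 'e) qpath \<Rightarrow> 'k::field) set" where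
  "arrow_ideal G = genideal (path_algebra G) {path_elem (tail G e, [e]) | e. e \<in> arcs G}"

definition admissible_ideal ::
  "('v, 'e) pre_digraph \<Rightarrow> (('v, 'e) qpath \<Rightarrow> 'k::field) set \<Rightarrow> bool" where
  "admissible_ideal G I \<longleftrightarrow>
     ideal I (path_algebra G) \<and>
     (\<exists>m::nat. m \<ge> 2 \<and> arrow_ideal G [^]\<^bsub>ideals_set (path_algebra G)\<^esub> m \<subseteq> I) \<and>
     I \<subseteq> arrow_ideal G [^]\<^bsub>ideals_set (path_algebra G)\<^esub> (2::nat)"

text \<open>
  The quotient ring of HOL-Algebra, with the scalar multiplication
  \<open>c (I + x) = I + c x\<close> added.
\<close>

definition bound_quiver_algebra ::
  "('v, 'e) pre_digraph \<Rightarrow> (('v, 'e) qpath \<Rightarrow> 'k::field) set \<Rightarrow>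
     ('k, (('v, 'e) qpath \<Rightarrow> 'k) set) module" where
  "bound_quiver_algebra G I =
     (let L = path_algebra G Quot I in
      \<lparr>carrier = carrier L, mult = mult L, one = one L, zero = zero L, add = add L,
       smult = (\<lambda>c C. \<Union>x\<in>C. I +>\<^bsub>path_algebra G\<^esub> fscale c x)\<rparr>)"


section \<open>Star algebras\<close>

datatype star_vertex = Vx nat | Vz | Vy nat

datatype star_arrow = Arr_a nat | Arr_b nat

definition star_quiver :: "nat \<Rightarrow> nat \<Rightarrow> (star_vertex, star_arrow) pre_digraph" where
  "star_quiver r s =
     \<lparr>verts = Vx ` {1..r} \<union> {Vz} \<union> Vy ` {1..s},
      arcs = Arr_a ` {1..r} \<union> Arr_b ` {1..s},
      tail = (\<lambda>e. case e of Arr_a i \<Rightarrow> Vx i | Arr_b j \<Rightarrow> Vz),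
      head = (\<lambda>e. case e of Arr_a i \<Rightarrow> Vz | Arr_b j \<Rightarrow> Vy j)\<rparr>"

text \<open>The quiver \<open>B\<^sub>\<Lambda>\<close>; the arrow \<open>\<beta>\<^sub>j\<^sub>i\<close> from \<open>y\<^sub>j\<close> to \<open>x\<^sub>i\<close> is the pair \<open>(j, i)\<close>.\<close>

definition star_B ::
  "nat \<Rightarrow> nat \<Rightarrow> ((star_vertex, star_arrow) qpath \<Rightarrow> 'k::field) set \<Rightarrow>
     (star_vertex, nat \<times> nat) pre_digraph" where
  "star_B r s I =
     \<lparr>verts = Vx ` {1..r} \<union> Vy ` {1..s},
      arcs = {(j, i). i \<in> {1..r} \<and> j \<in> {1..s} \<and> path_elem (Vx i, [Arr_a i, Arr_b j]) \<notin> I},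
      tail = (\<lambda>(j, i). Vy j),
      head = (\<lambda>(j, i). Vx i)\<rparr>"

definition underlying_degree :: "('v, 'e) pre_digraph \<Rightarrow> 'v \<Rightarrow> nat" where
  "underlying_degree G v = in_degree G v + out_degree G v"

definition semi_regular ::
  "nat \<Rightarrow> nat \<Rightarrow> (star_vertex, 'e) pre_digraph \<Rightarrow> nat \<Rightarrow> nat \<Rightarrow> bool" where
  "semi_regular r s B \<Sigma>1 \<Sigma>2 \<longleftrightarrow>
     (\<forall>i\<in>{1..r}. underlying_degree B (Vx i) = \<Sigma>1) \<and>
     (\<forall>j\<in>{1..s}. underlying_degree B (Vy j) = \<Sigma>2)"

end

theory Submission
  imports Defs "HOL-Library.Countable_Set"
begin

text \<open>
  The path algebra quotient \<open>\<Lambda>\<close> has a multiplicative basis of paths without oriented cycles. Dimension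
  vectors (Euler characteristics of the parts \<open>X e\<^sub>v\<close>) are invariant under quasi-isomorphisms, and
  finitely generated projectives are free on paths, so on dimension vectors \<open>\<nu>\<^sub>2\<close> acts as the linear
  map \<open>\<Phi>\<close> that takes \<open>[P\<^sub>v]\<close> to \<open>[I\<^sub>v]\<close>. If \<open>\<Lambda>\<close> is 2-representation-finite, then some positive power
  of \<open>\<Phi>\<^sup>-\<^sup>1\<close> takes each \<open>[P\<^sub>v]\<close> to some \<open>[P\<^sub>w]\<close>, hence all orbits of the \<open>[P\<^sub>v]\<close> are finite.

  When \<open>B\<^sub>\<Lambda>\<close> is semi-regular, summing the coordinates at the \<open>x\<^sub>i\<close> and at the \<open>y\<^sub>j\<close> makes \<open>\<Phi>\<close> descend
  to \<open>\<int>\<^sup>3\<close>, with trace \<open>3 - N\<close> for \<open>N = \<Sigma>\<^sub>1 \<Sigma>\<^sub>2 + r + s - r \<Sigma>\<^sub>1\<close> and characteristic polynomial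
  \<open>(X - 1) (X\<^sup>2 - (2 - N) X + 1)\<close>. Finite orbits force \<open>\<bar>2 - N\<bar> \<le> 2\<close>, and \<open>N = 0\<close> would make \<open>\<Phi>\<close>
  unipotent, hence trivial on a finite orbit, which it is not.
\<close>

section \<open>Linear algebra in function spaces\<close>

text \<open>Objects of the derived category are given only through roofs of quasi-isomorphisms, and
  \<open>nu\<close> is only a relation between complexes. Hence the proof keeps nothing of an object
  but its dimension vector, on which the relation becomes linear once the classes of projectives and
  injectives are known. For this, modules that are projective or injective by a lifting property
  have to be recognised: every projective is a direct sum of the P_v, every indecomposable injective
  has the dimension vector of some I_c. The Cartan matrix is never inverted; it suffices that a
  complex of projectives and its image have the same coefficients with respect to the [P_v] and the
  [I_v].

  Semi-regularity enters through the 0-1 matrix that records which paths a_i b_j are nonzero. Its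
  row sums are \<Sigma>1 and its column sums \<Sigma>2, so after summation over the x_i and the y_j
  only these two numbers remain of it; counting its entries in two ways gives (a). The bound in (b)
  needs no eigenvalues: it comes from sums of squares over a finite invariant set of integer
  vectors. The class (0, 0, 1) of the projective at a sink y_j keeps these sums positive.\<close>

definition fd_subspace :: "('i \<Rightarrow> 'k::field) set \<Rightarrow> bool" where
  "fd_subspace V \<longleftrightarrow> fun_vs.subspace V \<and> (\<exists>B. finite B \<and> V = fun_vs.span B)"

text \<open>Linearity is required on V only, because homomorphisms of modules are unconstrained off
  the elements of their source.\<close>

definition linear_on :: "('i \<Rightarrow> 'k::field) set \<Rightarrow> (('i \<Rightarrow> 'k) \<Rightarrow> ('j \<Rightarrow> 'k)) \<Rightarrow> bool" where
  "linear_on V f \<longleftrightarrow> (\<forall>v\<in>V. \<forall>w\<in>V. f (v + w) = f v + f w) \<and>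
     (\<forall>c. \<forall>v\<in>V. f (fscale c v) = fscale c (f v))"

lemma fscale_apply: "fscale c v i = c * v i"
  by (simp add: fscale_def)

lemma sum_fun_apply: "(\<Sum>x\<in>X. f x) i = (\<Sum>x\<in>X. f x i)"
  by (induction X rule: infinite_finite_induct) auto

lemma subspace_diff_mem: "fun_vs.subspace V \<Longrightarrow> x \<in> V \<Longrightarrow> y \<in> V \<Longrightarrow> x - y \<in> V"
  by (rule fun_vs.subspace_diff)

lemma linear_on_zero:
  assumes "fun_vs.subspace V" "linear_on V f"
  shows "f 0 = 0"
proof -
  have "0 \<in> V" using assms(1) by (rule fun_vs.subspace_0)
  then have "f (fscale 0 0) = fscale 0 (f 0)" using assms(2) unfolding linear_on_def by blast
  then show ?thesis by simp
qed

lemma linear_on_diff: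
  assumes "fun_vs.subspace V" "linear_on V f" "v \<in> V" "w \<in> V"
  shows "f (v - w) = f v - f w"
proof -
  have "v - w \<in> V" using assms by (intro subspace_diff_mem)
  then have "f (v - w + w) = f (v - w) + f w"
    using assms unfolding linear_on_def by blast
  then show ?thesis by (simp add: algebra_simps)
qed

lemma linear_on_sum:
  assumes V: "fun_vs.subspace V" and f: "linear_on V f" and w: "\<And>x. x \<in> X \<Longrightarrow> w x \<in> V"
  shows "f (\<Sum>x\<in>X. w x) = (\<Sum>x\<in>X. f (w x))"
  using w
proof (induction X rule: infinite_finite_induct)
  case (insert x F)
  have "(\<Sum>x\<in>F. w x) \<in> V" by (intro fun_vs.subspace_sum V insert.prems) auto
  then have "f (w x + (\<Sum>x\<in>F. w x)) = f (w x) + f (\<Sum>x\<in>F. w x)"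
    using insert.prems f unfolding linear_on_def by blast
  also have "f (\<Sum>x\<in>F. w x) = (\<Sum>x\<in>F. f (w x))" using insert by blast
  finally show ?case unfolding sum.insert[OF insert.hyps] .
qed (auto simp: linear_on_zero[OF V f])

lemma linear_on_sum_scale:
  assumes V: "fun_vs.subspace V" and f: "linear_on V f" and w: "\<And>x. x \<in> X \<Longrightarrow> w x \<in> V"
  shows "f (\<Sum>x\<in>X. fscale (c x) (w x)) = (\<Sum>x\<in>X. fscale (c x) (f (w x)))"
proof -
  have "f (\<Sum>x\<in>X. fscale (c x) (w x)) = (\<Sum>x\<in>X. f (fscale (c x) (w x)))"
    by (rule linear_on_sum[OF V f]) (auto intro: fun_vs.subspace_scale V w)
  also have "\<dots> = (\<Sum>x\<in>X. fscale (c x) (f (w x)))"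
    using f w unfolding linear_on_def by (intro sum.cong) auto
  finally show ?thesis .
qed

lemma linear_on_subset: "linear_on V f \<Longrightarrow> U \<subseteq> V \<Longrightarrow> linear_on U f"
  unfolding linear_on_def by blast

lemma subspace_image:
  assumes V: "fun_vs.subspace V" and f: "linear_on V f"
  shows "fun_vs.subspace (f ` V)"
proof (unfold fun_vs.subspace_def, intro conjI ballI allI)
  show "0 \<in> f ` V" using linear_on_zero[OF V f] fun_vs.subspace_0[OF V] by (metis image_eqI)
next
  fix x y assume "x \<in> f ` V" "y \<in> f ` V"
  then obtain v w where "x = f v" "y = f w" "v \<in> V" "w \<in> V" by blast
  then show "x + y \<in> f ` V"
    using f fun_vs.subspace_add[OF V] unfolding linear_on_def by (metis image_eqI)
next
  fix c x assume "x \<in> f ` V"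
  then obtain v where "x = f v" "v \<in> V" by blast
  then show "fscale c x \<in> f ` V"
    using f fun_vs.subspace_scale[OF V] unfolding linear_on_def by (metis image_eqI)
qed

lemma subspace_vimage:
  assumes V: "fun_vs.subspace V" and f: "linear_on V f" and B: "fun_vs.subspace B"
  shows "fun_vs.subspace {v \<in> V. f v \<in> B}"
proof (unfold fun_vs.subspace_def, intro conjI ballI allI)
  show "0 \<in> {v \<in> V. f v \<in> B}"
    using linear_on_zero[OF V f] fun_vs.subspace_0[OF V] fun_vs.subspace_0[OF B] by simp
next
  fix x y assume "x \<in> {v \<in> V. f v \<in> B}" "y \<in> {v \<in> V. f v \<in> B}"
  then show "x + y \<in> {v \<in> V. f v \<in> B}"
    using f fun_vs.subspace_add[OF V] fun_vs.subspace_add[OF B] unfolding linear_on_def by simp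
next
  fix c x assume "x \<in> {v \<in> V. f v \<in> B}"
  then show "fscale c x \<in> {v \<in> V. f v \<in> B}"
    using f fun_vs.subspace_scale[OF V] fun_vs.subspace_scale[OF B] unfolding linear_on_def by simp
qed

lemma subspace_kernel:
  assumes "fun_vs.subspace V" "linear_on V f"
  shows "fun_vs.subspace {v \<in> V. f v = 0}"
  using subspace_vimage[OF assms, of "{0}"] by (simp add: fun_vs.subspace_def)

section \<open>Bases and dimension formulas\<close>

lemma dim_family:
  fixes w :: "'x \<Rightarrow> ('i \<Rightarrow> 'k::field)"
  assumes X: "finite X" and V: "fun_vs.subspace V" and w: "\<And>x. x \<in> X \<Longrightarrow> w x \<in> V"
    and span: "\<And>v. v \<in> V \<Longrightarrow> \<exists>c. v = (\<Sum>x\<in>X. fscale (c x) (w x))"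
    and indep: "\<And>c x. (\<Sum>x\<in>X. fscale (c x) (w x)) = 0 \<Longrightarrow> x \<in> X \<Longrightarrow> c x = 0"
  shows "fun_vs.dim V = card X" and "fd_subspace V"
proof -
  have inj: "inj_on w X"
  proof (rule inj_onI, rule ccontr)
    fix x y assume xy: "x \<in> X" "y \<in> X" "w x = w y" "x \<noteq> y"
    \<comment> \<open>A repeated vector would satisfy a relation with coefficients 1 and -1, so
      independence of the family makes it injective.\<close>
    let ?c = "\<lambda>z. if z = x then (1::'k) else if z = y then - 1 else 0"
    have "(\<Sum>z\<in>X. fscale (?c z) (w z)) = (\<Sum>z\<in>{x,y}. fscale (?c z) (w z))"
      using xy X by (intro sum.mono_neutral_right) auto
    also have "\<dots> = 0" using xy by simp
    finally show False using indep[of ?c x] xy by simp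
  qed
  have "V \<subseteq> fun_vs.span (w ` X)"
  proof
    fix v assume "v \<in> V"
    then obtain c where "v = (\<Sum>x\<in>X. fscale (c x) (w x))" using span by blast
    then show "v \<in> fun_vs.span (w ` X)"
      by (auto intro!: fun_vs.span_sum fun_vs.span_scale intro: fun_vs.span_base)
  qed
  moreover have "fun_vs.span (w ` X) \<subseteq> V"
    using w V by (intro fun_vs.span_minimal) auto
  ultimately have eq: "V = fun_vs.span (w ` X)" by blast
  then show "fd_subspace V" using V X unfolding fd_subspace_def by blast
  have "fun_vs.independent (w ` X)"
  proof (rule fun_vs.independent_if_scalars_zero)
    fix f y assume *: "(\<Sum>x\<in>w ` X. fscale (f x) x) = 0" "y \<in> w ` X"
    have "(\<Sum>x\<in>X. fscale (f (w x)) (w x)) = 0"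
      using *(1) sum.reindex[OF inj, of "\<lambda>x. fscale (f x) x"] by simp
    then show "f y = 0" using indep[of "f \<circ> w"] *(2) by auto
  qed (use X in simp)
  then have "fun_vs.dim V = card (w ` X)"
    using eq fun_vs.dim_span_eq_card_independent by blast
  then show "fun_vs.dim V = card X" using inj by (simp add: card_image)
qed

lemma independent_coeff_zero:
  assumes "fun_vs.independent B" "finite B" "(\<Sum>x\<in>B. fscale (c x) x) = 0" "x \<in> B"
  shows "c x = 0"
  using assms unfolding fun_vs.independent_explicit_finite_subsets by blast

lemma fd_subspace_basis_extend:
  fixes S :: "('i \<Rightarrow> 'k::field) set"
  assumes V: "fd_subspace V" and S: "S \<subseteq> V" "fun_vs.independent S"
  obtains D where "S \<subseteq> D" "D \<subseteq> V" "fun_vs.independent D" "finite D" "V = fun_vs.span D"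
proof -
  obtain D where D: "S \<subseteq> D" "D \<subseteq> V" "fun_vs.independent D" "V \<subseteq> fun_vs.span D"
    using fun_vs.maximal_independent_subset_extend[OF S] by blast
  obtain B where "finite B" "V = fun_vs.span B" using V unfolding fd_subspace_def by blast
  then have "finite D" using fun_vs.independent_span_bound[of B D] D by blast
  moreover have "V = fun_vs.span D"
  proof (rule subset_antisym[OF D(4)])
    show "fun_vs.span D \<subseteq> V" using V fun_vs.span_minimal[OF D(2)] unfolding fd_subspace_def by simp
  qed
  ultimately show ?thesis using D that by blast
qed

lemma fd_subspace_basis:
  assumes "fd_subspace V"
  obtains D where "D \<subseteq> V" "fun_vs.independent D" "finite D" "V = fun_vs.span D"
  by (rule fd_subspace_basis_extend[OF assms empty_subsetI fun_vs.independent_empty]) (rule that)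

lemma fd_subspace_subset:
  assumes V: "fd_subspace V" and U: "fun_vs.subspace U" "U \<subseteq> V"
  shows "fd_subspace U"
proof -
  obtain C where C: "C \<subseteq> U" "fun_vs.independent C" "U \<subseteq> fun_vs.span C"
    using fun_vs.maximal_independent_subset by blast
  obtain B where "finite B" "V = fun_vs.span B" using V unfolding fd_subspace_def by blast
  then have "finite C" using fun_vs.independent_span_bound[of B C] C U by blast
  moreover have "U = fun_vs.span C" using C U(1) fun_vs.span_minimal by blast
  ultimately show ?thesis using U unfolding fd_subspace_def by blast
qed

lemma fd_subspace_image:
  assumes V: "fd_subspace V" and f: "linear_on V f"
  shows "fd_subspace (f ` V)"
proof -
  obtain D where D: "D \<subseteq> V" "finite D" "V = fun_vs.span D"
    by (rule fd_subspace_basis[OF V])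
  have Vs: "fun_vs.subspace V" using V unfolding fd_subspace_def by blast
  have "f ` V \<subseteq> fun_vs.span (f ` D)"
  proof
    fix y assume "y \<in> f ` V"
    then obtain v where v: "y = f v" "v \<in> V" by blast
    then obtain c where "v = (\<Sum>x\<in>D. fscale (c x) x)"
      using D fun_vs.span_finite[of D] by auto
    then have "y = (\<Sum>x\<in>D. fscale (c x) (f x))"
      using linear_on_sum_scale[OF Vs f, of D "\<lambda>x. x"] v D by auto
    then show "y \<in> fun_vs.span (f ` D)"
      by (auto intro!: fun_vs.span_sum fun_vs.span_scale intro: fun_vs.span_base)
  qed
  moreover have "fun_vs.span (f ` D) \<subseteq> f ` V"
    using D subspace_image[OF Vs f] by (intro fun_vs.span_minimal) auto
  ultimately show ?thesis
    using D subspace_image[OF Vs f] unfolding fd_subspace_def by blast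
qed

text \<open>The map V \<rightarrow> W / B induced by f is onto and its kernel is the preimage of B.
  The formula is additive, so that quotients and differences of naturals are avoided. With B = 0 it
  is rank and nullity; with cocycles and coboundaries it compares cohomology.\<close>

lemma dim_relative:
  fixes f :: "('i \<Rightarrow> 'k::field) \<Rightarrow> ('j \<Rightarrow> 'k)"
  assumes V: "fd_subspace V" and f: "linear_on V f" and W: "fd_subspace W"
    and B: "fun_vs.subspace B" "B \<subseteq> W" and fV: "f ` V \<subseteq> W"
    and sur: "\<And>w. w \<in> W \<Longrightarrow> \<exists>v\<in>V. w - f v \<in> B"
  shows "fun_vs.dim V + fun_vs.dim B = fun_vs.dim W + fun_vs.dim {v \<in> V. f v \<in> B}"
proof -
  define K where "K = {v \<in> V. f v \<in> B}"
  have Vs: "fun_vs.subspace V" and Ws: "fun_vs.subspace W"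
    using V W unfolding fd_subspace_def by auto
  have Ks: "fun_vs.subspace K" unfolding K_def by (rule subspace_vimage[OF Vs f B(1)])
  have Kf: "fd_subspace K" by (rule fd_subspace_subset[OF V Ks]) (auto simp: K_def)
  have Bf: "fd_subspace B" by (rule fd_subspace_subset[OF W B])
  obtain K0 where K0: "K0 \<subseteq> K" "fun_vs.independent K0" "finite K0" "K = fun_vs.span K0"
    by (rule fd_subspace_basis[OF Kf])
  have "K0 \<subseteq> V" using K0 K_def by auto
  then obtain D where D: "K0 \<subseteq> D" "D \<subseteq> V" "fun_vs.independent D" "finite D" "V = fun_vs.span D"
    by (rule fd_subspace_basis_extend[OF V _ K0(2)])
  obtain B0 where B0: "B0 \<subseteq> B" "fun_vs.independent B0" "finite B0" "B = fun_vs.span B0"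
    by (rule fd_subspace_basis[OF Bf])
  define C where "C = D - K0"
  have C: "finite C" "C \<subseteq> V" using D C_def by auto
  \<comment> \<open>The basis of W consists of a basis of B and the images of the vectors C that
    extend a basis of the kernel to one of V. The disjoint sum keeps the two kinds apart without
    knowing that their values differ.\<close>
  define w where "w = case_sum f (\<lambda>b. b)"
  let ?X = "C <+> B0"
  have sumX: "(\<Sum>x\<in>?X. fscale (c x) (w x)) =
      (\<Sum>x\<in>C. fscale (c (Inl x)) (f x)) + (\<Sum>x\<in>B0. fscale (c (Inr x)) x)" for c
    using C B0 by (simp add: sum.Plus w_def)
  have fC: "f (\<Sum>x\<in>C. fscale (c x) x) = (\<Sum>x\<in>C. fscale (c x) (f x))" for c
    using linear_on_sum_scale[OF Vs f, of C "\<lambda>x. x"] C by auto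
  have dW: "fun_vs.dim W = card ?X"
  proof (rule dim_family)
    show "finite ?X" using C B0 by simp
    show "fun_vs.subspace W" by (rule Ws)
    show "w x \<in> W" if "x \<in> ?X" for x
      using that C fV B0(1) B(2) by (fastforce simp: w_def)
    show "\<exists>c. u = (\<Sum>x\<in>?X. fscale (c x) (w x))" if u: "u \<in> W" for u
    proof -
      obtain v where v: "v \<in> V" "u - f v \<in> B" using sur[OF u] by blast
      then obtain c where c: "v = (\<Sum>x\<in>D. fscale (c x) x)"
        using D(5) fun_vs.span_finite[OF D(4)] by auto
      define k where "k = (\<Sum>x\<in>K0. fscale (c x) x)"
      have k: "k \<in> K" unfolding k_def K0(4)
        by (auto intro!: fun_vs.span_sum fun_vs.span_scale intro: fun_vs.span_base)
      have "v = (\<Sum>x\<in>C. fscale (c x) x) + k"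
        unfolding c k_def C_def using sum.subset_diff[OF D(1) D(4), of "\<lambda>x. fscale (c x) x"] by simp
      moreover have "(\<Sum>x\<in>C. fscale (c x) x) \<in> V"
        by (intro fun_vs.subspace_sum fun_vs.subspace_scale Vs subsetD[OF C(2)])
      ultimately have fv: "f v = (\<Sum>x\<in>C. fscale (c x) (f x)) + f k"
        using f k fC unfolding linear_on_def K_def by simp
      have "u - f v + f k \<in> B" using v k B fun_vs.subspace_add unfolding K_def by auto
      then obtain e where "u - f v + f k = (\<Sum>x\<in>B0. fscale (e x) x)"
        using B0(4) fun_vs.span_finite[OF B0(3)] by auto
      then have "u = (\<Sum>x\<in>C. fscale (c x) (f x)) + (\<Sum>x\<in>B0. fscale (e x) x)"
        using fv by (simp add: algebra_simps)
      then show ?thesis using sumX[of "case_sum c e"] by (intro exI[of _ "case_sum c e"]) simp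
    qed
    show "c x = 0" if z: "(\<Sum>x\<in>?X. fscale (c x) (w x)) = 0" and x: "x \<in> ?X" for c x
    proof -
      define v where "v = (\<Sum>x\<in>C. fscale (c (Inl x)) x)"
      have b: "(\<Sum>x\<in>B0. fscale (c (Inr x)) x) \<in> B"
        by (intro fun_vs.subspace_sum fun_vs.subspace_scale B(1) subsetD[OF B0(1)])
      have "f v = - (\<Sum>x\<in>B0. fscale (c (Inr x)) x)"
        unfolding eq_neg_iff_add_eq_0 v_def fC sumX[of c, symmetric] by (rule z)
      then have "f v \<in> B" using fun_vs.subspace_neg[OF B(1) b] by (simp only:)
      moreover have "v \<in> V" unfolding v_def
        by (intro fun_vs.subspace_sum fun_vs.subspace_scale Vs subsetD[OF C(2)])
      ultimately have "v \<in> K" unfolding K_def by simp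
      then obtain e where e: "v = (\<Sum>x\<in>K0. fscale (e x) x)"
        using K0(4) fun_vs.span_finite[OF K0(3)] by auto
      \<comment> \<open>The vector v is a combination of C and, lying in the kernel, also one of K0.
        The difference of the two expansions is a relation in the basis D.\<close>
      let ?c = "\<lambda>x. if x \<in> K0 then - e x else c (Inl x)"
      have "(\<Sum>x\<in>D. fscale (?c x) x) = (\<Sum>x\<in>C. fscale (?c x) x) + (\<Sum>x\<in>K0. fscale (?c x) x)"
        unfolding C_def using sum.subset_diff[OF D(1) D(4)] by blast
      also have "(\<Sum>x\<in>C. fscale (?c x) x) = v"
        unfolding v_def by (intro sum.cong) (auto simp: C_def)
      also have "(\<Sum>x\<in>K0. fscale (?c x) x) = - v"
        unfolding e by (simp add: sum_negf)
      finally have "(\<Sum>x\<in>D. fscale (?c x) x) = 0" unfolding add.right_inverse .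
      then have Cz: "c (Inl y) = 0" if "y \<in> C" for y
        using independent_coeff_zero[OF D(3,4), of ?c y] that unfolding C_def by auto
      then have "(\<Sum>x\<in>B0. fscale (c (Inr x)) x) = 0" using z sumX[of c] by simp
      then have "c (Inr y) = 0" if "y \<in> B0" for y
        using independent_coeff_zero[OF B0(2,3), of "\<lambda>x. c (Inr x)" y] that by blast
      then show ?thesis using Cz x by auto
    qed
  qed
  have "card D = card C + card K0"
    unfolding C_def using D K0 by (simp add: card_Diff_subset card_mono)
  moreover have "card ?X = card C + card B0" using C B0 by (simp add: card_Plus)
  moreover have "fun_vs.dim V = card D" "fun_vs.dim B = card B0" "fun_vs.dim K = card K0"
    using D(3,5) K0(2,4) B0(2,4) by (auto intro: fun_vs.dim_eq_card)
  ultimately show ?thesis using dW unfolding K_def by simp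
qed

lemma dim_zero: "fun_vs.dim ({0} :: ('i \<Rightarrow> 'k::field) set) = 0"
  using fun_vs.dim_eq_card[of "{}" "{0}"] fun_vs.independent_empty by simp

lemma rank_nullity:
  fixes f :: "('i \<Rightarrow> 'k::field) \<Rightarrow> ('j \<Rightarrow> 'k)"
  assumes V: "fd_subspace V" and f: "linear_on V f"
  shows "fun_vs.dim V = fun_vs.dim (f ` V) + fun_vs.dim {v \<in> V. f v = 0}"
proof -
  have "fun_vs.dim V + fun_vs.dim ({0} :: ('j \<Rightarrow> 'k) set) =
      fun_vs.dim (f ` V) + fun_vs.dim {v \<in> V. f v \<in> {0}}"
  proof (rule dim_relative[OF V f fd_subspace_image[OF V f]])
    have "fun_vs.subspace (f ` V)" using fd_subspace_image[OF V f] unfolding fd_subspace_def by blast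
    then show "{0} \<subseteq> f ` V" using fun_vs.subspace_0 by blast
  qed (auto simp: fun_vs.subspace_def)
  then show ?thesis by (simp add: dim_zero)
qed

text \<open>Each b m is counted in the adjacent degrees m - 1 and m with opposite signs, so that
  only the two end terms could survive. It removes the ranks of the differentials from an Euler
  characteristic.\<close>

lemma sum_alternating_telescope:
  fixes b :: "int \<Rightarrow> int"
  assumes "n \<ge> 0" and "b (- n) = 0" and "b (n + 1) = 0"
  shows "(\<Sum>m\<in>{-n..n}. (if even m then 1 else - 1) * (b m + b (m + 1))) = 0"
proof -
  have "(\<Sum>m\<in>{-n..-n + int k}. (if even m then 1 else - 1) * (b m + b (m + 1))) =
      (if even (-n + int k) then 1 else -1) * b (-n + int k + 1)" for k
  proof (induction k)
    case 0 then show ?case using assms by simp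
  next
    case (Suc k)
    have "{-n..-n + int (Suc k)} = insert (-n + int (Suc k)) {-n..-n + int k}" by auto
    then show ?case using Suc by (auto simp: algebra_simps)
  qed
  from this[of "nat (2 * n)"] show ?thesis using assms by simp
qed

section \<open>Euler characteristics of complexes\<close>

text \<open>For an idempotent e this is the space M e, described by fixed points so that membership
  is an equation.\<close>

definition wspace :: "('k::field, 'a, 'i) rmodule \<Rightarrow> 'a \<Rightarrow> ('i \<Rightarrow> 'k) set" where
  "wspace M e = {v \<in> elems M. ract M v e = v}"

definition wdim :: "('k::field, 'a, 'i) rmodule \<Rightarrow> 'a \<Rightarrow> nat" where
  "wdim M e = fun_vs.dim (wspace M e)"

text \<open>Summing over the support makes the definition independent of a choice of bounds;
  \<open>euler_bound\<close> replaces the support by any symmetric interval containing it.\<close>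

definition euler :: "('k::field, 'a, 'i) cplx \<Rightarrow> 'a \<Rightarrow> int" where
  "euler X e = (\<Sum>m | wdim (obj X m) e \<noteq> 0. (if even m then 1 else - 1) * int (wdim (obj X m) e))"

lemma wspace_subset: "wspace M e \<subseteq> elems M"
  by (auto simp: wspace_def)

lemma right_moduleD:
  assumes "right_module A M"
  shows "fun_vs.subspace (elems M)" "fd_subspace (elems M)"
    "\<And>v a. v \<in> elems M \<Longrightarrow> a \<in> carrier A \<Longrightarrow> ract M v a \<in> elems M"
    "\<And>v a b. v \<in> elems M \<Longrightarrow> a \<in> carrier A \<Longrightarrow> b \<in> carrier A \<Longrightarrow>
        ract M v (a \<oplus>\<^bsub>A\<^esub> b) = ract M v a + ract M v b"
    "\<And>c v a. v \<in> elems M \<Longrightarrow> a \<in> carrier A \<Longrightarrow> ract M v (c \<odot>\<^bsub>A\<^esub> a) = fscale c (ract M v a)"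
    "\<And>v. v \<in> elems M \<Longrightarrow> ract M v \<one>\<^bsub>A\<^esub> = v"
    "\<And>v a b. v \<in> elems M \<Longrightarrow> a \<in> carrier A \<Longrightarrow> b \<in> carrier A \<Longrightarrow>
        ract M v (a \<otimes>\<^bsub>A\<^esub> b) = ract M (ract M v a) b"
  using assms unfolding right_module_def fd_subspace_def by blast+

lemma ract_linear: "right_module A M \<Longrightarrow> a \<in> carrier A \<Longrightarrow> linear_on (elems M) (\<lambda>v. ract M v a)"
  unfolding right_module_def linear_on_def by blast

lemma ract_zero: "right_module A M \<Longrightarrow> a \<in> carrier A \<Longrightarrow> ract M 0 a = 0"
  using linear_on_zero[OF right_moduleD(1) ract_linear] .

lemma module_homD:
  assumes "h \<in> module_hom A M N"
  shows "linear_on (elems M) h" "\<And>v. v \<in> elems M \<Longrightarrow> h v \<in> elems N"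
    "\<And>v a. v \<in> elems M \<Longrightarrow> a \<in> carrier A \<Longrightarrow> h (ract M v a) = ract N (h v) a"
  using assms unfolding module_hom_def linear_on_def by blast+

lemma module_homI:
  assumes "linear_on (elems M) h" "\<And>v. v \<in> elems M \<Longrightarrow> h v \<in> elems N"
    "\<And>v a. v \<in> elems M \<Longrightarrow> a \<in> carrier A \<Longrightarrow> h (ract M v a) = ract N (h v) a"
  shows "h \<in> module_hom A M N"
  using assms unfolding module_hom_def linear_on_def by blast

lemma wspace_subspace:
  assumes M: "right_module A M" and e: "e \<in> carrier A"
  shows "fun_vs.subspace (wspace M e)"
proof -
  note Ms = right_moduleD(1)[OF M] and lin = ract_linear[OF M e]
  show ?thesis
    unfolding wspace_def fun_vs.subspace_def
    using ract_zero[OF M e] fun_vs.subspace_0[OF Ms] fun_vs.subspace_add[OF Ms]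
      fun_vs.subspace_scale[OF Ms] lin unfolding linear_on_def by auto
qed

lemma wspace_fd: "right_module A M \<Longrightarrow> e \<in> carrier A \<Longrightarrow> fd_subspace (wspace M e)"
  by (rule fd_subspace_subset[OF right_moduleD(2) wspace_subspace]) (auto simp: wspace_def)

lemma module_hom_wspace:
  "h \<in> module_hom A M N \<Longrightarrow> e \<in> carrier A \<Longrightarrow> v \<in> wspace M e \<Longrightarrow> h v \<in> wspace N e"
  unfolding wspace_def module_hom_def by auto metis

lemma ract_wspace:
  assumes "right_module A M" "e \<in> carrier A" "e \<otimes>\<^bsub>A\<^esub> e = e" "v \<in> elems M"
  shows "ract M v e \<in> wspace M e"
  using right_moduleD(3,7)[OF assms(1)] assms unfolding wspace_def by (metis (mono_tags, lifting) mem_Collect_eq)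

lemma wdim_zero:
  assumes "right_module A M" "e \<in> carrier A" "elems M = {0}"
  shows "wdim M e = 0"
proof -
  have "wspace M e = {0}" using ract_zero[OF assms(1,2)] assms(3) by (auto simp: wspace_def)
  then show ?thesis by (simp add: wdim_def dim_zero)
qed

section \<open>Bounded complexes: Euler characteristic and cohomology\<close>

lemma bounded_complexD:
  assumes "bounded_complex A X"
  shows "\<And>m. right_module A (obj X m)" "\<And>m. diff X m \<in> module_hom A (obj X m) (obj X (m + 1))"
    "\<And>m v. v \<in> elems (obj X m) \<Longrightarrow> diff X (m + 1) (diff X m v) = 0"
  using assms unfolding bounded_complex_def by blast+

text \<open>The bound is symmetric and may be enlarged, so that two complexes can be summed over one
  common interval.\<close>

lemma bounded_complex_bound:
  assumes "bounded_complex A X"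
  obtains n where "\<And>k m. k \<ge> n \<Longrightarrow> m < - k \<or> k < m \<Longrightarrow> elems (obj X m) = {0}" "n \<ge> 0"
proof -
  obtain a b where ab: "\<forall>m. m < a \<or> b < m \<longrightarrow> elems (obj X m) = {0}"
    using assms unfolding bounded_complex_def by blast
  show ?thesis by (rule that[of "\<bar>a\<bar> + \<bar>b\<bar>"]) (use ab in auto)
qed

lemma euler_bound:
  assumes "\<And>m. m < - n \<or> n < m \<Longrightarrow> wdim (obj X m) e = 0"
  shows "euler X e = (\<Sum>m\<in>{-n..n}. (if even m then 1 else - 1) * int (wdim (obj X m) e))"
proof -
  have "{m. wdim (obj X m) e \<noteq> 0} \<subseteq> {-n..n}" using assms by (force simp: not_le)
  then show ?thesis unfolding euler_def by (intro sum.mono_neutral_left) auto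
qed

text \<open>By rank and nullity the dimension in degree m is z m + b (m + 1), with z the dimension
  of the cocycles and b that of the coboundaries. This is (z m - b m) + (b m + b (m + 1)), and the
  second part telescopes.\<close>

lemma euler_cohomology:
  fixes X :: "('k::field, 'a, 'i) cplx"
  assumes X: "bounded_complex A X" and e: "e \<in> carrier A" "e \<otimes>\<^bsub>A\<^esub> e = e"
    and n: "n \<ge> 0" "\<And>m. m < - n \<or> n < m \<Longrightarrow> elems (obj X m) = {0}"
  shows "euler X e = (\<Sum>m\<in>{-n..n}. (if even m then 1 else - 1) *
      (int (fun_vs.dim {v \<in> wspace (obj X m) e. diff X m v = 0}) -
       int (fun_vs.dim (diff X (m - 1) ` wspace (obj X (m - 1)) e))))"
proof -
  note XD = bounded_complexD[OF X]
  define z where "z m = int (fun_vs.dim {v \<in> wspace (obj X m) e. diff X m v = 0})" for m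
  define b where "b m = int (fun_vs.dim (diff X (m - 1) ` wspace (obj X (m - 1)) e))" for m
  have lin: "linear_on (wspace (obj X m) e) (diff X m)" for m
    by (rule linear_on_subset[OF module_homD(1)[OF XD(2)]]) (auto simp: wspace_def)
  have w: "int (wdim (obj X m) e) = b (m + 1) + z m" for m
    using rank_nullity[OF wspace_fd[OF XD(1) e(1)] lin] unfolding wdim_def b_def z_def by simp
  \<comment> \<open>The third alternative covers the end term m = - n, whose differential starts in
    degree - n - 1.\<close>
  have b0: "b m = 0" if "m < - n \<or> n < m \<or> elems (obj X (m - 1)) = {0}" for m
  proof -
    have "diff X (m - 1) ` wspace (obj X (m - 1)) e \<subseteq> {0}"
    proof (cases "elems (obj X (m - 1)) = {0}")
      case True
      then have "wspace (obj X (m - 1)) e \<subseteq> {0}" by (auto simp: wspace_def)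
      moreover have "diff X (m - 1) 0 = 0"
        using linear_on_zero[OF wspace_subspace[OF XD(1) e(1)] lin] .
      ultimately show ?thesis by auto
    next
      case False
      then have "elems (obj X m) = {0}" using that n(2)[of m] n(2)[of "m - 1"] by fastforce
      then show ?thesis using module_homD(2)[OF XD(2)[of "m - 1"]] by (auto simp: wspace_def)
    qed
    then have "fun_vs.dim (diff X (m - 1) ` wspace (obj X (m - 1)) e) \<le> card ({} :: ('i \<Rightarrow> 'k) set)"
      by (intro fun_vs.dim_le_card) auto
    then show ?thesis by (simp add: b_def)
  qed
  have "euler X e = (\<Sum>m\<in>{-n..n}. (if even m then 1 else - 1) * int (wdim (obj X m) e))"
    by (rule euler_bound) (use n wdim_zero[OF XD(1) e(1)] in blast)
  also have "\<dots> = (\<Sum>m\<in>{-n..n}. (if even m then 1 else - 1) * (b m + b (m + 1))) +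
      (\<Sum>m\<in>{-n..n}. (if even m then 1 else - 1) * (z m - b m))"
    unfolding w sum.distrib[symmetric] by (intro sum.cong) (auto simp: algebra_simps)
  also have "(\<Sum>m\<in>{-n..n}. (if even m then 1 else - 1) * (b m + b (m + 1))) = 0"
    by (rule sum_alternating_telescope) (use n b0 in auto)
  finally show ?thesis unfolding z_def b_def by simp
qed

text \<open>Since f and the differentials commute with e, multiplying all witnesses by e turns
  bijectivity on cohomology into bijectivity on its e-part. There \<open>dim_relative\<close>
  equates the dimensions degree by degree.\<close>

theorem euler_quasi_iso:
  assumes X: "bounded_complex A X" and Y: "bounded_complex A Y" and q: "quasi_iso A X Y f"
    and e: "e \<in> carrier A" "e \<otimes>\<^bsub>A\<^esub> e = e"
  shows "euler X e = euler Y e"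
proof -
  note XD = bounded_complexD[OF X] and YD = bounded_complexD[OF Y]
  have fh: "f m \<in> module_hom A (obj X m) (obj Y m)" for m
    using q unfolding quasi_iso_def chain_map_def by blast
  have comm: "f (m + 1) (diff X m v) = diff Y m (f m v)" if "v \<in> elems (obj X m)" for m v
    using q that unfolding quasi_iso_def chain_map_def by blast
  have q_inj: "v \<in> cocycles X m \<Longrightarrow> f m v \<in> coboundaries Y m \<Longrightarrow> v \<in> coboundaries X m"
    and q_sur: "w \<in> cocycles Y m \<Longrightarrow> \<exists>v\<in>cocycles X m. w - f m v \<in> coboundaries Y m" for m v w
    using q unfolding quasi_iso_def by blast+
  define zX where "zX m = {v \<in> wspace (obj X m) e. diff X m v = 0}" for m
  define bX where "bX m = diff X (m - 1) ` wspace (obj X (m - 1)) e" for m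
  define zY where "zY m = {v \<in> wspace (obj Y m) e. diff Y m v = 0}" for m
  define bY where "bY m = diff Y (m - 1) ` wspace (obj Y (m - 1)) e" for m
  note wsub = wspace_subset
  have linX: "linear_on (wspace (obj X m) e) (diff X m)" for m
    by (rule linear_on_subset[OF module_homD(1)[OF XD(2)] wsub])
  have linY: "linear_on (wspace (obj Y m) e) (diff Y m)" for m
    by (rule linear_on_subset[OF module_homD(1)[OF YD(2)] wsub])
  have zXs: "fun_vs.subspace (zX m)" and zYs: "fun_vs.subspace (zY m)" for m
    unfolding zX_def zY_def
    by (rule subspace_kernel[OF wspace_subspace[OF XD(1) e(1)] linX],
        rule subspace_kernel[OF wspace_subspace[OF YD(1) e(1)] linY])
  have zXf: "fd_subspace (zX m)" and zYf: "fd_subspace (zY m)" for m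
    by (rule fd_subspace_subset[OF wspace_fd[OF XD(1)[of m] e(1)] zXs], auto simp: zX_def)
       (rule fd_subspace_subset[OF wspace_fd[OF YD(1)[of m] e(1)] zYs], auto simp: zY_def)
  have dim_eq: "int (fun_vs.dim (zX m)) - int (fun_vs.dim (bX m)) =
      int (fun_vs.dim (zY m)) - int (fun_vs.dim (bY m))" for m
  proof -
    have lin: "linear_on (zX m) (f m)"
      by (rule linear_on_subset[OF module_homD(1)[OF fh]]) (auto simp: zX_def wspace_def)
    have bYs: "fun_vs.subspace (bY m)"
      unfolding bY_def by (rule subspace_image[OF wspace_subspace[OF YD(1) e(1)] linY])
    have bYz: "bY m \<subseteq> zY m"
      using YD(3)[of _ "m - 1"] module_hom_wspace[OF YD(2)[of "m - 1"] e(1)]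
      unfolding bY_def zY_def by (auto simp: wspace_def)
    have fz: "f m ` zX m \<subseteq> zY m"
    proof
      fix y assume "y \<in> f m ` zX m"
      then obtain v where v: "y = f m v" "v \<in> wspace (obj X m) e" "diff X m v = 0"
        unfolding zX_def by blast
      have "diff Y m y = f (m + 1) 0" using comm v wsub by fastforce
      also have "\<dots> = 0" using linear_on_zero[OF right_moduleD(1)[OF XD(1)] module_homD(1)[OF fh]] .
      finally show "y \<in> zY m" unfolding zY_def using v module_hom_wspace[OF fh e(1)] by simp
    qed
    \<comment> \<open>Preimage and bounding element exist in the whole complexes; multiplied by e
      they serve for a cocycle w fixed by e.\<close>
    have sur: "\<exists>v\<in>zX m. w - f m v \<in> bY m" if w: "w \<in> zY m" for w
    proof -
      have we: "w \<in> elems (obj Y m)" "ract (obj Y m) w e = w" "diff Y m w = 0"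
        using w by (auto simp: zY_def wspace_def)
      then obtain v u where v: "v \<in> elems (obj X m)" "diff X m v = 0"
        and u: "u \<in> elems (obj Y (m - 1))" "w - f m v = diff Y (m - 1) u"
        using q_sur[of w m] unfolding cocycles_def coboundaries_def by blast
      let ?v = "ract (obj X m) v e" and ?u = "ract (obj Y (m - 1)) u e"
      have "diff X m ?v = 0"
        using module_homD(3)[OF XD(2) v(1) e(1)] v ract_zero[OF XD(1) e(1)] by simp
      then have vz: "?v \<in> zX m" unfolding zX_def using ract_wspace[OF XD(1) e v(1)] by simp
      have "diff Y (m - 1) ?u = ract (obj Y m) (w - f m v) e"
        using module_homD(3)[OF YD(2)[of "m - 1"] u(1) e(1)] u by simp
      also have "\<dots> = w - f m ?v"
        using linear_on_diff[OF right_moduleD(1)[OF YD(1)] ract_linear[OF YD(1) e(1)] we(1) module_homD(2)[OF fh v(1)]]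
          we module_homD(3)[OF fh v(1) e(1)] by simp
      finally have "w - f m ?v \<in> bY m"
        unfolding bY_def using ract_wspace[OF YD(1) e u(1)] by (metis image_eqI)
      then show ?thesis using vz by blast
    qed
    \<comment> \<open>Injectivity on cohomology is the inclusion from left to right; with this,
      \<open>dim_relative\<close> compares cocycles modulo coboundaries on both sides.\<close>
    have "{v \<in> zX m. f m v \<in> bY m} = bX m"
    proof (intro equalityI subsetI)
      fix v assume v: "v \<in> {v \<in> zX m. f m v \<in> bY m}"
      then have vw: "v \<in> elems (obj X m)" "ract (obj X m) v e = v" "diff X m v = 0"
        by (auto simp: zX_def wspace_def)
      have "bY m \<subseteq> coboundaries Y m" unfolding coboundaries_def bY_def by (rule image_mono[OF wsub])
      then have "f m v \<in> coboundaries Y m" using v by auto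
      then have "v \<in> coboundaries X m" using vw by (intro q_inj) (simp_all add: cocycles_def)
      then obtain u where u: "u \<in> elems (obj X (m - 1))" "v = diff X (m - 1) u"
        unfolding coboundaries_def by blast
      have "v = diff X (m - 1) (ract (obj X (m - 1)) u e)"
        using module_homD(3)[OF XD(2)[of "m - 1"] u(1) e(1)] u vw by simp
      then show "v \<in> bX m" unfolding bX_def using ract_wspace[OF XD(1) e u(1)] by blast
    next
      fix v assume "v \<in> bX m"
      then obtain u where u: "u \<in> wspace (obj X (m - 1)) e" "v = diff X (m - 1) u"
        unfolding bX_def by blast
      have "v \<in> zX m"
        using u XD(3)[of u "m - 1"] module_hom_wspace[OF XD(2)[of "m - 1"] e(1) u(1)]
        unfolding zX_def by (auto simp: wspace_def)
      moreover have "f m v = diff Y (m - 1) (f (m - 1) u)"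
        using comm[OF subsetD[OF wsub u(1)]] u by simp
      then have "f m v \<in> bY m" unfolding bY_def using module_hom_wspace[OF fh e(1) u(1)] by blast
      ultimately show "v \<in> {v \<in> zX m. f m v \<in> bY m}" by simp
    qed
    then show ?thesis using dim_relative[OF zXf lin zYf bYs bYz fz sur] by simp
  qed
  obtain n1 where n1: "\<And>k m. k \<ge> n1 \<Longrightarrow> m < - k \<or> k < m \<Longrightarrow> elems (obj X m) = {0}" "n1 \<ge> 0"
    using bounded_complex_bound[OF X] by blast
  obtain n2 where n2: "\<And>k m. k \<ge> n2 \<Longrightarrow> m < - k \<or> k < m \<Longrightarrow> elems (obj Y m) = {0}" "n2 \<ge> 0"
    using bounded_complex_bound[OF Y] by blast
  let ?n = "max n1 n2"
  have "euler X e = (\<Sum>m\<in>{-?n..?n}. (if even m then 1 else - 1) *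
      (int (fun_vs.dim (zX m)) - int (fun_vs.dim (bX m))))"
    unfolding zX_def bX_def by (rule euler_cohomology[OF X e]) (use n1(2) n1(1)[of ?n] in auto)
  also have "\<dots> = (\<Sum>m\<in>{-?n..?n}. (if even m then 1 else - 1) *
      (int (fun_vs.dim (zY m)) - int (fun_vs.dim (bY m))))"
    unfolding dim_eq ..
  also have "\<dots> = euler Y e"
    unfolding zY_def bY_def by (rule euler_cohomology[OF Y e, symmetric]) (use n2(2) n2(1)[of ?n] in auto)
  finally show ?thesis .
qed

lemma euler_derived_iso:
  assumes "bounded_complex A X" "bounded_complex A Y" "derived_iso A X Y"
    "e \<in> carrier A" "e \<otimes>\<^bsub>A\<^esub> e = e"
  shows "euler X e = euler Y e"
  using assms euler_quasi_iso unfolding derived_iso_def by metis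

text \<open>An even shift preserves all signs. This is where it matters that the shift in
  \<open>nu 2\<close> is by an even number.\<close>

lemma euler_shift:
  assumes "even k"
  shows "euler (shift k X) e = euler X e"
proof -
  have w: "wdim (obj (shift k X) m) e = wdim (obj X (m + k)) e" for m
    by (simp add: shift_def)
  show ?thesis
    unfolding euler_def w
    by (rule sum.reindex_bij_witness[of _ "\<lambda>m. m - k" "\<lambda>m. m + k"])
      (simp_all only: mem_Collect_eq even_add assms add_diff_cancel_right' diff_add_cancel not_False_eq_True, simp_all)
qed

lemma euler_stalk:
  fixes M :: "('k::field, 'a, 'i) rmodule"
  assumes "right_module A M" "e \<in> carrier A"
  shows "euler (stalk M) e = int (wdim M e)"
proof -
  have z: "wdim (zero_module :: ('k, 'a, 'i) rmodule) e = 0"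
  proof -
    have "wspace (zero_module :: ('k, 'a, 'i) rmodule) e = {0}"
      by (auto simp: wspace_def zero_module_def)
    then show ?thesis by (simp add: wdim_def dim_zero)
  qed
  have "euler (stalk M) e = (\<Sum>m\<in>{-0..0}. (if even m then 1 else - 1) * int (wdim (obj (stalk M) m) e))"
    by (rule euler_bound) (auto simp: stalk_def z)
  then show ?thesis by (simp add: stalk_def)
qed

section \<open>Algebras with a multiplicative basis of paths\<close>

text \<open>
  \<open>T p q r\<close> expresses that the composite of the paths \<open>p\<close> and \<open>q\<close> is the basis element \<open>r\<close>; the
  product of two basis elements that have no composite is zero.
\<close>

locale path_basis =
  fixes A :: "('k::field, 'a) module" and Q :: "'q set" and coef :: "'q \<Rightarrow> 'a \<Rightarrow> 'k"
    and \<beta> :: "'q \<Rightarrow> 'a" and V :: "'v set" and idp :: "'v \<Rightarrow> 'q" and src tgt :: "'q \<Rightarrow> 'v"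
    and T :: "'q \<Rightarrow> 'q \<Rightarrow> 'q \<Rightarrow> bool" and len :: "'q \<Rightarrow> nat"
  assumes fd: "fd_algebra A"
    and finQ: "finite Q" and finV: "finite V"
    and \<beta>_closed: "q \<in> Q \<Longrightarrow> \<beta> q \<in> carrier A"
    and coef_\<beta>: "p \<in> Q \<Longrightarrow> q \<in> Q \<Longrightarrow> coef p (\<beta> q) = of_bool (p = q)"
    and coef_add: "q \<in> Q \<Longrightarrow> a \<in> carrier A \<Longrightarrow> b \<in> carrier A \<Longrightarrow> coef q (a \<oplus>\<^bsub>A\<^esub> b) = coef q a + coef q b"
    and coef_smult: "q \<in> Q \<Longrightarrow> a \<in> carrier A \<Longrightarrow> coef q (c \<odot>\<^bsub>A\<^esub> a) = c * coef q a"
    and coef_mult: "r \<in> Q \<Longrightarrow> a \<in> carrier A \<Longrightarrow> b \<in> carrier A \<Longrightarrow>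
      coef r (a \<otimes>\<^bsub>A\<^esub> b) = (\<Sum>p\<in>Q. \<Sum>q\<in>Q. of_bool (T p q r) * (coef p a * coef q b))"
    and coef_one: "q \<in> Q \<Longrightarrow> coef q \<one>\<^bsub>A\<^esub> = of_bool (q \<in> idp ` V)"
    and coef_ext: "a \<in> carrier A \<Longrightarrow> b \<in> carrier A \<Longrightarrow> (\<And>q. q \<in> Q \<Longrightarrow> coef q a = coef q b) \<Longrightarrow> a = b"
    and src_V: "q \<in> Q \<Longrightarrow> src q \<in> V" and tgt_V: "q \<in> Q \<Longrightarrow> tgt q \<in> V"
    and idp_Q: "v \<in> V \<Longrightarrow> idp v \<in> Q" and idp_src: "v \<in> V \<Longrightarrow> src (idp v) = v"
    and idp_tgt: "v \<in> V \<Longrightarrow> tgt (idp v) = v"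
    and T_mem: "T p q r \<Longrightarrow> p \<in> Q \<and> q \<in> Q \<and> r \<in> Q"
    and T_ends: "T p q r \<Longrightarrow> tgt p = src q \<and> src r = src p \<and> tgt r = tgt q"
    and T_len: "T p q r \<Longrightarrow> len r = len p + len q"
    and T_fun: "T p q r \<Longrightarrow> T p q r' \<Longrightarrow> r = r'"
    and T_cancel: "T p q r \<Longrightarrow> T p q' r \<Longrightarrow> q = q'"
    and T_id_left: "q \<in> Q \<Longrightarrow> T (idp (src q)) q q"
    and T_id_right: "q \<in> Q \<Longrightarrow> T q (idp (tgt q)) q"
    and T_assoc: "(\<exists>u. T p q u \<and> T u r s) \<longleftrightarrow> (\<exists>u. T q r u \<and> T p u s)"
    and acyclic: "q \<in> Q \<Longrightarrow> src q = tgt q \<Longrightarrow> q = idp (src q)"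
    and len_zero: "q \<in> Q \<Longrightarrow> len q = 0 \<Longrightarrow> q = idp (src q)"

lemma sum_of_bool_unique:
  assumes "finite S" "\<And>x y. x \<in> S \<Longrightarrow> y \<in> S \<Longrightarrow> P x \<Longrightarrow> P y \<Longrightarrow> x = y"
  shows "(\<Sum>x\<in>S. of_bool (P x)) = (of_bool (\<exists>x\<in>S. P x) :: 'b::semiring_1)"
proof (cases "\<exists>x\<in>S. P x")
  case True
  then obtain x where x: "x \<in> S" "P x" by blast
  have "(\<Sum>y\<in>S. of_bool (P y)) = (\<Sum>y\<in>{x}. of_bool (P y) :: 'b)"
    using assms x by (intro sum.mono_neutral_right) auto
  then show ?thesis using x by auto
qed auto

context path_basis
begin

section \<open>Coefficients, vertex idempotents and the parts of a module at the vertices\<close>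

sublocale ring A using fd unfolding fd_algebra_def by blast

lemma scalars_module: "Module.module scalars A"
  using fd unfolding fd_algebra_def by blast

lemma smult_closed[simp, intro]: "a \<in> carrier A \<Longrightarrow> c \<odot>\<^bsub>A\<^esub> a \<in> carrier A"
  using Module.module.smult_closed[OF scalars_module, of c a] by (simp add: scalars_def)

lemma mult_smult_left: "a \<in> carrier A \<Longrightarrow> b \<in> carrier A \<Longrightarrow>
    (c \<odot>\<^bsub>A\<^esub> a) \<otimes>\<^bsub>A\<^esub> b = c \<odot>\<^bsub>A\<^esub> (a \<otimes>\<^bsub>A\<^esub> b)"
  using fd unfolding fd_algebra_def by blast

lemma mult_smult_right: "a \<in> carrier A \<Longrightarrow> b \<in> carrier A \<Longrightarrow>
    a \<otimes>\<^bsub>A\<^esub> (c \<odot>\<^bsub>A\<^esub> b) = c \<odot>\<^bsub>A\<^esub> (a \<otimes>\<^bsub>A\<^esub> b)"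
  using fd unfolding fd_algebra_def by blast

lemma coef_zero: "q \<in> Q \<Longrightarrow> coef q \<zero>\<^bsub>A\<^esub> = 0"
  using coef_add[of q "\<zero>\<^bsub>A\<^esub>" "\<zero>\<^bsub>A\<^esub>"] by (metis add_cancel_right_right l_zero zero_closed)

definition lc :: "('q \<Rightarrow> 'k) \<Rightarrow> 'a" where
  "lc c = finsum A (\<lambda>q. c q \<odot>\<^bsub>A\<^esub> \<beta> q) Q"

lemma lc_closed[simp, intro]: "lc c \<in> carrier A"
  unfolding lc_def using \<beta>_closed by (intro finsum_closed) auto

lemma coef_finsum:
  assumes "q \<in> Q" "finite S" "\<And>x. x \<in> S \<Longrightarrow> f x \<in> carrier A"
  shows "coef q (finsum A f S) = (\<Sum>x\<in>S. coef q (f x))"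
  using assms(2,3)
proof (induction S rule: finite_induct)
  case (insert x F)
  then have "finsum A f (insert x F) = f x \<oplus>\<^bsub>A\<^esub> finsum A f F"
    by (intro finsum_insert) auto
  then show ?case using insert assms(1) coef_add[of q "f x" "finsum A f F"] by (simp add: finsum_closed Pi_def)
qed (use assms coef_zero in simp)

lemma coef_lc:
  assumes "q \<in> Q" shows "coef q (lc c) = c q"
proof -
  have "coef q (lc c) = (\<Sum>p\<in>Q. coef q (c p \<odot>\<^bsub>A\<^esub> \<beta> p))"
    unfolding lc_def using assms finQ \<beta>_closed by (intro coef_finsum) auto
  also have "\<dots> = (\<Sum>p\<in>Q. if p = q then c p else 0)"
    using assms \<beta>_closed by (intro sum.cong) (auto simp: coef_smult coef_\<beta>)
  finally show ?thesis using assms finQ by simp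
qed

lemma lc_coef: "a \<in> carrier A \<Longrightarrow> lc (\<lambda>q. coef q a) = a"
  by (rule coef_ext) (auto simp: coef_lc)

lemma \<beta>_mult_T: assumes "T p q r" shows "\<beta> p \<otimes>\<^bsub>A\<^esub> \<beta> q = \<beta> r"
proof (rule coef_ext)
  fix s assume s: "s \<in> Q"
  note m = T_mem[OF assms]
  have "coef s (\<beta> p \<otimes>\<^bsub>A\<^esub> \<beta> q) = (\<Sum>p'\<in>Q. \<Sum>q'\<in>Q. of_bool (T p' q' s) * (coef p' (\<beta> p) * coef q' (\<beta> q)))"
    using s m \<beta>_closed by (intro coef_mult) auto
  also have "\<dots> = (\<Sum>p'\<in>Q. \<Sum>q'\<in>Q. if p' = p \<and> q' = q then of_bool (T p q s) else 0)"
    using m by (intro sum.cong) (auto simp: coef_\<beta>)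
  also have "\<dots> = (\<Sum>p'\<in>Q. if p' = p then of_bool (T p q s) else 0)"
    using m finQ by (intro sum.cong) auto
  also have "\<dots> = of_bool (T p q s)" using m finQ by simp
  also have "T p q s \<longleftrightarrow> s = r" using T_fun[OF assms] assms by metis
  also have "of_bool (s = r) = coef s (\<beta> r)" using m s by (simp add: coef_\<beta>)
  finally show "coef s (\<beta> p \<otimes>\<^bsub>A\<^esub> \<beta> q) = coef s (\<beta> r)" .
qed (use T_mem[OF assms] \<beta>_closed in auto)

lemma \<beta>_mult_zero: assumes "p \<in> Q" "q \<in> Q" "\<nexists>r. T p q r" shows "\<beta> p \<otimes>\<^bsub>A\<^esub> \<beta> q = \<zero>\<^bsub>A\<^esub>"
proof (rule coef_ext)
  fix s assume s: "s \<in> Q"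
  have "coef s (\<beta> p \<otimes>\<^bsub>A\<^esub> \<beta> q) = (\<Sum>p'\<in>Q. \<Sum>q'\<in>Q. of_bool (T p' q' s) * (coef p' (\<beta> p) * coef q' (\<beta> q)))"
    using s assms \<beta>_closed by (intro coef_mult) auto
  also have "\<dots> = 0"
    using assms by (intro sum.neutral ballI) (auto simp: coef_\<beta>)
  finally show "coef s (\<beta> p \<otimes>\<^bsub>A\<^esub> \<beta> q) = coef s \<zero>\<^bsub>A\<^esub>" using s coef_zero by simp
qed (use assms \<beta>_closed in auto)

lemma idp_inj: "inj_on idp V"
  by (rule inj_on_inverseI[where g = src]) (rule idp_src)

lemma T_idpD:
  assumes "v \<in> V"
  shows "T (idp v) q r \<longleftrightarrow> q \<in> Q \<and> r = q \<and> src q = v" "T q (idp v) r \<longleftrightarrow> q \<in> Q \<and> r = q \<and> tgt q = v"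
  using T_mem T_ends T_fun T_id_left T_id_right idp_src[OF assms] idp_tgt[OF assms] by metis+

abbreviation ve :: "'v \<Rightarrow> 'a" where "ve v \<equiv> \<beta> (idp v)"

lemma ve_closed: "v \<in> V \<Longrightarrow> ve v \<in> carrier A"
  by (simp add: \<beta>_closed idp_Q)

lemma ve_idem: "v \<in> V \<Longrightarrow> ve v \<otimes>\<^bsub>A\<^esub> ve v = ve v"
  by (rule \<beta>_mult_T) (simp add: T_idpD idp_Q idp_src idp_tgt)

lemma coef_ve_left:
  assumes q: "q \<in> Q" and v: "v \<in> V" and y: "y \<in> carrier A"
  shows "coef q (ve v \<otimes>\<^bsub>A\<^esub> y) = of_bool (src q = v) * coef q y"
proof -
  have "coef q (ve v \<otimes>\<^bsub>A\<^esub> y) = (\<Sum>p\<in>Q. \<Sum>r\<in>Q. of_bool (T p r q) * (coef p (ve v) * coef r y))"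
    by (rule coef_mult[OF q ve_closed[OF v] y])
  also have "\<dots> = (\<Sum>p\<in>Q. if p = idp v then (\<Sum>r\<in>Q. if r = q then of_bool (src q = v) * coef q y else 0) else 0)"
    using idp_Q[OF v] by (intro sum.cong refl) (auto simp: coef_\<beta> T_idpD[OF v] intro!: sum.cong sum.neutral)
  finally show ?thesis using finQ idp_Q[OF v] q by simp
qed

lemma coef_ve_right:
  assumes q: "q \<in> Q" and v: "v \<in> V" and y: "y \<in> carrier A"
  shows "coef q (y \<otimes>\<^bsub>A\<^esub> ve v) = of_bool (tgt q = v) * coef q y"
proof -
  have "coef q (y \<otimes>\<^bsub>A\<^esub> ve v) = (\<Sum>r\<in>Q. \<Sum>p\<in>Q. of_bool (T r p q) * (coef r y * coef p (ve v)))"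
    by (rule coef_mult[OF q y ve_closed[OF v]])
  also have "\<dots> = (\<Sum>r\<in>Q. if r = q then of_bool (tgt q = v) * coef q y else 0)"
  proof (intro sum.cong refl)
    fix r assume r: "r \<in> Q"
    have "(\<Sum>p\<in>Q. of_bool (T r p q) * (coef r y * coef p (ve v))) =
        (\<Sum>p\<in>Q. if p = idp v then of_bool (T r (idp v) q) * coef r y else 0)"
      using idp_Q[OF v] by (intro sum.cong) (auto simp: coef_\<beta>)
    also have "\<dots> = of_bool (T r (idp v) q) * coef r y" using finQ idp_Q[OF v] by simp
    finally show "(\<Sum>p\<in>Q. of_bool (T r p q) * (coef r y * coef p (ve v))) =
        (if r = q then of_bool (tgt q = v) * coef q y else 0)"
      using r by (simp add: T_idpD[OF v])
  qed
  finally show ?thesis using finQ q by simp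
qed

lemma ract_A_zero:
  assumes "right_module A M" "v \<in> elems M" shows "ract M v \<zero>\<^bsub>A\<^esub> = 0"
  using right_moduleD(4)[OF assms, of "\<zero>\<^bsub>A\<^esub>" "\<zero>\<^bsub>A\<^esub>"] by simp

lemma ract_expand:
  assumes M: "right_module A M" and v: "v \<in> elems M" and a: "a \<in> carrier A"
  shows "ract M v a = (\<Sum>q\<in>Q. fscale (coef q a) (ract M v (\<beta> q)))"
proof -
  have "ract M v (finsum A (\<lambda>q. coef q a \<odot>\<^bsub>A\<^esub> \<beta> q) S) = (\<Sum>q\<in>S. fscale (coef q a) (ract M v (\<beta> q)))"
    if "finite S" "S \<subseteq> Q" for S
    using that
  proof (induction S rule: finite_induct)
    case (insert x F)
    have cl: "coef q a \<odot>\<^bsub>A\<^esub> \<beta> q \<in> carrier A" if "q \<in> insert x F" for q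
      using that insert.prems \<beta>_closed by auto
    have fi: "finsum A (\<lambda>q. coef q a \<odot>\<^bsub>A\<^esub> \<beta> q) F \<in> carrier A"
      using cl by (intro finsum_closed) auto
    have "finsum A (\<lambda>q. coef q a \<odot>\<^bsub>A\<^esub> \<beta> q) (insert x F) =
        coef x a \<odot>\<^bsub>A\<^esub> \<beta> x \<oplus>\<^bsub>A\<^esub> finsum A (\<lambda>q. coef q a \<odot>\<^bsub>A\<^esub> \<beta> q) F"
      using insert.hyps cl by (intro finsum_insert) auto
    then have "ract M v (finsum A (\<lambda>q. coef q a \<odot>\<^bsub>A\<^esub> \<beta> q) (insert x F)) =
        ract M v (coef x a \<odot>\<^bsub>A\<^esub> \<beta> x) + ract M v (finsum A (\<lambda>q. coef q a \<odot>\<^bsub>A\<^esub> \<beta> q) F)"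
      using right_moduleD(4)[OF M v cl[of x] fi] by simp
    also have "ract M v (coef x a \<odot>\<^bsub>A\<^esub> \<beta> x) = fscale (coef x a) (ract M v (\<beta> x))"
      using right_moduleD(5)[OF M v] insert.prems \<beta>_closed by blast
    also have "ract M v (finsum A (\<lambda>q. coef q a \<odot>\<^bsub>A\<^esub> \<beta> q) F) = (\<Sum>q\<in>F. fscale (coef q a) (ract M v (\<beta> q)))"
      using insert by blast
    finally show ?case unfolding sum.insert[OF insert.hyps] .
  qed (use ract_A_zero[OF M v] in simp)
  from this[OF finQ order_refl] show ?thesis using lc_coef[OF a] unfolding lc_def by simp
qed

lemma ract_T:
  assumes "right_module A M" "v \<in> elems M" "T p q r"
  shows "ract M (ract M v (\<beta> p)) (\<beta> q) = ract M v (\<beta> r)"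
  using right_moduleD(7)[OF assms(1,2), of "\<beta> p" "\<beta> q"] T_mem[OF assms(3)] \<beta>_closed \<beta>_mult_T[OF assms(3)]
  by simp

lemma ract_no_T:
  assumes "right_module A M" "v \<in> elems M" "p \<in> Q" "q \<in> Q" "\<nexists>r. T p q r"
  shows "ract M (ract M v (\<beta> p)) (\<beta> q) = 0"
  using right_moduleD(7)[OF assms(1,2), of "\<beta> p" "\<beta> q"] \<beta>_closed \<beta>_mult_zero[OF assms(3-5)] assms
    ract_A_zero[OF assms(1,2)] by simp

text \<open>The unit is the sum of the vertex idempotents: its coefficients are 1 at the trivial
  paths and 0 elsewhere.\<close>

lemma vertex_decomp:
  assumes M: "right_module A M" and m: "m \<in> elems M"
  shows "m = (\<Sum>v\<in>V. ract M m (ve v))"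
proof -
  have "m = ract M m \<one>\<^bsub>A\<^esub>" using right_moduleD(6)[OF M m] by simp
  also have "\<dots> = (\<Sum>q\<in>Q. fscale (coef q \<one>\<^bsub>A\<^esub>) (ract M m (\<beta> q)))"
    by (rule ract_expand[OF M m]) simp
  also have "\<dots> = (\<Sum>q\<in>idp ` V. ract M m (\<beta> q))"
    using finQ idp_Q by (intro sum.mono_neutral_cong_right) (auto simp: coef_one)
  also have "\<dots> = (\<Sum>v\<in>V. ract M m (ve v))"
    using idp_inj by (simp add: sum.reindex)
  finally show ?thesis .
qed

lemma wspace_ract:
  assumes M: "right_module A M" and v: "v \<in> V" and m: "m \<in> wspace M (ve v)" and q: "q \<in> Q"
  shows "src q \<noteq> v \<Longrightarrow> ract M m (\<beta> q) = 0" and "ract M m (\<beta> q) \<in> wspace M (ve (tgt q))"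
proof -
  have me: "m \<in> elems M" "ract M m (ve v) = m" using m by (auto simp: wspace_def)
  show "ract M m (\<beta> q) = 0" if "src q \<noteq> v"
    using ract_no_T[OF M me(1) idp_Q[OF v] q] T_idpD[OF v] that me(2) by auto
  show "ract M m (\<beta> q) \<in> wspace M (ve (tgt q))"
    using ract_T[OF M me(1) T_id_right[OF q]] right_moduleD(3)[OF M me(1) \<beta>_closed[OF q]]
    by (simp add: wspace_def)
qed

lemma ract_ve_wspace:
  assumes "right_module A M" "v \<in> V" "m \<in> elems M" shows "ract M m (ve v) \<in> wspace M (ve v)"
  by (rule ract_wspace[OF assms(1) ve_closed[OF assms(2)] ve_idem[OF assms(2)] assms(3)])

subsection \<open>Modules spanned by a partial action\<close>

text \<open>One combinatorial pattern for free, simple and injective modules: paths act as partial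
  maps on a finite set of basis vectors, and undefined means zero. The associativity clause is an
  equivalence, so that paths without a composite act as zero one after the other. The function
  \<open>vt\<close> gives the vertex at which a basis vector sits.\<close>

definition path_action :: "'x set \<Rightarrow> ('x \<Rightarrow> 'q \<Rightarrow> 'x \<Rightarrow> bool) \<Rightarrow> ('x \<Rightarrow> 'v) \<Rightarrow> bool" where
  "path_action S act vt \<longleftrightarrow> finite S \<and>
     (\<forall>x q y. act x q y \<longrightarrow> x \<in> S \<and> q \<in> Q \<and> y \<in> S) \<and>
     (\<forall>x q y y'. act x q y \<and> act x q y' \<longrightarrow> y = y') \<and>
     (\<forall>x p q z. (\<exists>y. act x p y \<and> act y q z) \<longleftrightarrow> (\<exists>r. T p q r \<and> act x r z)) \<and>
     (\<forall>x\<in>S. vt x \<in> V) \<and>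
     (\<forall>x\<in>S. \<forall>v\<in>V. \<forall>y. act x (idp v) y \<longleftrightarrow> y = x \<and> v = vt x)"

lemma path_actionD:
  assumes "path_action S act vt"
  shows "finite S" "\<And>x q y. act x q y \<Longrightarrow> x \<in> S \<and> q \<in> Q \<and> y \<in> S"
    "\<And>x q y y'. act x q y \<Longrightarrow> act x q y' \<Longrightarrow> y = y'"
    "\<And>x p q z. (\<exists>y. act x p y \<and> act y q z) \<longleftrightarrow> (\<exists>r. T p q r \<and> act x r z)"
    "\<And>x. x \<in> S \<Longrightarrow> vt x \<in> V"
    "\<And>x v y. x \<in> S \<Longrightarrow> v \<in> V \<Longrightarrow> act x (idp v) y \<longleftrightarrow> y = x \<and> v = vt x"
proof -
  note a = assms[unfolded path_action_def]
  show "finite S" by (rule a[THEN conjunct1])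
  show "act x q y \<Longrightarrow> x \<in> S \<and> q \<in> Q \<and> y \<in> S" for x q y
    by (rule a[THEN conjunct2, THEN conjunct1, rule_format])
  show "act x q y \<Longrightarrow> act x q y' \<Longrightarrow> y = y'" for x q y y'
    by (rule a[THEN conjunct2, THEN conjunct2, THEN conjunct1, rule_format, OF conjI])
  show "(\<exists>y. act x p y \<and> act y q z) \<longleftrightarrow> (\<exists>r. T p q r \<and> act x r z)" for x p q z
    by (rule a[THEN conjunct2, THEN conjunct2, THEN conjunct2, THEN conjunct1, rule_format])
  show "x \<in> S \<Longrightarrow> vt x \<in> V" for x
    by (rule a[THEN conjunct2, THEN conjunct2, THEN conjunct2, THEN conjunct2, THEN conjunct1, rule_format])
  show "x \<in> S \<Longrightarrow> v \<in> V \<Longrightarrow> act x (idp v) y \<longleftrightarrow> y = x \<and> v = vt x" for x v y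
    by (rule a[THEN conjunct2, THEN conjunct2, THEN conjunct2, THEN conjunct2, THEN conjunct2, rule_format])
qed

text \<open>Vectors are functions on the codes of S rather than on S, since projectivity and
  injectivity are defined for modules with index type \<open>nat\<close>. The outer sum selects the
  element y whose code is n.\<close>

definition act_module :: "'x set \<Rightarrow> ('x \<Rightarrow> 'q \<Rightarrow> 'x \<Rightarrow> bool) \<Rightarrow> ('k, 'a, nat) rmodule" where
  "act_module S act =
     \<lparr>elems = {f. \<forall>n. n \<notin> to_nat_on S ` S \<longrightarrow> f n = 0},
      ract = (\<lambda>f a n. \<Sum>y\<in>S. of_bool (to_nat_on S y = n) *
        (\<Sum>x\<in>S. \<Sum>q\<in>Q. of_bool (act x q y) * (f (to_nat_on S x) * coef q a)))\<rparr>"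

definition bas :: "'x set \<Rightarrow> 'x \<Rightarrow> nat \<Rightarrow> 'k" where
  "bas S x = (\<lambda>n. of_bool (n = to_nat_on S x))"

lemma code_inj: "finite S \<Longrightarrow> x \<in> S \<Longrightarrow> y \<in> S \<Longrightarrow> to_nat_on S x = to_nat_on S y \<longleftrightarrow> x = y"
  using inj_on_to_nat_on[OF countable_finite] by (auto simp: inj_on_def)

lemma act_module_ract:
  assumes "finite S" "y \<in> S"
  shows "ract (act_module S act) f a (to_nat_on S y) =
    (\<Sum>x\<in>S. \<Sum>q\<in>Q. of_bool (act x q y) * (f (to_nat_on S x) * coef q a))"
proof -
  have "ract (act_module S act) f a (to_nat_on S y) =
      (\<Sum>y'\<in>S. if y' = y then (\<Sum>x\<in>S. \<Sum>q\<in>Q. of_bool (act x q y) * (f (to_nat_on S x) * coef q a)) else 0)"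
    unfolding act_module_def rmodule.simps using assms
    by (intro sum.cong) (auto simp: code_inj)
  then show ?thesis using assms by simp
qed

lemma act_module_ract_mem: "ract (act_module S act) f a \<in> elems (act_module S act)"
  unfolding act_module_def by (auto intro!: sum.neutral)

lemma act_module_ext:
  assumes "f \<in> elems (act_module S act)" "g \<in> elems (act_module S act)"
    "\<And>x. x \<in> S \<Longrightarrow> f (to_nat_on S x) = g (to_nat_on S x)"
  shows "f = g"
proof
  fix n show "f n = g n" using assms unfolding act_module_def by (cases "n \<in> to_nat_on S ` S") auto
qed

lemma act_module_subspace: "fun_vs.subspace (elems (act_module S act))"
  unfolding act_module_def fun_vs.subspace_def by (auto simp: fscale_apply)

lemma bas_mem: "x \<in> S \<Longrightarrow> bas S x \<in> elems (act_module S act)"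
  unfolding act_module_def bas_def by auto

lemma bas_apply: "finite S \<Longrightarrow> x \<in> S \<Longrightarrow> y \<in> S \<Longrightarrow> bas S x (to_nat_on S y) = of_bool (y = x)"
  by (simp add: bas_def code_inj)

lemma sum_bas_apply:
  assumes "finite S" "y \<in> S"
  shows "(\<Sum>x\<in>S. fscale (c x) (bas S x)) (to_nat_on S y) = c y"
proof -
  have "(\<Sum>x\<in>S. fscale (c x) (bas S x)) (to_nat_on S y) = (\<Sum>x\<in>S. if x = y then c x else 0)"
    unfolding sum_fun_apply using assms by (intro sum.cong) (auto simp: fscale_apply bas_apply)
  then show ?thesis using assms by simp
qed

lemma sum_bas_mem: "(\<Sum>x\<in>S. fscale (c x) (bas S x)) \<in> elems (act_module S act)"
  by (intro fun_vs.subspace_sum fun_vs.subspace_scale act_module_subspace bas_mem)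

lemma act_module_expand:
  assumes "finite S" "f \<in> elems (act_module S act)"
  shows "f = (\<Sum>x\<in>S. fscale (f (to_nat_on S x)) (bas S x))"
  by (rule act_module_ext[OF assms(2) sum_bas_mem]) (simp add: sum_bas_apply assms)

lemma act_module_right_module:
  assumes act: "path_action S act vt"
  shows "right_module A (act_module S act)"
proof -
  note fin = path_actionD(1)[OF act] and act_S = path_actionD(2)[OF act] and act_fun = path_actionD(3)[OF act]
    and act_assoc = path_actionD(4)[OF act] and vt = path_actionD(5)[OF act] and act_id = path_actionD(6)[OF act]
  let ?M = "act_module S act" and ?c = "to_nat_on S"
  note at = act_module_ract[OF fin]
  have ext: "ract ?M f a = g"
    if "g \<in> elems ?M" "\<And>y. y \<in> S \<Longrightarrow> (\<Sum>x\<in>S. \<Sum>q\<in>Q. of_bool (act x q y) * (f (?c x) * coef q a)) = g (?c y)"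
    for f a g
    by (rule act_module_ext[OF act_module_ract_mem that(1)]) (simp add: at that(2))
  show ?thesis
    unfolding right_module_def
  proof (intro conjI ballI allI)
    show "fun_vs.subspace (elems ?M)" by (rule act_module_subspace)
    show "\<exists>B. finite B \<and> elems ?M = fun_vs.span B"
    proof (intro exI conjI)
      show "elems ?M = fun_vs.span (bas S ` S)"
      proof
        show "elems ?M \<subseteq> fun_vs.span (bas S ` S)"
        proof
          fix f assume "f \<in> elems ?M"
          from act_module_expand[OF fin this] show "f \<in> fun_vs.span (bas S ` S)"
            by (metis (no_types, lifting) fun_vs.span_sum fun_vs.span_scale fun_vs.span_base image_eqI)
        qed
        show "fun_vs.span (bas S ` S) \<subseteq> elems ?M"
          by (intro fun_vs.span_minimal act_module_subspace) (auto intro: bas_mem)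
      qed
    qed (use fin in simp)
  next
    fix v a assume "v \<in> elems ?M" "a \<in> carrier A"
    show "ract ?M v a \<in> elems ?M" by (rule act_module_ract_mem)
  next
    fix v w a assume "v \<in> elems ?M" "w \<in> elems ?M" "a \<in> carrier A"
    show "ract ?M (v + w) a = ract ?M v a + ract ?M w a"
      by (rule ext) (auto simp: act_module_subspace act_module_ract_mem fun_vs.subspace_add at
          sum.distrib[symmetric] algebra_simps intro!: sum.cong)
  next
    fix v a b assume "v \<in> elems ?M" "a \<in> carrier A" "b \<in> carrier A"
    then show "ract ?M v (a \<oplus>\<^bsub>A\<^esub> b) = ract ?M v a + ract ?M v b"
      by (intro ext) (auto simp: act_module_subspace act_module_ract_mem fun_vs.subspace_add at
          sum.distrib[symmetric] algebra_simps coef_add intro!: sum.cong)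
  next
    fix c v a assume *: "v \<in> elems ?M" "a \<in> carrier A"
    show "ract ?M (fscale c v) a = fscale c (ract ?M v a)"
      by (rule ext) (auto simp: act_module_subspace act_module_ract_mem fun_vs.subspace_scale at
          sum_distrib_left fscale_apply algebra_simps intro!: sum.cong)
    show "ract ?M v (c \<odot>\<^bsub>A\<^esub> a) = fscale c (ract ?M v a)"
      using * by (intro ext) (auto simp: act_module_subspace act_module_ract_mem fun_vs.subspace_scale at
          sum_distrib_left fscale_apply algebra_simps coef_smult intro!: sum.cong)
  next
    fix v assume v: "v \<in> elems ?M"
    show "ract ?M v \<one>\<^bsub>A\<^esub> = v"
    proof (rule ext[OF v])
      fix y assume y: "y \<in> S"
      have "(\<Sum>q\<in>Q. of_bool (act x q y) * (v (?c x) * coef q \<one>\<^bsub>A\<^esub>)) = (if x = y then v (?c y) else 0)"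
        if x: "x \<in> S" for x
      proof -
        have "(\<Sum>q\<in>Q. of_bool (act x q y) * (v (?c x) * coef q \<one>\<^bsub>A\<^esub>)) =
            (\<Sum>q\<in>idp ` V. of_bool (act x q y) * v (?c x))"
          using finQ idp_Q by (intro sum.mono_neutral_cong_right) (auto simp: coef_one)
        also have "\<dots> = (\<Sum>u\<in>V. if u = vt x then of_bool (x = y) * v (?c x) else 0)"
          unfolding sum.reindex[OF idp_inj] comp_def using act_id[OF x] by (intro sum.cong) auto
        finally show ?thesis using finV vt[OF x] by simp
      qed
      then have "(\<Sum>x\<in>S. \<Sum>q\<in>Q. of_bool (act x q y) * (v (?c x) * coef q \<one>\<^bsub>A\<^esub>)) =
          (\<Sum>x\<in>S. if x = y then v (?c y) else 0)" by (intro sum.cong) auto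
      then show "(\<Sum>x\<in>S. \<Sum>q\<in>Q. of_bool (act x q y) * (v (?c x) * coef q \<one>\<^bsub>A\<^esub>)) = v (?c y)"
        using fin y by simp
    qed
  next
    fix v a b assume v: "v \<in> elems ?M" and a: "a \<in> carrier A" and b: "b \<in> carrier A"
    show "ract ?M v (a \<otimes>\<^bsub>A\<^esub> b) = ract ?M (ract ?M v a) b"
    proof (rule ext[OF act_module_ract_mem])
      fix z assume z: "z \<in> S"
      \<comment> \<open>Both sides are 0 or 1, because composites of paths and results of actions
        are unique, and associativity of the action equates them. What remains is a reordering of
        finite sums.\<close>
      have key: "(\<Sum>r\<in>Q. of_bool (act x r z) * of_bool (T p q r)) =
          (\<Sum>y\<in>S. of_bool (act y q z) * of_bool (act x p y) :: 'k)" for x p q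
      proof -
        have "(\<Sum>r\<in>Q. of_bool (act x r z) * of_bool (T p q r) :: 'k) = (\<Sum>r\<in>Q. of_bool (act x r z \<and> T p q r))"
          by (simp add: of_bool_conj)
        also have "\<dots> = of_bool (\<exists>r\<in>Q. act x r z \<and> T p q r)"
          by (rule sum_of_bool_unique[OF finQ]) (use T_fun in blast)
        also have "(\<exists>r\<in>Q. act x r z \<and> T p q r) \<longleftrightarrow> (\<exists>r. T p q r \<and> act x r z)"
          using T_mem by blast
        also have "(\<exists>r. T p q r \<and> act x r z) \<longleftrightarrow> (\<exists>y. act x p y \<and> act y q z)"
          by (rule act_assoc[symmetric])
        also have "(\<exists>y. act x p y \<and> act y q z) \<longleftrightarrow> (\<exists>y\<in>S. act y q z \<and> act x p y)"
          using act_S by blast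
        also have "of_bool (\<exists>y\<in>S. act y q z \<and> act x p y) = (\<Sum>y\<in>S. of_bool (act y q z \<and> act x p y) :: 'k)"
          by (rule sum_of_bool_unique[OF fin, symmetric]) (use act_fun in blast)
        finally show ?thesis by (simp add: of_bool_conj)
      qed
      have "(\<Sum>x\<in>S. \<Sum>r\<in>Q. of_bool (act x r z) * (v (?c x) * coef r (a \<otimes>\<^bsub>A\<^esub> b))) =
          (\<Sum>x\<in>S. \<Sum>r\<in>Q. \<Sum>p\<in>Q. \<Sum>q\<in>Q. (v (?c x) * coef p a * coef q b) * (of_bool (act x r z) * of_bool (T p q r)))"
        using a b by (intro sum.cong refl) (auto simp: coef_mult sum_distrib_left algebra_simps intro!: sum.cong)
      also have "\<dots> = (\<Sum>x\<in>S. \<Sum>p\<in>Q. \<Sum>q\<in>Q. \<Sum>r\<in>Q. (v (?c x) * coef p a * coef q b) * (of_bool (act x r z) * of_bool (T p q r)))"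
        by (rule sum.cong[OF refl], subst sum.swap, rule sum.cong[OF refl], rule sum.swap)
      also have "\<dots> = (\<Sum>x\<in>S. \<Sum>p\<in>Q. \<Sum>q\<in>Q. \<Sum>y\<in>S. (v (?c x) * coef p a * coef q b) * (of_bool (act y q z) * of_bool (act x p y)))"
        unfolding sum_distrib_left[symmetric] key ..
      also have "\<dots> = (\<Sum>x\<in>S. \<Sum>p\<in>Q. \<Sum>y\<in>S. \<Sum>q\<in>Q. (v (?c x) * coef p a * coef q b) * (of_bool (act y q z) * of_bool (act x p y)))"
        by (intro sum.cong refl, rule sum.swap)
      also have "\<dots> = (\<Sum>x\<in>S. \<Sum>y\<in>S. \<Sum>p\<in>Q. \<Sum>q\<in>Q. (v (?c x) * coef p a * coef q b) * (of_bool (act y q z) * of_bool (act x p y)))"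
        by (intro sum.cong refl, rule sum.swap)
      also have "\<dots> = (\<Sum>y\<in>S. \<Sum>x\<in>S. \<Sum>p\<in>Q. \<Sum>q\<in>Q. (v (?c x) * coef p a * coef q b) * (of_bool (act y q z) * of_bool (act x p y)))"
        by (rule sum.swap)
      also have "\<dots> = (\<Sum>y\<in>S. \<Sum>x\<in>S. \<Sum>q\<in>Q. \<Sum>p\<in>Q. (v (?c x) * coef p a * coef q b) * (of_bool (act y q z) * of_bool (act x p y)))"
        by (rule sum.cong[OF refl], rule sum.cong[OF refl], rule sum.swap)
      also have "\<dots> = (\<Sum>y\<in>S. \<Sum>q\<in>Q. \<Sum>x\<in>S. \<Sum>p\<in>Q. (v (?c x) * coef p a * coef q b) * (of_bool (act y q z) * of_bool (act x p y)))"
        by (intro sum.cong refl, rule sum.swap)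
      also have "\<dots> = (\<Sum>y\<in>S. \<Sum>q\<in>Q. of_bool (act y q z) * (ract ?M v a (?c y) * coef q b))"
        by (intro sum.cong refl) (auto simp: at sum_distrib_left sum_distrib_right algebra_simps intro!: sum.cong)
      also have "\<dots> = ract ?M (ract ?M v a) b (?c z)" by (simp add: at z)
      finally show "(\<Sum>x\<in>S. \<Sum>q\<in>Q. of_bool (act x q z) * (v (?c x) * coef q (a \<otimes>\<^bsub>A\<^esub> b))) =
          ract ?M (ract ?M v a) b (?c z)" .
    qed
  qed
qed

lemma bas_ract:
  assumes act: "path_action S act vt" and xy: "act x q y"
  shows "ract (act_module S act) (bas S x) (\<beta> q) = bas S y"
proof (rule act_module_ext[OF act_module_ract_mem])
  note fin = path_actionD(1)[OF act]
  have m: "x \<in> S" "q \<in> Q" "y \<in> S" using path_actionD(2)[OF act xy] by simp_all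
  have u: "act x q z \<longleftrightarrow> z = y" for z using path_actionD(3)[OF act xy] xy by metis
  show "bas S y \<in> elems (act_module S act)" by (rule bas_mem[OF m(3)])
  fix z assume z: "z \<in> S"
  have "ract (act_module S act) (bas S x) (\<beta> q) (to_nat_on S z) =
      (\<Sum>x'\<in>S. \<Sum>q'\<in>Q. of_bool (act x' q' z) * (of_bool (x' = x) * of_bool (q' = q)))"
    unfolding act_module_ract[OF fin z] using fin m by (intro sum.cong) (auto simp: bas_apply coef_\<beta>)
  also have "\<dots> = (\<Sum>x'\<in>S. if x' = x then of_bool (act x q z) else 0)"
  proof (intro sum.cong refl)
    fix x' assume "x' \<in> S"
    have "(\<Sum>q'\<in>Q. of_bool (act x' q' z) * (of_bool (x' = x) * of_bool (q' = q)) :: 'k) =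
        (\<Sum>q'\<in>Q. if q' = q then of_bool (act x' q z) * of_bool (x' = x) else 0)"
      by (intro sum.cong) auto
    then show "(\<Sum>q'\<in>Q. of_bool (act x' q' z) * (of_bool (x' = x) * of_bool (q' = q)) :: 'k) =
        (if x' = x then of_bool (act x q z) else 0)" using finQ m by simp
  qed
  also have "\<dots> = of_bool (z = y)" using fin m u by simp
  finally show "ract (act_module S act) (bas S x) (\<beta> q) (to_nat_on S z) = bas S y (to_nat_on S z)"
    using fin m z by (simp add: bas_apply)
qed

text \<open>The linear extension of the assignment \<open>bas S x\<close> \<mapsto>
  \<open>el x\<close>.\<close>

definition act_hom :: "'x set \<Rightarrow> ('x \<Rightarrow> 'i \<Rightarrow> 'k) \<Rightarrow> (nat \<Rightarrow> 'k) \<Rightarrow> 'i \<Rightarrow> 'k" where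
  "act_hom S el f = (\<Sum>x\<in>S. fscale (f (to_nat_on S x)) (el x))"

lemma act_hom_bas:
  assumes "finite S" "x \<in> S" shows "act_hom S el (bas S x) = el x"
proof -
  have "act_hom S el (bas S x) = (\<Sum>y\<in>S. if y = x then el x else 0)"
    unfolding act_hom_def using assms by (intro sum.cong) (auto simp: bas_apply)
  then show ?thesis using assms by simp
qed

lemma act_hom_linear: "linear_on (elems (act_module S act)) (act_hom S el)"
  unfolding linear_on_def act_hom_def
  by (auto simp: fscale_apply fun_vs.scale_left_distrib sum.distrib fun_vs.scale_sum_right)

lemma act_hom_hom:
  assumes act: "path_action S act vt" and N: "right_module A N"
    and el: "\<And>x. x \<in> S \<Longrightarrow> el x \<in> elems N"
    and el_act: "\<And>x q y. act x q y \<Longrightarrow> ract N (el x) (\<beta> q) = el y"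
    and el_zero: "\<And>x q. x \<in> S \<Longrightarrow> q \<in> Q \<Longrightarrow> \<nexists>y. act x q y \<Longrightarrow> ract N (el x) (\<beta> q) = 0"
  shows "act_hom S el \<in> module_hom A (act_module S act) N"
proof (rule module_homI[OF act_hom_linear])
  note fin = path_actionD(1)[OF act] and act_S = path_actionD(2)[OF act] and act_fun = path_actionD(3)[OF act]
  note Ns = right_moduleD(1)[OF N]
  show "act_hom S el v \<in> elems N" for v
    unfolding act_hom_def using el by (intro fun_vs.subspace_sum fun_vs.subspace_scale Ns)
  fix f a assume "f \<in> elems (act_module S act)" and a: "a \<in> carrier A"
  let ?c = "to_nat_on S"
  have elq: "ract N (el x) (\<beta> q) = (\<Sum>y\<in>S. fscale (of_bool (act x q y)) (el y))" if x: "x \<in> S" "q \<in> Q" for x q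
  proof (cases "\<exists>y. act x q y")
    case True
    then obtain y where y: "act x q y" by blast
    have "(\<Sum>z\<in>S. fscale (of_bool (act x q z)) (el z)) = (\<Sum>z\<in>S. if z = y then el y else 0)"
      using y act_fun by (intro sum.cong) auto
    then show ?thesis using fin act_S[OF y] el_act[OF y] by simp
  next
    case False
    then show ?thesis using el_zero[OF x] by simp
  qed
  have "act_hom S el (ract (act_module S act) f a) =
      (\<Sum>y\<in>S. fscale (\<Sum>x\<in>S. \<Sum>q\<in>Q. of_bool (act x q y) * (f (?c x) * coef q a)) (el y))"
    unfolding act_hom_def by (intro sum.cong) (simp_all add: act_module_ract[OF fin])
  also have "\<dots> = (\<Sum>y\<in>S. \<Sum>x\<in>S. \<Sum>q\<in>Q. fscale (f (?c x)) (fscale (coef q a) (fscale (of_bool (act x q y)) (el y))))"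
    unfolding fun_vs.scale_sum_left by (intro sum.cong refl) (simp add: fscale_def fun_eq_iff)
  also have "\<dots> = (\<Sum>x\<in>S. \<Sum>q\<in>Q. \<Sum>y\<in>S. fscale (f (?c x)) (fscale (coef q a) (fscale (of_bool (act x q y)) (el y))))"
    by (subst sum.swap, intro sum.cong refl, rule sum.swap)
  also have "\<dots> = (\<Sum>x\<in>S. fscale (f (?c x)) (\<Sum>q\<in>Q. fscale (coef q a) (ract N (el x) (\<beta> q))))"
    unfolding fun_vs.scale_sum_right using elq by (intro sum.cong refl) (simp add: fun_vs.scale_sum_right)
  also have "\<dots> = (\<Sum>x\<in>S. fscale (f (?c x)) (ract N (el x) a))"
    using ract_expand[OF N el a] by (intro sum.cong) auto
  also have "\<dots> = ract N (act_hom S el f) a"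
    unfolding act_hom_def using linear_on_sum_scale[OF Ns ract_linear[OF N a], of S el] el by simp
  finally show "act_hom S el (ract (act_module S act) f a) = ract N (act_hom S el f) a" .
qed

end

section \<open>Projective modules are free on paths\<close>

text \<open>The coefficients are indexed by the family and not by the set of its values, since
  different paths may give the same vector.\<close>

lemma span_image_family:
  fixes w :: "'x \<Rightarrow> ('i \<Rightarrow> 'k::field)"
  assumes "finite X" "v \<in> fun_vs.span (w ` X)"
  obtains c where "v = (\<Sum>x\<in>X. fscale (c x) (w x))"
proof -
  let ?W = "{v. \<exists>c. v = (\<Sum>x\<in>X. fscale (c x) (w x))}"
  have "fun_vs.subspace ?W"
    unfolding fun_vs.subspace_def
  proof (intro conjI ballI allI)
    show "0 \<in> ?W" by (intro CollectI exI[of _ "\<lambda>_. 0"]) simp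
    fix a b assume "a \<in> ?W" "b \<in> ?W"
    then obtain c d where "a = (\<Sum>x\<in>X. fscale (c x) (w x))" "b = (\<Sum>x\<in>X. fscale (d x) (w x))" by blast
    then have "a + b = (\<Sum>x\<in>X. fscale (c x + d x) (w x))"
      by (simp only: fun_vs.scale_left_distrib sum.distrib)
    then show "a + b \<in> ?W" by (intro CollectI exI[of _ "\<lambda>x. c x + d x"])
  next
    fix t a assume "a \<in> ?W"
    then obtain c where "a = (\<Sum>x\<in>X. fscale (c x) (w x))" by blast
    then have "fscale t a = (\<Sum>x\<in>X. fscale (t * c x) (w x))"
      by (simp only: fun_vs.scale_sum_right fun_vs.scale_scale)
    then show "fscale t a \<in> ?W" by (intro CollectI exI[of _ "\<lambda>x. t * c x"])
  qed
  moreover have "w ` X \<subseteq> ?W"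
  proof
    fix v assume "v \<in> w ` X"
    then obtain y where y: "y \<in> X" "v = w y" by blast
    have "(\<Sum>x\<in>X. fscale (of_bool (x = y)) (w x)) = (\<Sum>x\<in>X. if x = y then w y else 0)"
      by (intro sum.cong) auto
    then have "v = (\<Sum>x\<in>X. fscale (of_bool (x = y)) (w x))" using y assms(1) by simp
    then show "v \<in> ?W" by (intro CollectI exI[of _ "\<lambda>x. of_bool (x = y)"])
  qed
  ultimately have "fun_vs.span (w ` X) \<subseteq> ?W" by (rule fun_vs.span_minimal[rotated])
  then show ?thesis using assms(2) that by blast
qed

context path_basis
begin

section \<open>Free modules on paths\<close>

lemma act_module_linear_ext:
  assumes "finite S" "linear_on (elems (act_module S act)) f" "linear_on (elems (act_module S act)) g"
    and "\<And>x. x \<in> S \<Longrightarrow> f (bas S x) = g (bas S x)" "v \<in> elems (act_module S act)"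
  shows "f v = g v"
proof -
  have v: "v = (\<Sum>x\<in>S. fscale (v (to_nat_on S x)) (bas S x))"
    by (rule act_module_expand[OF assms(1,5)])
  have "f v = (\<Sum>x\<in>S. fscale (v (to_nat_on S x)) (f (bas S x)))"
    by (subst v, rule linear_on_sum_scale[OF act_module_subspace assms(2) bas_mem])
  also have "\<dots> = (\<Sum>x\<in>S. fscale (v (to_nat_on S x)) (g (bas S x)))"
    using assms(4) by simp
  also have "\<dots> = g v"
    by (subst (2) v, rule linear_on_sum_scale[OF act_module_subspace assms(3) bas_mem, symmetric])
  finally show ?thesis .
qed

text \<open>These pairs index a basis of the direct sum of the P_(b k) over k in K: the pair (k, q)
  stands for the generator k multiplied by the path q.\<close>

definition free_idx :: "'g set \<Rightarrow> ('g \<Rightarrow> 'v) \<Rightarrow> ('g \<times> 'q) set" where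
  "free_idx K b = (SIGMA k:K. {q \<in> Q. src q = b k})"

definition free_act :: "'g set \<Rightarrow> ('g \<Rightarrow> 'v) \<Rightarrow> 'g \<times> 'q \<Rightarrow> 'q \<Rightarrow> 'g \<times> 'q \<Rightarrow> bool" where
  "free_act K b x p y \<longleftrightarrow> fst x = fst y \<and> fst x \<in> K \<and> src (snd x) = b (fst x) \<and> T (snd x) p (snd y)"

abbreviation free_module :: "'g set \<Rightarrow> ('g \<Rightarrow> 'v) \<Rightarrow> ('k, 'a, nat) rmodule" where
  "free_module K b \<equiv> act_module (free_idx K b) (free_act K b)"

lemma free_idx_iff: "x \<in> free_idx K b \<longleftrightarrow> fst x \<in> K \<and> snd x \<in> Q \<and> src (snd x) = b (fst x)"
  unfolding free_idx_def by (cases x) auto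

lemma free_idx_finite: "finite K \<Longrightarrow> finite (free_idx K b)"
  unfolding free_idx_def using finQ by (intro finite_SigmaI) auto

lemma free_idx_idp: "k \<in> K \<Longrightarrow> b k \<in> V \<Longrightarrow> (k, idp (b k)) \<in> free_idx K b"
  by (simp add: free_idx_iff idp_Q idp_src)

lemma free_path_action:
  assumes K: "finite K" "\<And>k. k \<in> K \<Longrightarrow> b k \<in> V"
  shows "path_action (free_idx K b) (free_act K b) (\<lambda>x. tgt (snd x))"
  unfolding path_action_def
proof (intro conjI allI impI ballI)
  show "finite (free_idx K b)" by (rule free_idx_finite[OF K(1)])
  fix x y :: "'b \<times> 'q" and q
  assume a: "free_act K b x q y"
  then have t: "T (snd x) q (snd y)" by (simp add: free_act_def)
  show "x \<in> free_idx K b" "q \<in> Q" "y \<in> free_idx K b"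
    using a T_mem[OF t] T_ends[OF t] by (auto simp: free_act_def free_idx_iff)
next
  fix x y z :: "'b \<times> 'q" and q
  assume "free_act K b x q y \<and> free_act K b x q z"
  then show "y = z" using T_fun unfolding free_act_def by (metis prod.collapse)
next
  fix x z :: "'b \<times> 'q" and p q
  show "(\<exists>y. free_act K b x p y \<and> free_act K b y q z) \<longleftrightarrow> (\<exists>r. T p q r \<and> free_act K b x r z)"
  proof
    assume "\<exists>y. free_act K b x p y \<and> free_act K b y q z"
    then obtain y where y: "free_act K b x p y" "free_act K b y q z" by blast
    then have "\<exists>u. T (snd x) p u \<and> T u q (snd z)" unfolding free_act_def by blast
    then obtain r where "T p q r" "T (snd x) r (snd z)" using T_assoc by blast
    then show "\<exists>r. T p q r \<and> free_act K b x r z" using y unfolding free_act_def by metis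
  next
    assume "\<exists>r. T p q r \<and> free_act K b x r z"
    then obtain r where r: "T p q r" "free_act K b x r z" by blast
    then have "\<exists>u. T p q u \<and> T (snd x) u (snd z)" unfolding free_act_def by blast
    then obtain u where u: "T (snd x) p u" "T u q (snd z)" using T_assoc by blast
    then have "free_act K b x p (fst x, u) \<and> free_act K b (fst x, u) q z"
      using r(2) T_ends[OF u(1)] unfolding free_act_def by auto
    then show "\<exists>y. free_act K b x p y \<and> free_act K b y q z" by blast
  qed
next
  fix x :: "'b \<times> 'q" assume x: "x \<in> free_idx K b"
  then show "tgt (snd x) \<in> V" by (simp add: free_idx_iff tgt_V)
  fix v and y :: "'b \<times> 'q" assume v: "v \<in> V"
  show "free_act K b x (idp v) y \<longleftrightarrow> y = x \<and> v = tgt (snd x)"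
    using x unfolding free_act_def T_idpD(2)[OF v] free_idx_iff by (cases x; cases y) auto
qed

lemma free_right_module:
  "finite K \<Longrightarrow> (\<And>k. k \<in> K \<Longrightarrow> b k \<in> V) \<Longrightarrow> right_module A (free_module K b)"
  by (rule act_module_right_module[OF free_path_action])

definition free_elem :: "('k, 'a, 'i) rmodule \<Rightarrow> ('g \<Rightarrow> 'i \<Rightarrow> 'k) \<Rightarrow> 'g \<times> 'q \<Rightarrow> 'i \<Rightarrow> 'k" where
  "free_elem N p x = ract N (p (fst x)) (\<beta> (snd x))"

abbreviation free_hom where
  "free_hom K b N p \<equiv> act_hom (free_idx K b) (free_elem N p)"

lemma free_elem_mem:
  assumes "right_module A N" "\<And>k. k \<in> K \<Longrightarrow> p k \<in> wspace N (ve (b k))" "x \<in> free_idx K b"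
  shows "free_elem N p x \<in> elems N"
  unfolding free_elem_def
  by (rule right_moduleD(3)[OF assms(1) subsetD[OF wspace_subset assms(2)] \<beta>_closed])
    (use assms(3) in \<open>simp_all add: free_idx_iff\<close>)

lemma free_elem_act:
  assumes "right_module A N" "\<And>k. k \<in> K \<Longrightarrow> p k \<in> wspace N (ve (b k))"
  shows "free_act K b x q y \<Longrightarrow> ract N (free_elem N p x) (\<beta> q) = free_elem N p y"
    and "x \<in> free_idx K b \<Longrightarrow> q \<in> Q \<Longrightarrow> \<nexists>y. free_act K b x q y \<Longrightarrow> ract N (free_elem N p x) (\<beta> q) = 0"
proof -
  have mem: "fst x \<in> K \<Longrightarrow> p (fst x) \<in> elems N" by (rule subsetD[OF wspace_subset assms(2)])
  show "free_act K b x q y \<Longrightarrow> ract N (free_elem N p x) (\<beta> q) = free_elem N p y"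
    using ract_T[OF assms(1) mem, of "snd x" q "snd y"] by (auto simp: free_act_def free_elem_def)
  show "x \<in> free_idx K b \<Longrightarrow> q \<in> Q \<Longrightarrow> \<nexists>y. free_act K b x q y \<Longrightarrow> ract N (free_elem N p x) (\<beta> q) = 0"
    unfolding free_elem_def
  proof (rule ract_no_T[OF assms(1)])
    assume x: "x \<in> free_idx K b" and n: "\<nexists>y. free_act K b x q y"
    show "p (fst x) \<in> elems N" "snd x \<in> Q" using x mem by (simp_all add: free_idx_iff)
    show "\<nexists>r. T (snd x) q r"
    proof
      assume "\<exists>r. T (snd x) q r"
      then obtain r where "T (snd x) q r" by blast
      then have "free_act K b x q (fst x, r)" using x by (simp add: free_act_def free_idx_iff)
      then show False using n by blast
    qed
  qed
qed

lemma free_hom_hom: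
  assumes K: "finite K" "\<And>k. k \<in> K \<Longrightarrow> b k \<in> V" and N: "right_module A N"
    and p: "\<And>k. k \<in> K \<Longrightarrow> p k \<in> wspace N (ve (b k))"
  shows "free_hom K b N p \<in> module_hom A (free_module K b) N"
  by (rule act_hom_hom[OF free_path_action[OF K] N free_elem_mem[OF N p] free_elem_act[OF N p]])

lemma free_bas_idp:
  assumes K: "finite K" "\<And>k. k \<in> K \<Longrightarrow> b k \<in> V" and x: "x \<in> free_idx K b"
  shows "ract (free_module K b) (bas (free_idx K b) (fst x, idp (b (fst x)))) (\<beta> (snd x)) = bas (free_idx K b) x"
proof (rule bas_ract[OF free_path_action[OF K]])
  have v: "b (fst x) \<in> V" "src (snd x) = b (fst x)" "snd x \<in> Q" using x K by (auto simp: free_idx_iff)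
  show "free_act K b (fst x, idp (b (fst x))) (snd x) x"
    using v x T_idpD(1)[OF v(1)] by (simp add: free_act_def free_idx_iff idp_src)
qed

lemma free_bas_wspace:
  assumes K: "finite K" "\<And>k. k \<in> K \<Longrightarrow> b k \<in> V" and k: "k \<in> K"
  shows "bas (free_idx K b) (k, idp (b k)) \<in> wspace (free_module K b) (ve (b k))"
proof -
  have x: "(k, idp (b k)) \<in> free_idx K b" by (rule free_idx_idp) (use k K in auto)
  show ?thesis using free_bas_idp[OF K x] bas_mem[OF x] unfolding wspace_def by simp
qed

text \<open>The image of a generator under h lifts along g to some element of M. Multiplied by the
  vertex idempotent the lift still has the right image and now lies at the vertex of the generator,
  so it may be prescribed as the value there.\<close>

lemma free_projective:
  assumes K: "finite K" "\<And>k. k \<in> K \<Longrightarrow> b k \<in> V"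
  shows "projective_module A (free_module K b)"
  unfolding projective_module_def
proof (intro conjI allI impI)
  show "right_module A (free_module K b)" by (rule free_right_module[OF K])
next
  fix M N :: "('k, 'a, nat) rmodule" and g h
  let ?P = "free_module K b" and ?S = "free_idx K b"
  assume "right_module A M \<and> right_module A N \<and> g \<in> module_hom A M N \<and> g ` elems M = elems N \<and>
    h \<in> module_hom A ?P N"
  then have M: "right_module A M" and N: "right_module A N" and g: "g \<in> module_hom A M N"
    and gs: "g ` elems M = elems N" and h: "h \<in> module_hom A ?P N" by auto
  have "\<exists>m\<in>wspace M (ve (b k)). g m = h (bas ?S (k, idp (b k)))" if k: "k \<in> K" for k
  proof -
    have w: "h (bas ?S (k, idp (b k))) \<in> wspace N (ve (b k))"
      by (rule module_hom_wspace[OF h ve_closed[OF K(2)[OF k]] free_bas_wspace[OF K k]])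
    then obtain m where m: "m \<in> elems M" "g m = h (bas ?S (k, idp (b k)))"
      using gs[symmetric] by (auto simp: wspace_def)
    have "g (ract M m (ve (b k))) = h (bas ?S (k, idp (b k)))"
      using module_homD(3)[OF g m(1) ve_closed[OF K(2)[OF k]]] w m(2) by (simp add: wspace_def)
    then show ?thesis using ract_ve_wspace[OF M K(2)[OF k] m(1)] by blast
  qed
  then obtain p where p: "\<And>k. k \<in> K \<Longrightarrow> p k \<in> wspace M (ve (b k))"
    and gp: "\<And>k. k \<in> K \<Longrightarrow> g (p k) = h (bas ?S (k, idp (b k)))" by metis
  let ?l = "free_hom K b M p"
  have l: "?l \<in> module_hom A ?P M" by (rule free_hom_hom[OF K M p])
  show "\<exists>l\<in>module_hom A ?P M. \<forall>v\<in>elems ?P. g (l v) = h v"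
  proof (intro bexI[OF _ l] ballI)
    fix v assume v: "v \<in> elems ?P"
    show "g (?l v) = h v"
    proof (rule act_module_linear_ext[OF free_idx_finite[OF K(1)] _ module_homD(1)[OF h] _ v])
      show "linear_on (elems ?P) (\<lambda>v. g (?l v))"
        using module_homD(1,2)[OF l] module_homD(1)[OF g] unfolding linear_on_def by auto
      fix x assume x: "x \<in> ?S"
      have xx: "fst x \<in> K" "\<beta> (snd x) \<in> carrier A" "p (fst x) \<in> elems M"
        using x p \<beta>_closed by (auto simp: free_idx_iff wspace_def)
      have "g (?l (bas ?S x)) = g (ract M (p (fst x)) (\<beta> (snd x)))"
        by (simp only: act_hom_bas[OF free_idx_finite[OF K(1)] x] free_elem_def)
      also have "\<dots> = ract N (h (bas ?S (fst x, idp (b (fst x))))) (\<beta> (snd x))"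
        using module_homD(3)[OF g xx(3,2)] gp[OF xx(1)] by simp
      also have "\<dots> = h (ract ?P (bas ?S (fst x, idp (b (fst x)))) (\<beta> (snd x)))"
        using module_homD(3)[OF h bas_mem xx(2)] free_idx_idp xx(1) K(2) by metis
      also have "\<dots> = h (bas ?S x)" using free_bas_idp[OF K x] by simp
      finally show "g (?l (bas ?S x)) = h (bas ?S x)" .
    qed
  qed
qed

section \<open>The indecomposable projective P_v\<close>

abbreviation vproj :: "'v \<Rightarrow> ('k, 'a, nat) rmodule" where
  "vproj v \<equiv> free_module {()} (\<lambda>_. v)"

lemma vproj_generated:
  assumes v: "v \<in> V" and U: "submodule A U (vproj v)"
    and u: "bas (free_idx {()} (\<lambda>_. v)) ((), idp v) \<in> U"
  shows "elems (vproj v) \<subseteq> U"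
proof
  let ?S = "free_idx {()} (\<lambda>_. v)"
  have K: "finite {()}" "\<And>k. k \<in> {()} \<Longrightarrow> v \<in> V" using v by auto
  have Us: "fun_vs.subspace U" and Ua: "\<And>u a. u \<in> U \<Longrightarrow> a \<in> carrier A \<Longrightarrow> ract (vproj v) u a \<in> U"
    using U unfolding submodule_def by auto
  have b: "bas ?S x \<in> U" if x: "x \<in> ?S" for x
    using free_bas_idp[OF K x] Ua[OF u, of "\<beta> (snd x)"] x \<beta>_closed by (auto simp: free_idx_iff)
  fix f assume "f \<in> elems (vproj v)"
  from act_module_expand[OF free_idx_finite[OF K(1)] this]
  show "f \<in> U" using fun_vs.subspace_sum[OF Us] fun_vs.subspace_scale[OF Us] b
    by (metis (no_types, lifting))
qed

text \<open>By acyclicity the only path from v to v is trivial, so the part of P_v at v is the line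
  through the generator.\<close>

lemma vproj_wspace:
  assumes v: "v \<in> V" and f: "f \<in> wspace (vproj v) (ve v)"
  shows "\<exists>c. f = fscale c (bas (free_idx {()} (\<lambda>_. v)) ((), idp v))"
proof -
  let ?S = "free_idx {()} (\<lambda>_. v)" and ?c = "to_nat_on (free_idx {()} (\<lambda>_. v))"
  have K: "finite {()}" "\<And>k. k \<in> {()} \<Longrightarrow> v \<in> V" using v by auto
  have R: "right_module A (vproj v)" by (rule free_right_module) (use v in auto)
  have fm: "f \<in> elems (vproj v)" "ract (vproj v) f (ve v) = f" using f by (auto simp: wspace_def)
  have b0: "((), idp v) \<in> ?S" using v by (intro free_idx_idp) auto
  have z: "ract (vproj v) (bas ?S x) (ve v) = 0" if x: "x \<in> ?S" "x \<noteq> ((), idp v)" for x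
  proof -
    have q: "snd x \<in> Q" "src (snd x) = v" using x by (auto simp: free_idx_iff)
    have "tgt (snd x) \<noteq> v" using acyclic[OF q(1)] q(2) x(2) by (cases x) auto
    then have "\<nexists>r. T (snd x) (idp v) r" using T_idpD(2)[OF v] by blast
    then show ?thesis
      using ract_no_T[OF R bas_mem[OF b0] q(1) idp_Q[OF v]] free_bas_idp[OF K x(1)] by simp
  qed
  have lin: "linear_on (elems (vproj v)) (\<lambda>m. ract (vproj v) m (ve v))"
    by (rule ract_linear[OF R ve_closed[OF v]])
  have "f = ract (vproj v) (\<Sum>x\<in>?S. fscale (f (?c x)) (bas ?S x)) (ve v)"
    using fm act_module_expand[OF free_idx_finite[OF K(1)] fm(1)] by simp
  also have "\<dots> = (\<Sum>x\<in>?S. fscale (f (?c x)) (ract (vproj v) (bas ?S x) (ve v)))"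
    by (rule linear_on_sum_scale[OF act_module_subspace lin bas_mem])
  also have "\<dots> = (\<Sum>x\<in>{((), idp v)}. fscale (f (?c x)) (ract (vproj v) (bas ?S x) (ve v)))"
    using free_idx_finite[OF K(1)] b0 z by (intro sum.mono_neutral_right) auto
  also have "\<dots> = fscale (f (?c ((), idp v))) (bas ?S ((), idp v))"
    using free_bas_idp[OF K b0] by simp
  finally show ?thesis by blast
qed

text \<open>If P_v is the sum of U and W, the components of the generator, multiplied by the
  idempotent of v, are multiples of the generator. One of the multiples is nonzero, so one summand
  contains the generator and is everything.\<close>

lemma vproj_indecomposable:
  assumes v: "v \<in> V"
  shows "indecomposable_module A (vproj v)"
  unfolding indecomposable_module_def
proof (intro conjI allI impI)
  let ?S = "free_idx {()} (\<lambda>_. v)"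
  let ?e = "bas ?S ((), idp v)"
  have K: "finite {()}" "\<And>k. k \<in> {()} \<Longrightarrow> v \<in> V" using v by auto
  have R: "right_module A (vproj v)" by (rule free_right_module) (use v in auto)
  have b0: "((), idp v) \<in> ?S" using v by (intro free_idx_idp) auto
  have e: "?e \<in> elems (vproj v)" by (rule bas_mem[OF b0])
  have e0: "?e \<noteq> 0"
    using bas_apply[OF free_idx_finite[OF K(1)] b0 b0] by fastforce
  show "right_module A (vproj v)" by (rule R)
  show "elems (vproj v) \<noteq> {0}" using e e0 by blast
  fix U W assume a: "submodule A U (vproj v) \<and> submodule A W (vproj v) \<and> U \<inter> W = {0} \<and>
    elems (vproj v) = {u + w |u w. u \<in> U \<and> w \<in> W}"
  then have Us: "submodule A U (vproj v)" and Ws: "submodule A W (vproj v)" and UW: "U \<inter> W = {0}"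
    by simp_all
  have Usub: "fun_vs.subspace U" "U \<subseteq> elems (vproj v)" and Wsub: "fun_vs.subspace W" "W \<subseteq> elems (vproj v)"
    using Us Ws unfolding submodule_def by simp_all
  have "elems (vproj v) = {u + w |u w. u \<in> U \<and> w \<in> W}" using a by (elim conjE)
  then have "?e \<in> {u + w |u w. u \<in> U \<and> w \<in> W}" using e by (rule subst)
  then obtain u w where uw: "?e = u + w" "u \<in> U" "w \<in> W" by blast
  have um: "u \<in> elems (vproj v)" "w \<in> elems (vproj v)"
    by (rule subsetD[OF Usub(2) uw(2)], rule subsetD[OF Wsub(2) uw(3)])
  let ?u = "ract (vproj v) u (ve v)" and ?w = "ract (vproj v) w (ve v)"
  have Ua: "ract (vproj v) x a \<in> X" if "submodule A X (vproj v)" "x \<in> X" "a \<in> carrier A" for X x a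
    using that unfolding submodule_def by simp
  have uw': "?u \<in> U" "?w \<in> W"
    by (rule Ua[OF Us uw(2) ve_closed[OF v]], rule Ua[OF Ws uw(3) ve_closed[OF v]])
  have "?e = ract (vproj v) ?e (ve v)" using free_bas_idp[OF K b0] by simp
  also have "\<dots> = ?u + ?w"
    unfolding uw(1)
    using ract_linear[OF R ve_closed[OF v], unfolded linear_on_def, THEN conjunct1, rule_format, OF um] .
  finally have e_eq: "?e = ?u + ?w" .
  obtain c where c: "?u = fscale c ?e" using vproj_wspace[OF v ract_ve_wspace[OF R v um(1)]] by blast
  obtain d where d: "?w = fscale d ?e" using vproj_wspace[OF v ract_ve_wspace[OF R v um(2)]] by blast
  have main: "Y = {0}" if X: "submodule A X (vproj v)" "Y \<subseteq> elems (vproj v)" "X \<inter> Y = {0}"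
      "fscale t ?e \<in> X" "t \<noteq> 0" for X Y t
  proof -
    have "fscale (inverse t) (fscale t ?e) \<in> X"
      using X(1,4) fun_vs.subspace_scale unfolding submodule_def by blast
    then have "?e \<in> X" using X(5) by simp
    then have "Y \<subseteq> X" using vproj_generated[OF v X(1)] X(2) by blast
    then show ?thesis using X(3) by blast
  qed
  show "U = {0} \<or> W = {0}"
  proof (cases "c = 0")
    case False
    then show ?thesis using main[OF Us Wsub(2) UW, of c] uw'(1) c by simp
  next
    case True
    then have "d \<noteq> 0" using e_eq c d e0 by auto
    then show ?thesis using main[OF Ws Usub(2) _, of d] UW uw'(2) d by (simp add: Int_commute)
  qed
qed


text \<open>Each generator carries its vertex and has to lie in the part of P at that vertex, so
  that K with \<open>snd\<close> can itself index a free module mapping onto P.\<close>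

definition generates :: "('k, 'a, 'i) rmodule \<Rightarrow> (('i \<Rightarrow> 'k) \<times> 'v) set \<Rightarrow> bool" where
  "generates P K \<longleftrightarrow> finite K \<and> (\<forall>k\<in>K. snd k \<in> V \<and> fst k \<in> wspace P (ve (snd k))) \<and>
     elems P \<subseteq> fun_vs.span (free_elem P fst ` free_idx K snd)"

lemma generatesD:
  assumes "generates P K"
  shows "finite K" "\<And>k. k \<in> K \<Longrightarrow> snd k \<in> V" "\<And>k. k \<in> K \<Longrightarrow> fst k \<in> wspace P (ve (snd k))"
    "elems P \<subseteq> fun_vs.span (free_elem P fst ` free_idx K snd)"
  using assms unfolding generates_def by simp_all

text \<open>Cutting a vector space basis by all vertex idempotents yields generators that sit at
  single vertices.\<close>

lemma generates_exists:
  assumes P: "right_module A P"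
  shows "\<exists>K. generates P K"
proof -
  obtain B where B: "B \<subseteq> elems P" "finite B" "elems P = fun_vs.span B"
    by (rule fd_subspace_basis[OF right_moduleD(2)[OF P]])
  let ?K = "(\<lambda>(u, v). (ract P u (ve v), v)) ` (B \<times> V)"
  have kw: "\<forall>k\<in>?K. snd k \<in> V \<and> fst k \<in> wspace P (ve (snd k))"
    using ract_ve_wspace[OF P] B(1) by auto
  have "u \<in> fun_vs.span (free_elem P fst ` free_idx ?K snd)" if u: "u \<in> B" for u
  proof -
    have "u = (\<Sum>v\<in>V. ract P u (ve v))" using vertex_decomp[OF P] u B(1) by blast
    also have "\<dots> \<in> fun_vs.span (free_elem P fst ` free_idx ?K snd)"
    proof (intro fun_vs.span_sum fun_vs.span_base)
      fix v assume v: "v \<in> V"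
      let ?x = "((ract P u (ve v), v), idp v)"
      have k: "(ract P u (ve v), v) \<in> ?K" using u v by force
      have x: "?x \<in> free_idx ?K snd" using k v by (simp add: free_idx_iff idp_Q idp_src)
      have "free_elem P fst ?x = ract P u (ve v)"
        using ract_ve_wspace[OF P v subsetD[OF B(1) u]] by (simp add: free_elem_def wspace_def)
      then show "ract P u (ve v) \<in> free_elem P fst ` free_idx ?K snd"
        by (intro image_eqI[OF _ x]) (rule sym)
    qed
    finally show ?thesis .
  qed
  then have "elems P \<subseteq> fun_vs.span (free_elem P fst ` free_idx ?K snd)"
    unfolding B(3) by (intro fun_vs.span_minimal fun_vs.subspace_span) blast
  then have "generates P ?K" unfolding generates_def using kw B(2) finV by blast
  then show ?thesis by blast
qed

lemma free_span_ract:
  assumes P: "right_module A P" and K: "\<And>k. k \<in> K \<Longrightarrow> p k \<in> wspace P (ve (b k))"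
    and w: "w \<in> fun_vs.span (free_elem P p ` free_idx K b)" and q: "q \<in> Q"
  shows "ract P w (\<beta> q) \<in> fun_vs.span (free_elem P p ` free_idx K b)"
proof -
  let ?W = "fun_vs.span (free_elem P p ` free_idx K b)"
  have sub: "fun_vs.subspace {w \<in> elems P. ract P w (\<beta> q) \<in> ?W}"
    by (rule subspace_vimage[OF right_moduleD(1)[OF P] ract_linear[OF P \<beta>_closed[OF q]] fun_vs.subspace_span])
  have "?W \<subseteq> {w \<in> elems P. ract P w (\<beta> q) \<in> ?W}"
  proof (rule fun_vs.span_minimal[OF _ sub], rule image_subsetI)
    fix x assume x: "x \<in> free_idx K b"
    have m: "free_elem P p x \<in> elems P" by (rule free_elem_mem[OF P K x])
    have "ract P (free_elem P p x) (\<beta> q) \<in> ?W"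
    proof (cases "\<exists>y. free_act K b x q y")
      case True
      then obtain y where y: "free_act K b x q y" by blast
      have "y \<in> free_idx K b" using y T_mem T_ends unfolding free_act_def free_idx_iff by metis
      then have "free_elem P p y \<in> ?W" by (intro fun_vs.span_base imageI)
      moreover have "ract P (free_elem P p x) (\<beta> q) = free_elem P p y"
        by (rule free_elem_act(1)[OF P K y])
      ultimately show ?thesis by simp
    next
      case False
      then have "ract P (free_elem P p x) (\<beta> q) = 0" by (intro free_elem_act(2)[where K = K and b = b, OF P K x q])
      then show ?thesis by (simp add: fun_vs.span_zero)
    qed
    then show "free_elem P p x \<in> {w \<in> elems P. ract P w (\<beta> q) \<in> ?W}" using m by simp
  qed
  then show ?thesis using w by blast
qed

text \<open>A relation involving a generator itself would, by acyclicity, make that generator redundant.\<close>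

lemma minimal_generators_relation:
  assumes P: "right_module A P" and K: "generates P K"
    and min: "\<And>K'. generates P K' \<Longrightarrow> card K \<le> card K'"
    and rel: "(\<Sum>x\<in>free_idx K snd. fscale (c x) (free_elem P fst x)) = 0" and k0: "k0 \<in> K"
  shows "c (k0, idp (snd k0)) = 0"
proof (rule ccontr)
  let ?S = "free_idx K snd" and ?x0 = "(k0, idp (snd k0))" and ?el = "free_elem P fst"
  let ?K' = "K - {k0}"
  let ?W = "fun_vs.span (?el ` free_idx ?K' snd)"
  assume c0: "c ?x0 \<noteq> 0"
  note fK = generatesD(1)[OF K] and KV = generatesD(2)[OF K] and Kw = generatesD(3)[OF K]
    and span = generatesD(4)[OF K]
  have Kw': "\<And>k. k \<in> ?K' \<Longrightarrow> fst k \<in> wspace P (ve (snd k))" using Kw by simp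
  note v0 = KV[OF k0]
  have x0: "?x0 \<in> ?S" using free_idx_idp[OF k0, of snd] v0 by simp
  have em: "\<And>x. x \<in> ?S \<Longrightarrow> ?el x \<in> elems P" by (rule free_elem_mem[OF P Kw])
  have el0: "?el ?x0 = fst k0" using Kw[OF k0] by (simp add: free_elem_def wspace_def)
  \<comment> \<open>The relation is multiplied by the idempotent of the vertex of k0. This fixes the
    generator k0 and kills its multiples by nontrivial paths, which end elsewhere by acyclicity. All
    other terms stay in the span of the remaining generators.\<close>
  let ?t = "\<lambda>x. fscale (c x) (ract P (?el x) (ve (snd k0)))"
  have t: "?t x \<in> ?W" if x: "x \<in> ?S - {?x0}" for x
  proof (cases "fst x = k0")
    case True
    have q: "snd x \<in> Q" "src (snd x) = snd k0" using x True by (auto simp: free_idx_iff)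
    have "tgt (snd x) \<noteq> snd k0" using acyclic[OF q(1)] q(2) x True by (cases x) auto
    then have "\<nexists>y. free_act K snd x (idp (snd k0)) y" unfolding free_act_def T_idpD(2)[OF v0] by blast
    then have "ract P (?el x) (ve (snd k0)) = 0"
      by (intro free_elem_act(2)[OF P Kw _ idp_Q[OF v0]]) (use x in simp_all)
    then show ?thesis by (simp add: fun_vs.span_zero)
  next
    case False
    then have "x \<in> free_idx ?K' snd" using x by (auto simp: free_idx_iff)
    then have "?el x \<in> ?W" by (intro fun_vs.span_base imageI)
    then show ?thesis by (intro fun_vs.span_scale free_span_ract[OF P Kw' _ idp_Q[OF v0]])
  qed
  have "0 = ract P (\<Sum>x\<in>?S. fscale (c x) (?el x)) (ve (snd k0))"
    unfolding rel using ract_zero[OF P ve_closed[OF v0]] by simp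
  also have "\<dots> = (\<Sum>x\<in>?S. ?t x)"
    by (rule linear_on_sum_scale[OF right_moduleD(1)[OF P] ract_linear[OF P ve_closed[OF v0]] em])
  also have "\<dots> = ?t ?x0 + (\<Sum>x\<in>?S - {?x0}. ?t x)"
    by (rule sum.remove[OF free_idx_finite[OF fK] x0])
  finally have "?t ?x0 = - (\<Sum>x\<in>?S - {?x0}. ?t x)"
    unfolding eq_neg_iff_add_eq_0 by (rule sym)
  also have "\<dots> \<in> ?W" by (intro fun_vs.span_neg fun_vs.span_sum t)
  also have "?t ?x0 = fscale (c ?x0) (fst k0)"
    unfolding el0 using Kw[OF k0] by (simp add: wspace_def)
  finally have "fscale (inverse (c ?x0)) (fscale (c ?x0) (fst k0)) \<in> ?W" by (rule fun_vs.span_scale)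
  then have g0: "fst k0 \<in> ?W" using c0 by simp
  have "?el x \<in> ?W" if x: "x \<in> ?S" for x
  proof (cases "fst x = k0")
    case True
    have "ract P (fst k0) (\<beta> (snd x)) \<in> ?W"
      using x by (intro free_span_ract[OF P Kw' g0]) (simp_all add: free_idx_iff)
    then show ?thesis using True by (simp add: free_elem_def)
  next
    case False
    then have "x \<in> free_idx ?K' snd" using x by (auto simp: free_idx_iff)
    then show ?thesis by (intro fun_vs.span_base imageI)
  qed
  then have "fun_vs.span (?el ` ?S) \<subseteq> ?W"
    by (intro fun_vs.span_minimal fun_vs.subspace_span) blast
  then have "elems P \<subseteq> ?W" using span by (rule order_trans[rotated])
  then have "generates P ?K'" unfolding generates_def using fK KV Kw by simp
  then have "card K \<le> card ?K'" by (rule min)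
  then show False using fK k0 card_Diff1_less by (meson not_le)
qed

text \<open>Generators p with coordinate functions \<pi> as in the dual basis lemma, but
  biorthogonal and adapted to the vertices: the coordinate at k has values in e A for the idempotent
  e of the vertex b k. In this form P is the direct sum of the P_(b k).\<close>

definition free_basis ::
  "('k, 'a, 'i) rmodule \<Rightarrow> 'g set \<Rightarrow> ('g \<Rightarrow> 'v) \<Rightarrow> ('g \<Rightarrow> 'i \<Rightarrow> 'k) \<Rightarrow> ('g \<Rightarrow> ('i \<Rightarrow> 'k) \<Rightarrow> 'a) \<Rightarrow> bool" where
  "free_basis M K b p \<pi> \<longleftrightarrow> finite K \<and> (\<forall>k\<in>K. b k \<in> V) \<and> (\<forall>k\<in>K. p k \<in> wspace M (ve (b k))) \<and>
     (\<forall>k\<in>K. \<pi> k \<in> hom_alg A M) \<and>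
     (\<forall>k\<in>K. \<forall>l\<in>K. \<pi> k (p l) = (if k = l then ve (b k) else \<zero>\<^bsub>A\<^esub>)) \<and>
     (\<forall>k\<in>K. \<forall>m\<in>elems M. ve (b k) \<otimes>\<^bsub>A\<^esub> \<pi> k m = \<pi> k m) \<and>
     (\<forall>m\<in>elems M. m = (\<Sum>k\<in>K. ract M (p k) (\<pi> k m)))"

text \<open>
  An element of the kernel of \<open>F \<rightarrow> P\<close> is fixed by the idempotent \<open>e = 1 - l g\<close>. As \<open>e\<close> maps the
  generators of \<open>F\<close> to combinations of nontrivial paths, it raises the degree of the filtration by
  path length, so the kernel is zero.
\<close>

lemma projective_section:
  fixes P :: "('k, 'a, nat) rmodule"
  assumes P: "projective_module A P"
  obtains K l where "generates P K"
    "l \<in> module_hom A P (free_module K snd)"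
    "\<And>v. v \<in> elems P \<Longrightarrow> free_hom K snd P fst (l v) = v"
    "\<And>u. u \<in> elems (free_module K snd) \<Longrightarrow> l (free_hom K snd P fst u) = u"
proof -
  have R: "right_module A P" using P unfolding projective_module_def by blast
  define n where "n = (LEAST n. \<exists>K. generates P K \<and> card K = n)"
  have "\<exists>K. generates P K \<and> card K = n"
    unfolding n_def by (rule LeastI_ex) (use generates_exists[OF R] in simp)
  then obtain K where K: "generates P K" "card K = n" by blast
  have min: "card K \<le> card K'" if "generates P K'" for K'
    unfolding K(2) n_def using that by (intro Least_le) blast
  note fK = generatesD(1)[OF K(1)] and KV = generatesD(2)[OF K(1)] and Kw = generatesD(3)[OF K(1)]
    and span = generatesD(4)[OF K(1)]
  let ?S = "free_idx K snd" and ?F = "free_module K snd" and ?g = "free_hom K snd P fst"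
  let ?c = "to_nat_on ?S"
  note fS = free_idx_finite[OF fK, of snd]
  have F: "right_module A ?F" by (rule free_right_module[OF fK KV])
  have act: "path_action ?S (free_act K snd) (\<lambda>x. tgt (snd x))" by (rule free_path_action[OF fK KV])
  have g: "?g \<in> module_hom A ?F P" by (rule free_hom_hom[OF fK KV R Kw])
  have gs: "?g ` elems ?F = elems P"
  proof
    show "?g ` elems ?F \<subseteq> elems P" using module_homD(2)[OF g] by blast
    show "elems P \<subseteq> ?g ` elems ?F"
    proof
      fix v assume "v \<in> elems P"
      then obtain c where c: "v = (\<Sum>x\<in>?S. fscale (c x) (free_elem P fst x))"
        by (rule span_image_family[OF fS subsetD[OF span]])
      let ?f = "\<Sum>x\<in>?S. fscale (c x) (bas ?S x)"
      have "?g ?f = v" unfolding act_hom_def c by (intro sum.cong) (simp_all only: sum_bas_apply[OF fS])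
      then show "v \<in> ?g ` elems ?F" by (intro image_eqI[OF _ sum_bas_mem]) (rule sym)
    qed
  qed
  have "(\<lambda>v. v) \<in> module_hom A P P" unfolding module_hom_def by simp
  then obtain l where l: "l \<in> module_hom A P ?F" and gl: "\<And>v. v \<in> elems P \<Longrightarrow> ?g (l v) = v"
    using P F R g gs unfolding projective_module_def by blast
  \<comment> \<open>By minimality of K, an element of the kernel has no component at a trivial
    path.\<close>
  have ker_idp: "u (?c (k, idp (snd k))) = 0" if "u \<in> elems ?F" "?g u = 0" "k \<in> K" for u k
    using minimal_generators_relation[OF R K(1) min _ that(3), of "\<lambda>x. u (?c x)"] that(2)
    unfolding act_hom_def by blast
  define e where "e u = u - l (?g u)" for u
  have ge: "?g (e u) = 0" and e_mem: "e u \<in> elems ?F" if "u \<in> elems ?F" for u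
  proof -
    have lu: "l (?g u) \<in> elems ?F" using that module_homD(2)[OF g] module_homD(2)[OF l] by blast
    show "e u \<in> elems ?F" unfolding e_def by (rule subspace_diff_mem[OF act_module_subspace that lu])
    have "?g (e u) = ?g u - ?g (l (?g u))"
      unfolding e_def by (rule linear_on_diff[OF act_module_subspace module_homD(1)[OF g] that lu])
    then show "?g (e u) = 0" using gl module_homD(2)[OF g that] by simp
  qed
  have e_lin: "linear_on (elems ?F) e"
    using module_homD(1)[OF g] module_homD(1)[OF l] module_homD(2)[OF g]
    unfolding linear_on_def e_def by (simp add: fun_vs.scale_right_diff_distrib)
  have e_act: "e (ract ?F u a) = ract ?F (e u) a" if u: "u \<in> elems ?F" and a: "a \<in> carrier A" for u a
  proof -
    have gu: "?g u \<in> elems P" by (rule module_homD(2)[OF g u])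
    have "ract ?F (e u) a = ract ?F u a - ract ?F (l (?g u)) a"
      unfolding e_def
      by (rule linear_on_diff[OF act_module_subspace ract_linear[OF F a] u module_homD(2)[OF l gu]])
    also have "ract ?F (l (?g u)) a = l (?g (ract ?F u a))"
      using module_homD(3)[OF l gu a] module_homD(3)[OF g u a] by simp
    finally show ?thesis unfolding e_def ..
  qed
  \<comment> \<open>Induction on the path length, using u = e u. A component of u at y with length
    below n vanishes by induction. Any other y contributes to the component at x only through a
    factorisation of x as z followed by y, and then z has length 0. It carries a component at a
    trivial path of e applied to a generator, which lies in the kernel, so \<open>ker_idp\<close>
    applies.\<close>
  have ker: "u (?c x) = 0" if u: "u \<in> elems ?F" "?g u = 0" and x: "x \<in> ?S" "len (snd x) < n" for u x n
    using x
  proof (induction n arbitrary: x)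
    case (Suc n)
    have l0: "l 0 = 0" by (rule linear_on_zero[OF right_moduleD(1)[OF R] module_homD(1)[OF l]])
    have "u = e u" unfolding e_def u(2) l0 by simp
    also have "\<dots> = e (\<Sum>y\<in>?S. fscale (u (?c y)) (bas ?S y))"
      by (subst act_module_expand[OF fS u(1)]) simp
    also have "\<dots> = (\<Sum>y\<in>?S. fscale (u (?c y)) (e (bas ?S y)))"
      by (rule linear_on_sum_scale[OF act_module_subspace e_lin bas_mem])
    finally have "u = (\<Sum>y\<in>?S. fscale (u (?c y)) (e (bas ?S y)))" .
    from fun_cong[OF this, of "?c x"]
    have ux: "u (?c x) = (\<Sum>y\<in>?S. u (?c y) * e (bas ?S y) (?c x))"
      unfolding sum_fun_apply fscale_apply .
    have "u (?c y) * e (bas ?S y) (?c x) = 0" if y: "y \<in> ?S" for y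
    proof (cases "len (snd y) < n")
      case True
      then show ?thesis using Suc.IH[OF y] by simp
    next
      case False
      have yk: "fst y \<in> K" "snd y \<in> Q" "\<beta> (snd y) \<in> carrier A"
        using y \<beta>_closed by (auto simp: free_idx_iff)
      let ?y = "(fst y, idp (snd (fst y)))"
      have yS: "?y \<in> ?S" using free_idx_idp[OF yk(1), of snd] KV[OF yk(1)] by simp
      have "e (bas ?S y) = e (ract ?F (bas ?S ?y) (\<beta> (snd y)))"
        using free_bas_idp[OF fK KV y] by simp
      also have "\<dots> = ract ?F (e (bas ?S ?y)) (\<beta> (snd y))"
        by (rule e_act[OF bas_mem[OF yS] yk(3)])
      finally have "e (bas ?S y) (?c x) =
          (\<Sum>z\<in>?S. \<Sum>q\<in>Q. of_bool (free_act K snd z q x) * (e (bas ?S ?y) (?c z) * coef q (\<beta> (snd y))))"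
        using act_module_ract[OF fS Suc.prems(1)] by simp
      also have "\<dots> = 0"
      proof (intro sum.neutral ballI)
        fix z q assume z: "z \<in> ?S" and q: "q \<in> Q"
        show "of_bool (free_act K snd z q x) * (e (bas ?S ?y) (?c z) * coef q (\<beta> (snd y))) = 0"
        proof (cases "free_act K snd z q x \<and> q = snd y")
          case True
          then have "len (snd x) = len (snd z) + len (snd y)" using T_len unfolding free_act_def by blast
          then have "len (snd z) = 0" using Suc.prems(2) False by simp
          then have "snd z = idp (snd (fst z))" using len_zero z by (metis free_idx_iff)
          then have "z = (fst z, idp (snd (fst z)))" by (metis prod.collapse)
          moreover have "e (bas ?S ?y) (?c (fst z, idp (snd (fst z)))) = 0"
            using ker_idp[OF e_mem[OF bas_mem[OF yS]] ge[OF bas_mem[OF yS]]] z by (simp add: free_idx_iff)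
          ultimately show ?thesis by simp
        next
          case False
          then show ?thesis using q yk(2) by (auto simp: coef_\<beta>)
        qed
      qed
      finally show ?thesis by simp
    qed
    then show ?case unfolding ux by (intro sum.neutral) blast
  qed simp
  have "l (?g u) = u" if u: "u \<in> elems ?F" for u
  proof -
    have "e u = 0"
    proof (rule act_module_ext[OF e_mem[OF u]])
      show "0 \<in> elems ?F" by (rule fun_vs.subspace_0[OF act_module_subspace])
      fix x assume "x \<in> ?S"
      then show "e u (?c x) = 0 (?c x)"
        using ker[OF e_mem[OF u] ge[OF u], of x "Suc (len (snd x))"] by simp
    qed
    then show ?thesis unfolding e_def by simp
  qed
  then show ?thesis using that[OF K(1) l gl] by blast
qed

text \<open>The standard basis of the free module is carried over along the isomorphism l: the
  coordinate of m at k collects the coefficients of l m at the pairs (k, q) into one element of the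
  algebra.\<close>

lemma projective_free_basis:
  fixes P :: "('k, 'a, nat) rmodule"
  assumes P: "projective_module A P"
  shows "\<exists>(K :: ((nat \<Rightarrow> 'k) \<times> 'v) set) p \<pi>. free_basis P K snd p \<pi>"
proof -
  have R: "right_module A P" using P unfolding projective_module_def by blast
  obtain K l where K: "generates P K" and l: "l \<in> module_hom A P (free_module K snd)"
    and gl: "\<And>v. v \<in> elems P \<Longrightarrow> free_hom K snd P fst (l v) = v"
    and lg: "\<And>u. u \<in> elems (free_module K snd) \<Longrightarrow> l (free_hom K snd P fst u) = u"
    using projective_section[OF P] by blast
  note fK = generatesD(1)[OF K] and KV = generatesD(2)[OF K] and Kw = generatesD(3)[OF K]
  let ?S = "free_idx K snd" and ?F = "free_module K snd" and ?g = "free_hom K snd P fst"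
  let ?c = "to_nat_on ?S"
  note fS = free_idx_finite[OF fK, of snd]
  \<comment> \<open>The factor \<open>of_bool\<close> discards the paths q for which (k, q) is no
    index, as the code of such a pair has no meaning.\<close>
  define \<pi> where "\<pi> k = (\<lambda>m\<in>elems P. lc (\<lambda>q. of_bool (src q = snd k) * l m (?c (k, q))))"
    for k :: "(nat \<Rightarrow> 'k) \<times> 'v"
  have coef_\<pi>: "coef q (\<pi> k m) = of_bool (src q = snd k) * l m (?c (k, q))"
    if "m \<in> elems P" "q \<in> Q" for k m q
    unfolding \<pi>_def using that by (simp add: coef_lc)
  have \<pi>_closed: "\<pi> k m \<in> carrier A" if "m \<in> elems P" for k m unfolding \<pi>_def using that by simp
  have Ps: "fun_vs.subspace (elems P)" by (rule right_moduleD(1)[OF R])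
  have \<pi>_hom: "\<pi> k \<in> hom_alg A P" if k: "k \<in> K" for k
  proof -
    have "\<pi> k \<in> elems P \<rightarrow>\<^sub>E carrier A" unfolding \<pi>_def by auto
    moreover have "\<pi> k (v + w) = \<pi> k v \<oplus>\<^bsub>A\<^esub> \<pi> k w" if v: "v \<in> elems P" and w: "w \<in> elems P" for v w
    proof (rule coef_ext)
      have vw: "v + w \<in> elems P" by (rule fun_vs.subspace_add[OF Ps v w])
      show "\<pi> k (v + w) \<in> carrier A" "\<pi> k v \<oplus>\<^bsub>A\<^esub> \<pi> k w \<in> carrier A" using \<pi>_closed v w vw by auto
      have "l (v + w) = l v + l w" using module_homD(1)[OF l] v w unfolding linear_on_def by blast
      then show "coef q (\<pi> k (v + w)) = coef q (\<pi> k v \<oplus>\<^bsub>A\<^esub> \<pi> k w)" if "q \<in> Q" for q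
        using that v w vw by (simp add: coef_\<pi> coef_add \<pi>_closed algebra_simps)
    qed
    moreover have "\<pi> k (fscale c v) = c \<odot>\<^bsub>A\<^esub> \<pi> k v" if v: "v \<in> elems P" for c v
    proof (rule coef_ext)
      have cv: "fscale c v \<in> elems P" by (rule fun_vs.subspace_scale[OF Ps v])
      show "\<pi> k (fscale c v) \<in> carrier A" "c \<odot>\<^bsub>A\<^esub> \<pi> k v \<in> carrier A" using \<pi>_closed v cv by auto
      have "l (fscale c v) = fscale c (l v)" using module_homD(1)[OF l] v unfolding linear_on_def by blast
      then show "coef q (\<pi> k (fscale c v)) = coef q (c \<odot>\<^bsub>A\<^esub> \<pi> k v)" if "q \<in> Q" for q
        using that v cv by (simp add: coef_\<pi> coef_smult \<pi>_closed fscale_apply)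
    qed
    moreover have "\<pi> k (ract P v a) = \<pi> k v \<otimes>\<^bsub>A\<^esub> a" if v: "v \<in> elems P" and a: "a \<in> carrier A" for v a
    proof (rule coef_ext)
      have va: "ract P v a \<in> elems P" by (rule right_moduleD(3)[OF R v a])
      show "\<pi> k (ract P v a) \<in> carrier A" "\<pi> k v \<otimes>\<^bsub>A\<^esub> a \<in> carrier A" using \<pi>_closed v va a by auto
      fix r assume r: "r \<in> Q"
      have rhs: "coef r (\<pi> k v \<otimes>\<^bsub>A\<^esub> a) =
          (\<Sum>p\<in>Q. \<Sum>q\<in>Q. of_bool (T p q r) * (of_bool (src p = snd k) * l v (?c (k, p)) * coef q a))"
        using r v a \<pi>_closed by (simp add: coef_mult coef_\<pi>)
      show "coef r (\<pi> k (ract P v a)) = coef r (\<pi> k v \<otimes>\<^bsub>A\<^esub> a)"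
      proof (cases "src r = snd k")
        case False
        then have "of_bool (T p q r) * (of_bool (src p = snd k) * l v (?c (k, p)) * coef q a) = 0" for p q
          using T_ends[of p q r] by auto
        then have "coef r (\<pi> k v \<otimes>\<^bsub>A\<^esub> a) = 0" unfolding rhs by (simp only: sum.neutral_const)
        then show ?thesis using False va r by (simp add: coef_\<pi>)
      next
        case True
        then have rS: "(k, r) \<in> ?S" using k r by (simp add: free_idx_iff)
        have "coef r (\<pi> k (ract P v a)) = ract ?F (l v) a (?c (k, r))"
          using True va r module_homD(3)[OF l v a] by (simp add: coef_\<pi>)
        also have "\<dots> = (\<Sum>x\<in>?S. \<Sum>q\<in>Q. of_bool (free_act K snd x q (k, r)) * (l v (?c x) * coef q a))"
          by (rule act_module_ract[OF fS rS])
        \<comment> \<open>The action keeps the first component, so only indices over k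
          contribute.\<close>
        also have "\<dots> = (\<Sum>x\<in>Pair k ` {p \<in> Q. src p = snd k}.
            \<Sum>q\<in>Q. of_bool (free_act K snd x q (k, r)) * (l v (?c x) * coef q a))"
        proof (rule sum.mono_neutral_right[OF fS])
          show "Pair k ` {p \<in> Q. src p = snd k} \<subseteq> ?S" using k by (auto simp: free_idx_iff)
          show "\<forall>x\<in>?S - Pair k ` {p \<in> Q. src p = snd k}.
              (\<Sum>q\<in>Q. of_bool (free_act K snd x q (k, r)) * (l v (?c x) * coef q a)) = 0"
          proof
            fix x assume x: "x \<in> ?S - Pair k ` {p \<in> Q. src p = snd k}"
            then have "fst x \<noteq> k" by (cases x) (auto simp: free_idx_iff)
            then show "(\<Sum>q\<in>Q. of_bool (free_act K snd x q (k, r)) * (l v (?c x) * coef q a)) = 0"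
              by (simp add: free_act_def)
          qed
        qed
        also have "\<dots> = (\<Sum>p\<in>{p \<in> Q. src p = snd k}. \<Sum>q\<in>Q. of_bool (T p q r) * (l v (?c (k, p)) * coef q a))"
          using k by (subst sum.reindex) (auto simp: inj_on_def free_act_def intro!: sum.cong)
        also have "\<dots> = (\<Sum>p\<in>Q. \<Sum>q\<in>Q. of_bool (T p q r) * (of_bool (src p = snd k) * l v (?c (k, p)) * coef q a))"
          using finQ by (intro sum.mono_neutral_cong_left) auto
        finally show ?thesis using rhs by simp
      qed
    qed
    ultimately show ?thesis unfolding hom_alg_def by blast
  qed
  have lfst: "l (fst k) = bas ?S (k, idp (snd k))" if k: "k \<in> K" for k
  proof -
    have x: "(k, idp (snd k)) \<in> ?S" using free_idx_idp[OF k, of snd] KV[OF k] by simp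
    have "?g (bas ?S (k, idp (snd k))) = fst k"
      unfolding act_hom_bas[OF fS x] using Kw[OF k] by (simp add: free_elem_def wspace_def)
    then show ?thesis using lg[OF bas_mem[OF x]] by simp
  qed
  have Kmem: "fst k \<in> elems P" if "k \<in> K" for k
    by (rule subsetD[OF wspace_subset Kw[OF that]])
  have dual: "\<pi> k (fst k') = (if k = k' then ve (snd k) else \<zero>\<^bsub>A\<^esub>)" if k: "k \<in> K" "k' \<in> K" for k k'
  proof (rule coef_ext)
    show "\<pi> k (fst k') \<in> carrier A" by (rule \<pi>_closed[OF Kmem[OF k(2)]])
    show "(if k = k' then ve (snd k) else \<zero>\<^bsub>A\<^esub>) \<in> carrier A" using ve_closed KV k by simp
    fix q assume q: "q \<in> Q"
    have x: "(k', idp (snd k')) \<in> ?S" using free_idx_idp[OF k(2), of snd] KV[OF k(2)] by simp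
    show "coef q (\<pi> k (fst k')) = coef q (if k = k' then ve (snd k) else \<zero>\<^bsub>A\<^esub>)"
    proof (cases "src q = snd k")
      case True
      then have "(k, q) \<in> ?S" using k q by (simp add: free_idx_iff)
      then show ?thesis using True q k x Kmem KV
        by (simp add: coef_\<pi> lfst bas_apply[OF fS] coef_\<beta> idp_Q coef_zero)
    next
      case False
      then have "q \<noteq> idp (snd k)" using idp_src KV k by metis
      then show ?thesis using False q k Kmem KV
        by (auto simp: coef_\<pi> coef_\<beta> idp_Q coef_zero)
    qed
  qed
  have left: "ve (snd k) \<otimes>\<^bsub>A\<^esub> \<pi> k m = \<pi> k m" if k: "k \<in> K" and m: "m \<in> elems P" for k m
  proof (rule coef_ext)
    show "ve (snd k) \<otimes>\<^bsub>A\<^esub> \<pi> k m \<in> carrier A" "\<pi> k m \<in> carrier A"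
      using \<pi>_closed[OF m] ve_closed KV k by auto
    fix r assume r: "r \<in> Q"
    show "coef r (ve (snd k) \<otimes>\<^bsub>A\<^esub> \<pi> k m) = coef r (\<pi> k m)"
      unfolding coef_ve_left[OF r KV[OF k] \<pi>_closed[OF m]] using r m by (simp add: coef_\<pi>)
  qed
  have rep: "m = (\<Sum>k\<in>K. ract P (fst k) (\<pi> k m))" if m: "m \<in> elems P" for m
  proof -
    have "m = ?g (l m)" using gl[OF m] by simp
    also have "\<dots> = (\<Sum>k\<in>K. \<Sum>q\<in>{q \<in> Q. src q = snd k}. fscale (l m (?c (k, q))) (free_elem P fst (k, q)))"
      unfolding act_hom_def free_idx_def using fK finQ by (subst sum.Sigma) auto
    also have "\<dots> = (\<Sum>k\<in>K. \<Sum>q\<in>Q. fscale (coef q (\<pi> k m)) (ract P (fst k) (\<beta> q)))"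
      using finQ m by (intro sum.cong[OF refl] sum.mono_neutral_cong_left) (auto simp: coef_\<pi> free_elem_def)
    also have "\<dots> = (\<Sum>k\<in>K. ract P (fst k) (\<pi> k m))"
      using ract_expand[OF R Kmem \<pi>_closed[OF m]] by (intro sum.cong) auto
    finally show ?thesis .
  qed
  have "free_basis P K snd fst \<pi>"
    unfolding free_basis_def using fK KV Kw \<pi>_hom dual left rep by blast
  then show ?thesis by blast
qed

end

section \<open>The Nakayama functor on projective modules\<close>

text \<open>A linear form is viewed as a linear map into the functions on a one-point type, which
  makes \<open>linear_on_sum_scale\<close> applicable.\<close>

lemma functional_sum:
  fixes F :: "('i \<Rightarrow> 'k::field) \<Rightarrow> 'k"
  assumes V: "fun_vs.subspace V" and add: "\<And>v w. v \<in> V \<Longrightarrow> w \<in> V \<Longrightarrow> F (v + w) = F v + F w"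
    and scale: "\<And>c v. v \<in> V \<Longrightarrow> F (fscale c v) = c * F v" and w: "\<And>x. x \<in> X \<Longrightarrow> w x \<in> V"
  shows "F (\<Sum>x\<in>X. fscale (c x) (w x)) = (\<Sum>x\<in>X. c x * F (w x))"
proof -
  have "linear_on V (\<lambda>m (_::unit). F m)"
    unfolding linear_on_def using add scale by (auto simp: fun_eq_iff fscale_apply)
  from linear_on_sum_scale[OF V this w, where c = c and X = X]
  have "(\<lambda>_::unit. F (\<Sum>x\<in>X. fscale (c x) (w x))) = (\<Sum>x\<in>X. fscale (c x) (\<lambda>_. F (w x)))" by simp
  from fun_cong[OF this, of "()"] show ?thesis unfolding sum_fun_apply fscale_apply .
qed

lemma hom_algD:
  assumes "f \<in> hom_alg A M" "v \<in> elems M"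
  shows "f v \<in> carrier A" "w \<in> elems M \<Longrightarrow> f (v + w) = f v \<oplus>\<^bsub>A\<^esub> f w" "f (fscale c v) = c \<odot>\<^bsub>A\<^esub> f v"
    "a \<in> carrier A \<Longrightarrow> f (ract M v a) = f v \<otimes>\<^bsub>A\<^esub> a"
  using assms unfolding hom_alg_def by auto

lemma hom_alg_ext:
  assumes "f \<in> hom_alg A M" "g \<in> hom_alg A M" "\<And>v. v \<in> elems M \<Longrightarrow> f v = g v"
  shows "f = g"
  using assms unfolding hom_alg_def by (blast intro: PiE_ext)

lemma restrict_hom_algI:
  assumes "fun_vs.subspace (elems M)" "\<And>v a. v \<in> elems M \<Longrightarrow> a \<in> carrier A \<Longrightarrow> ract M v a \<in> elems M"
    "\<And>v. v \<in> elems M \<Longrightarrow> f v \<in> carrier A"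
    "\<And>v w. v \<in> elems M \<Longrightarrow> w \<in> elems M \<Longrightarrow> f (v + w) = f v \<oplus>\<^bsub>A\<^esub> f w"
    "\<And>c v. v \<in> elems M \<Longrightarrow> f (fscale c v) = c \<odot>\<^bsub>A\<^esub> f v"
    "\<And>v a. v \<in> elems M \<Longrightarrow> a \<in> carrier A \<Longrightarrow> f (ract M v a) = f v \<otimes>\<^bsub>A\<^esub> a"
  shows "(\<lambda>v\<in>elems M. f v) \<in> hom_alg A M"
  using assms fun_vs.subspace_add[OF assms(1)] fun_vs.subspace_scale[OF assms(1)]
  unfolding hom_alg_def by simp

lemma nakayama_objD:
  assumes "\<phi> \<in> elems (nakayama_obj A M)"
  shows "f \<notin> hom_alg A M \<Longrightarrow> \<phi> f = 0"
    "f \<in> hom_alg A M \<Longrightarrow> g \<in> hom_alg A M \<Longrightarrow> \<phi> (\<lambda>v\<in>elems M. f v \<oplus>\<^bsub>A\<^esub> g v) = \<phi> f + \<phi> g"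
    "f \<in> hom_alg A M \<Longrightarrow> \<phi> (\<lambda>v\<in>elems M. c \<odot>\<^bsub>A\<^esub> f v) = c * \<phi> f"
  using assms unfolding nakayama_obj_def by simp_all

lemma nakayama_objI:
  assumes "\<And>f. f \<notin> hom_alg A M \<Longrightarrow> \<phi> f = 0"
    "\<And>f g. f \<in> hom_alg A M \<Longrightarrow> g \<in> hom_alg A M \<Longrightarrow> \<phi> (\<lambda>v\<in>elems M. f v \<oplus>\<^bsub>A\<^esub> g v) = \<phi> f + \<phi> g"
    "\<And>c f. f \<in> hom_alg A M \<Longrightarrow> \<phi> (\<lambda>v\<in>elems M. c \<odot>\<^bsub>A\<^esub> f v) = c * \<phi> f"
  shows "\<phi> \<in> elems (nakayama_obj A M)"
  using assms unfolding nakayama_obj_def by simp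

lemma nakayama_obj_ract:
  "ract (nakayama_obj A M) \<phi> a f = (if f \<in> hom_alg A M then \<phi> (\<lambda>v\<in>elems M. a \<otimes>\<^bsub>A\<^esub> f v) else 0)"
  by (simp add: nakayama_obj_def)

lemma nakayama_obj_subspace: "fun_vs.subspace (elems (nakayama_obj A M))"
  unfolding fun_vs.subspace_def nakayama_obj_def by (auto simp: fscale_apply algebra_simps)

context path_basis
begin

lemma smult_zero: "c \<odot>\<^bsub>A\<^esub> \<zero>\<^bsub>A\<^esub> = \<zero>\<^bsub>A\<^esub>"
  by (rule coef_ext) (simp_all add: coef_smult coef_zero)

lemma smult_add: "x \<in> carrier A \<Longrightarrow> y \<in> carrier A \<Longrightarrow> c \<odot>\<^bsub>A\<^esub> (x \<oplus>\<^bsub>A\<^esub> y) = c \<odot>\<^bsub>A\<^esub> x \<oplus>\<^bsub>A\<^esub> c \<odot>\<^bsub>A\<^esub> y"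
  by (rule coef_ext) (simp_all add: coef_smult coef_add algebra_simps)

lemma smult_smult: "x \<in> carrier A \<Longrightarrow> c \<odot>\<^bsub>A\<^esub> (d \<odot>\<^bsub>A\<^esub> x) = (c * d) \<odot>\<^bsub>A\<^esub> x"
  by (rule coef_ext) (simp_all add: coef_smult)

lemma hom_alg_zero:
  assumes M: "right_module A M"
  shows "(\<lambda>v\<in>elems M. \<zero>\<^bsub>A\<^esub>) \<in> hom_alg A M"
  by (rule restrict_hom_algI[OF right_moduleD(1,3)[OF M]]) (simp_all add: smult_zero)

lemma hom_alg_add:
  assumes M: "right_module A M" and f: "f \<in> hom_alg A M" and g: "g \<in> hom_alg A M"
  shows "(\<lambda>v\<in>elems M. f v \<oplus>\<^bsub>A\<^esub> g v) \<in> hom_alg A M"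
  by (rule restrict_hom_algI[OF right_moduleD(1,3)[OF M]])
    (simp_all add: hom_algD[OF f] hom_algD[OF g] smult_add l_distr a_ac)

lemma hom_alg_smult:
  assumes M: "right_module A M" and f: "f \<in> hom_alg A M"
  shows "(\<lambda>v\<in>elems M. c \<odot>\<^bsub>A\<^esub> f v) \<in> hom_alg A M"
  by (rule restrict_hom_algI[OF right_moduleD(1,3)[OF M]])
    (simp_all add: hom_algD[OF f] smult_add smult_smult mult_smult_left mult.commute)

lemma hom_alg_lmult:
  assumes M: "right_module A M" and f: "f \<in> hom_alg A M" and a: "a \<in> carrier A"
  shows "(\<lambda>v\<in>elems M. a \<otimes>\<^bsub>A\<^esub> f v) \<in> hom_alg A M"
  by (rule restrict_hom_algI[OF right_moduleD(1,3)[OF M]])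
    (simp_all add: a hom_algD[OF f] r_distr mult_smult_right m_assoc)

lemma hom_alg_comp:
  assumes M: "right_module A M" and h: "h \<in> module_hom A M N" and f: "f \<in> hom_alg A N"
  shows "(\<lambda>v\<in>elems M. f (h v)) \<in> hom_alg A M"
proof (rule restrict_hom_algI[OF right_moduleD(1,3)[OF M]])
  note hN = module_homD(2)[OF h]
  show "f (h v) \<in> carrier A" if "v \<in> elems M" for v using hom_algD(1)[OF f hN[OF that]] .
  show "f (h (v + w)) = f (h v) \<oplus>\<^bsub>A\<^esub> f (h w)" if "v \<in> elems M" "w \<in> elems M" for v w
    using module_homD(1)[OF h] that hom_algD(2)[OF f hN hN] unfolding linear_on_def by simp
  show "f (h (fscale c v)) = c \<odot>\<^bsub>A\<^esub> f (h v)" if "v \<in> elems M" for c v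
    using module_homD(1)[OF h] that hom_algD(3)[OF f hN] unfolding linear_on_def by simp
  show "f (h (ract M v a)) = f (h v) \<otimes>\<^bsub>A\<^esub> a" if "v \<in> elems M" "a \<in> carrier A" for v a
    using module_homD(3)[OF h that] hom_algD(4)[OF f hN[OF that(1)] that(2)] by simp
qed simp_all

lemma hom_alg_at_zero:
  assumes M: "right_module A M" and f: "f \<in> hom_alg A M" shows "f 0 = \<zero>\<^bsub>A\<^esub>"
proof (rule coef_ext)
  have 0: "0 \<in> elems M" by (rule fun_vs.subspace_0[OF right_moduleD(1)[OF M]])
  show "f 0 \<in> carrier A" by (rule hom_algD(1)[OF f 0])
  show "coef q (f 0) = coef q \<zero>\<^bsub>A\<^esub>" if "q \<in> Q" for q
    using hom_algD(3)[OF f 0, of 0] coef_smult[OF that hom_algD(1)[OF f 0], of 0] that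
    by (simp add: coef_zero)
qed simp

lemma nakayama_at_zero:
  assumes M: "right_module A M" and \<phi>: "\<phi> \<in> elems (nakayama_obj A M)"
  shows "\<phi> (\<lambda>v\<in>elems M. \<zero>\<^bsub>A\<^esub>) = 0"
proof -
  have "\<phi> (\<lambda>v\<in>elems M. 0 \<odot>\<^bsub>A\<^esub> (\<lambda>v\<in>elems M. \<zero>\<^bsub>A\<^esub>) v) = 0 * \<phi> (\<lambda>v\<in>elems M. \<zero>\<^bsub>A\<^esub>)"
    by (rule nakayama_objD(3)[OF \<phi> hom_alg_zero[OF M]])
  moreover have "(\<lambda>v\<in>elems M. 0 \<odot>\<^bsub>A\<^esub> (\<lambda>v\<in>elems M. \<zero>\<^bsub>A\<^esub>) v) = (\<lambda>v\<in>elems M. \<zero>\<^bsub>A\<^esub>)"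
    by (rule restrict_ext) (simp add: smult_zero)
  ultimately show ?thesis by simp
qed

text \<open>Homomorphisms in \<open>hom_alg\<close> take values in A, so the lemmas on function
  spaces over the field do not cover them. The induction carries membership along because \<phi> is
  additive only on \<open>hom_alg\<close>.\<close>

lemma nakayama_sum:
  assumes M: "right_module A M" and \<phi>: "\<phi> \<in> elems (nakayama_obj A M)"
    and X: "finite X" and f: "\<And>x. x \<in> X \<Longrightarrow> f x \<in> hom_alg A M"
  shows "(\<lambda>v\<in>elems M. finsum A (\<lambda>x. c x \<odot>\<^bsub>A\<^esub> f x v) X) \<in> hom_alg A M \<and>
    \<phi> (\<lambda>v\<in>elems M. finsum A (\<lambda>x. c x \<odot>\<^bsub>A\<^esub> f x v) X) = (\<Sum>x\<in>X. c x * \<phi> (f x))"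
  using X f
proof (induction X rule: finite_induct)
  case empty
  have "(\<lambda>v\<in>elems M. finsum A (\<lambda>x. c x \<odot>\<^bsub>A\<^esub> f x v) {}) = (\<lambda>v\<in>elems M. \<zero>\<^bsub>A\<^esub>)"
    unfolding finsum_empty ..
  then show ?case using hom_alg_zero[OF M] nakayama_at_zero[OF M \<phi>] by (simp only: sum.empty)
next
  case (insert y X)
  let ?g = "\<lambda>v\<in>elems M. finsum A (\<lambda>x. c x \<odot>\<^bsub>A\<^esub> f x v) X"
  let ?h = "\<lambda>v\<in>elems M. c y \<odot>\<^bsub>A\<^esub> f y v"
  have g: "?g \<in> hom_alg A M" "\<phi> ?g = (\<Sum>x\<in>X. c x * \<phi> (f x))"
    using insert.IH[OF insert.prems[OF insertI2]] by blast+
  have fy: "f y \<in> hom_alg A M" using insert.prems by simp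
  have h: "?h \<in> hom_alg A M" "\<phi> ?h = c y * \<phi> (f y)"
    by (rule hom_alg_smult[OF M fy], rule nakayama_objD(3)[OF \<phi> fy])
  have eq: "(\<lambda>v\<in>elems M. finsum A (\<lambda>x. c x \<odot>\<^bsub>A\<^esub> f x v) (insert y X)) = (\<lambda>v\<in>elems M. ?h v \<oplus>\<^bsub>A\<^esub> ?g v)"
  proof (rule restrict_ext)
    fix v assume v: "v \<in> elems M"
    have "c x \<odot>\<^bsub>A\<^esub> f x v \<in> carrier A" if "x \<in> insert y X" for x
      using hom_algD(1)[OF insert.prems[OF that] v] by simp
    then have "finsum A (\<lambda>x. c x \<odot>\<^bsub>A\<^esub> f x v) (insert y X) =
        c y \<odot>\<^bsub>A\<^esub> f y v \<oplus>\<^bsub>A\<^esub> finsum A (\<lambda>x. c x \<odot>\<^bsub>A\<^esub> f x v) X"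
      using insert.hyps by (intro finsum_insert) auto
    then show "finsum A (\<lambda>x. c x \<odot>\<^bsub>A\<^esub> f x v) (insert y X) = ?h v \<oplus>\<^bsub>A\<^esub> ?g v" using v by simp
  qed
  show ?case
    unfolding eq sum.insert[OF insert.hyps]
    by (rule conjI[OF hom_alg_add[OF M h(1) g(1)] nakayama_objD(2)[OF \<phi> h(1) g(1), unfolded g(2) h(2)]])
qed

section \<open>Dimension vectors of projectives and of their Nakayama images\<close>

lemma free_basisD:
  assumes "free_basis M K b p \<pi>"
  shows "finite K" "\<And>k. k \<in> K \<Longrightarrow> b k \<in> V" "\<And>k. k \<in> K \<Longrightarrow> p k \<in> wspace M (ve (b k))"
    "\<And>k. k \<in> K \<Longrightarrow> \<pi> k \<in> hom_alg A M"
    "\<And>k l. k \<in> K \<Longrightarrow> l \<in> K \<Longrightarrow> \<pi> k (p l) = (if k = l then ve (b k) else \<zero>\<^bsub>A\<^esub>)"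
    "\<And>k m. k \<in> K \<Longrightarrow> m \<in> elems M \<Longrightarrow> ve (b k) \<otimes>\<^bsub>A\<^esub> \<pi> k m = \<pi> k m"
    "\<And>m. m \<in> elems M \<Longrightarrow> m = (\<Sum>k\<in>K. ract M (p k) (\<pi> k m))"
  using assms unfolding free_basis_def by simp_all

text \<open>The Cartan matrix, with entries dim e_u A e_v. Its row at u is the dimension vector of
  P_u, its column at u that of I_u.\<close>

definition cartan :: "'v \<Rightarrow> 'v \<Rightarrow> nat" where
  "cartan u v = card {q \<in> Q. src q = u \<and> tgt q = v}"

text \<open>The products of a generator p k with the paths from b k to v form a basis of the part at
  v. They span because the p k generate, and they are independent because the coordinates \<pi> k
  separate them.\<close>

lemma wdim_free_basis:
  assumes M: "right_module A M" and fb: "free_basis M K b p \<pi>" and v: "v \<in> V"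
  shows "wdim M (ve v) = (\<Sum>k\<in>K. cartan (b k) v)"
proof -
  note D = free_basisD[OF fb]
  let ?X = "SIGMA k:K. {q \<in> Q. src q = b k \<and> tgt q = v}"
  let ?w = "\<lambda>x. ract M (p (fst x)) (\<beta> (snd x))"
  have pm: "\<And>k. k \<in> K \<Longrightarrow> p k \<in> elems M" by (rule subsetD[OF wspace_subset D(3)])
  have wm: "?w x \<in> wspace M (ve v)" if "x \<in> ?X" for x
    using wspace_ract(2)[OF M D(2) D(3), of "fst x" "snd x"] that by (cases x) simp
  have "fun_vs.dim (wspace M (ve v)) = card ?X"
  proof (rule dim_family)
    show "finite ?X" using D(1) finQ by (intro finite_SigmaI) auto
    show "fun_vs.subspace (wspace M (ve v))" by (rule wspace_subspace[OF M ve_closed[OF v]])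
    show "?w x \<in> wspace M (ve v)" if "x \<in> ?X" for x by (rule wm[OF that])
    show "\<exists>c. m = (\<Sum>x\<in>?X. fscale (c x) (?w x))" if m: "m \<in> wspace M (ve v)" for m
    proof -
      have me: "m \<in> elems M" "ract M m (ve v) = m" using m by (auto simp: wspace_def)
      \<comment> \<open>The idempotent at v keeps just the paths ending at v; a path not starting at
        b k already kills p k.\<close>
      have z: "ract M (ract M (p k) (\<beta> q)) (ve v) = (if src q = b k \<and> tgt q = v then ract M (p k) (\<beta> q) else 0)"
        if "k \<in> K" "q \<in> Q" for k q
      proof (cases "tgt q = v")
        case True
        then have "ract M (ract M (p k) (\<beta> q)) (ve v) = ract M (p k) (\<beta> q)"
          using ract_T[OF M pm[OF that(1)] T_id_right[OF that(2)]] by simp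
        then show ?thesis using True wspace_ract(1)[OF M D(2)[OF that(1)] D(3)[OF that(1)] that(2)] by auto
      next
        case False
        then show ?thesis using ract_no_T[OF M pm[OF that(1)] that(2) idp_Q[OF v]] T_idpD[OF v] by auto
      qed
      note lin = ract_linear[OF M ve_closed[OF v]]
      have el: "ract M (p k) (\<pi> k m) \<in> elems M" if "k \<in> K" for k
        by (rule right_moduleD(3)[OF M pm[OF that] hom_algD(1)[OF D(4)[OF that] me(1)]])
      have "m = ract M (\<Sum>k\<in>K. ract M (p k) (\<pi> k m)) (ve v)" using me D(7)[OF me(1)] by simp
      also have "\<dots> = (\<Sum>k\<in>K. ract M (ract M (p k) (\<pi> k m)) (ve v))"
        by (rule linear_on_sum[OF right_moduleD(1)[OF M] lin el])
      also have "\<dots> = (\<Sum>k\<in>K. \<Sum>q\<in>Q. fscale (coef q (\<pi> k m)) (ract M (ract M (p k) (\<beta> q)) (ve v)))"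
      proof (intro sum.cong refl)
        fix k assume k: "k \<in> K"
        have "ract M (p k) (\<pi> k m) = (\<Sum>q\<in>Q. fscale (coef q (\<pi> k m)) (ract M (p k) (\<beta> q)))"
          by (rule ract_expand[OF M pm[OF k] hom_algD(1)[OF D(4)[OF k] me(1)]])
        then show "ract M (ract M (p k) (\<pi> k m)) (ve v) =
            (\<Sum>q\<in>Q. fscale (coef q (\<pi> k m)) (ract M (ract M (p k) (\<beta> q)) (ve v)))"
          using linear_on_sum_scale[OF right_moduleD(1)[OF M] lin right_moduleD(3)[OF M pm[OF k] \<beta>_closed]]
          by simp
      qed
      also have "\<dots> = (\<Sum>k\<in>K. \<Sum>q\<in>{q \<in> Q. src q = b k \<and> tgt q = v}. fscale (coef q (\<pi> k m)) (ract M (p k) (\<beta> q)))"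
        using finQ z by (intro sum.cong[OF refl] sum.mono_neutral_cong_right) auto
      also have "\<dots> = (\<Sum>x\<in>?X. fscale (coef (snd x) (\<pi> (fst x) m)) (?w x))"
        using D(1) finQ by (subst sum.Sigma) (auto simp: case_prod_beta)
      finally show ?thesis by (intro exI[of _ "\<lambda>x. coef (snd x) (\<pi> (fst x) m)"])
    qed
    show "c x = 0" if s: "(\<Sum>x\<in>?X. fscale (c x) (?w x)) = 0" and x: "x \<in> ?X" for c x
    proof -
      \<comment> \<open>The linear form dual to the index x = (k, q): the coefficient of \<pi> k m
        at q.\<close>
      let ?F = "\<lambda>m. coef (snd x) (\<pi> (fst x) m)"
      have xk: "fst x \<in> K" "snd x \<in> Q" using x by auto
      have F: "?F (?w y) = (if y = x then 1 else 0)" if y: "y \<in> ?X" for y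
      proof -
        have yk: "fst y \<in> K" "snd y \<in> Q" "src (snd y) = b (fst y)" using y by auto
        have "\<pi> (fst x) (?w y) = (if fst x = fst y then ve (b (fst x)) else \<zero>\<^bsub>A\<^esub>) \<otimes>\<^bsub>A\<^esub> \<beta> (snd y)"
          using hom_algD(4)[OF D(4)[OF xk(1)] pm[OF yk(1)] \<beta>_closed[OF yk(2)]] D(5)[OF xk(1) yk(1)] by simp
        also have "\<dots> = (if fst x = fst y then \<beta> (snd y) else \<zero>\<^bsub>A\<^esub>)"
          using \<beta>_mult_T[OF T_id_left[OF yk(2)]] yk \<beta>_closed by simp
        finally show ?thesis using xk yk by (auto simp: coef_\<beta> coef_zero prod_eq_iff)
      qed
      have "?F 0 = 0" using hom_alg_at_zero[OF M D(4)[OF xk(1)]] coef_zero[OF xk(2)] by simp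
      then have "0 = ?F (\<Sum>y\<in>?X. fscale (c y) (?w y))" using s by simp
      also have "\<dots> = (\<Sum>y\<in>?X. c y * ?F (?w y))"
      proof (rule functional_sum[OF right_moduleD(1)[OF M]])
        note h = D(4)[OF xk(1)]
        show "?F (v + w) = ?F v + ?F w" if "v \<in> elems M" "w \<in> elems M" for v w
          using hom_algD(2)[OF h that] coef_add[OF xk(2) hom_algD(1)[OF h that(1)] hom_algD(1)[OF h that(2)]]
          by (simp only:)
        show "?F (fscale c v) = c * ?F v" if "v \<in> elems M" for c v
          using hom_algD(3)[OF h that] coef_smult[OF xk(2) hom_algD(1)[OF h that]] by (simp only:)
        show "?w y \<in> elems M" if "y \<in> ?X" for y by (rule subsetD[OF wspace_subset wm[OF that]])
      qed
      also have "\<dots> = (\<Sum>y\<in>?X. if y = x then c y else 0)" using F by (intro sum.cong) auto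
      also have "\<dots> = c x" using x D(1) finQ by (subst sum.delta) (auto intro!: finite_SigmaI)
      finally show ?thesis by simp
    qed
  qed
  also have "\<dots> = (\<Sum>k\<in>K. cartan (b k) v)"
    unfolding cartan_def using D(1) finQ by (intro card_SigmaI) auto
  finally show ?thesis unfolding wdim_def .
qed


text \<open>The families \<open>nak_hom\<close> and \<open>nak_dual\<close> are dual bases of \<open>Hom\<^sub>A(M, A)\<close> and of its dual space.\<close>

definition nak_hom ::
  "('k, 'a, 'i) rmodule \<Rightarrow> ('g \<Rightarrow> ('i \<Rightarrow> 'k) \<Rightarrow> 'a) \<Rightarrow> 'g \<times> 'q \<Rightarrow> ('i \<Rightarrow> 'k) \<Rightarrow> 'a" where
  "nak_hom M \<pi> x = (\<lambda>m\<in>elems M. \<beta> (snd x) \<otimes>\<^bsub>A\<^esub> \<pi> (fst x) m)"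

definition nak_dual ::
  "('k, 'a, 'i) rmodule \<Rightarrow> ('g \<Rightarrow> 'i \<Rightarrow> 'k) \<Rightarrow> 'g \<times> 'q \<Rightarrow> (('i \<Rightarrow> 'k) \<Rightarrow> 'a) \<Rightarrow> 'k" where
  "nak_dual M p x f = (if f \<in> hom_alg A M then coef (snd x) (f (p (fst x))) else 0)"

text \<open>Here the paths end at b k, in contrast to \<open>free_idx\<close>, because Hom(P_u, A)
  is A e_u.\<close>

definition nak_idx :: "'g set \<Rightarrow> ('g \<Rightarrow> 'v) \<Rightarrow> ('g \<times> 'q) set" where
  "nak_idx K b = (SIGMA k:K. {q \<in> Q. tgt q = b k})"

lemma nak_idx_iff: "x \<in> nak_idx K b \<longleftrightarrow> fst x \<in> K \<and> snd x \<in> Q \<and> tgt (snd x) = b (fst x)"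
  unfolding nak_idx_def by (cases x) auto

lemma nak_idx_finite: "finite K \<Longrightarrow> finite (nak_idx K b)"
  unfolding nak_idx_def using finQ by (intro finite_SigmaI) auto

context
  fixes M :: "('k, 'a, 'i) rmodule" and K :: "'g set" and b p \<pi>
  assumes M: "right_module A M" and fb: "free_basis M K b p \<pi>"
begin

lemma free_basis_mem: "k \<in> K \<Longrightarrow> p k \<in> elems M"
  by (rule subsetD[OF wspace_subset free_basisD(3)[OF fb]])

lemma nak_hom_hom: "x \<in> nak_idx K b \<Longrightarrow> nak_hom M \<pi> x \<in> hom_alg A M"
  unfolding nak_hom_def
  by (intro hom_alg_lmult[OF M] free_basisD(4)[OF fb] \<beta>_closed) (simp_all add: nak_idx_iff)

lemma nak_dual_mem:
  assumes x: "fst x \<in> K" "snd x \<in> Q"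
  shows "nak_dual M p x \<in> elems (nakayama_obj A M)"
proof (rule nakayama_objI)
  note pm = free_basis_mem[OF x(1)]
  show "nak_dual M p x f = 0" if "f \<notin> hom_alg A M" for f using that by (simp add: nak_dual_def)
  show "nak_dual M p x (\<lambda>v\<in>elems M. f v \<oplus>\<^bsub>A\<^esub> g v) = nak_dual M p x f + nak_dual M p x g"
    if f: "f \<in> hom_alg A M" and g: "g \<in> hom_alg A M" for f g
    using hom_alg_add[OF M f g] f g pm x(2)
    by (simp only: nak_dual_def if_True restrict_apply' coef_add hom_algD(1)[OF f] hom_algD(1)[OF g])
  show "nak_dual M p x (\<lambda>v\<in>elems M. c \<odot>\<^bsub>A\<^esub> f v) = c * nak_dual M p x f" if f: "f \<in> hom_alg A M" for c f
    using hom_alg_smult[OF M f] f pm x(2)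
    by (simp only: nak_dual_def if_True restrict_apply' coef_smult hom_algD(1)[OF f])
qed

lemma nak_dual_hom:
  assumes x: "x \<in> nak_idx K b" and y: "y \<in> nak_idx K b"
  shows "nak_dual M p x (nak_hom M \<pi> y) = of_bool (x = y)"
proof -
  have xk: "fst x \<in> K" "snd x \<in> Q" and yk: "fst y \<in> K" "snd y \<in> Q" "tgt (snd y) = b (fst y)"
    using x y by (auto simp: nak_idx_iff)
  have "nak_hom M \<pi> y (p (fst x)) = \<beta> (snd y) \<otimes>\<^bsub>A\<^esub> (if fst y = fst x then ve (b (fst y)) else \<zero>\<^bsub>A\<^esub>)"
    using free_basis_mem[OF xk(1)] free_basisD(5)[OF fb yk(1) xk(1)] by (simp add: nak_hom_def)
  also have "\<dots> = (if fst y = fst x then \<beta> (snd y) else \<zero>\<^bsub>A\<^esub>)"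
    using \<beta>_mult_T[OF T_id_right[OF yk(2)]] yk \<beta>_closed by auto
  finally show ?thesis
    using xk yk nak_hom_hom[OF y] by (auto simp: nak_dual_def coef_\<beta> coef_zero prod_eq_iff)
qed

text \<open>The generator p k is fixed by the idempotent of b k, hence so is its image under right
  multiplication.\<close>

lemma hom_alg_at_generator:
  assumes f: "f \<in> hom_alg A M" and k: "k \<in> K" and q: "q \<in> Q" and t: "tgt q \<noteq> b k"
  shows "coef q (f (p k)) = 0"
proof -
  note v = free_basisD(2)[OF fb k] and pm = free_basis_mem[OF k]
  have "ract M (p k) (ve (b k)) = p k" using free_basisD(3)[OF fb k] by (simp add: wspace_def)
  then have "f (p k) = f (p k) \<otimes>\<^bsub>A\<^esub> ve (b k)" using hom_algD(4)[OF f pm ve_closed[OF v]] by simp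
  then show ?thesis using coef_ve_right[OF q v hom_algD(1)[OF f pm]] t by simp
qed

text \<open>A homomorphism is determined by its values at the generators: f m is the sum of the f (p
  k) \<pi> k m. Expanding f (p k) in the paths ending at b k gives the combination of the
  \<open>nak_hom\<close>.\<close>

lemma hom_alg_expand:
  assumes f: "f \<in> hom_alg A M"
  shows "f = (\<lambda>m\<in>elems M. finsum A (\<lambda>x. nak_dual M p x f \<odot>\<^bsub>A\<^esub> nak_hom M \<pi> x m) (nak_idx K b))"
proof
  fix m
  note D = free_basisD[OF fb]
  let ?X = "nak_idx K b"
  show "f m = (\<lambda>m\<in>elems M. finsum A (\<lambda>x. nak_dual M p x f \<odot>\<^bsub>A\<^esub> nak_hom M \<pi> x m) ?X) m"
  proof (cases "m \<in> elems M")
    case False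
    have "f \<in> elems M \<rightarrow>\<^sub>E carrier A" 
      using f unfolding hom_alg_def by (elim CollectE IntE conjE)
    then show ?thesis using PiE_arb[OF _ False] by (simp only: restrict_apply False if_False)
  next
    case m: True
    have \<pi>c: "\<pi> k m \<in> carrier A" if "k \<in> K" for k by (rule hom_algD(1)[OF D(4)[OF that] m])
    have cl: "nak_dual M p x f \<odot>\<^bsub>A\<^esub> nak_hom M \<pi> x m \<in> carrier A" if "x \<in> ?X" for x
      using hom_algD(1)[OF nak_hom_hom[OF that] m] by simp
    have "f m = finsum A (\<lambda>x. nak_dual M p x f \<odot>\<^bsub>A\<^esub> nak_hom M \<pi> x m) ?X"
    proof (rule coef_ext)
      show "f m \<in> carrier A" by (rule hom_algD(1)[OF f m])
      show "finsum A (\<lambda>x. nak_dual M p x f \<odot>\<^bsub>A\<^esub> nak_hom M \<pi> x m) ?X \<in> carrier A"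
        using cl by (intro finsum_closed) auto
      fix r assume r: "r \<in> Q"
      let ?F = "\<lambda>m. coef r (f m)"
      have el: "ract M (p k) (\<beta> q) \<in> elems M" if "k \<in> K" "q \<in> Q" for k q
        by (rule right_moduleD(3)[OF M free_basis_mem[OF that(1)] \<beta>_closed[OF that(2)]])
      note pm = free_basis_mem
      have add: "?F (v + w) = ?F v + ?F w" if "v \<in> elems M" "w \<in> elems M" for v w
        using hom_algD(2)[OF f that] coef_add[OF r hom_algD(1)[OF f that(1)] hom_algD(1)[OF f that(2)]]
        by (simp only:)
      have scale: "?F (fscale c v) = c * ?F v" if "v \<in> elems M" for c v
        using hom_algD(3)[OF f that] coef_smult[OF r hom_algD(1)[OF f that]] by (simp only:)
      \<comment> \<open>The scalars 1 only bring the sum into the form of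
        \<open>functional_sum\<close>.\<close>
      have "?F m = ?F (\<Sum>k\<in>K. fscale 1 (ract M (p k) (\<pi> k m)))"
        unfolding fun_vs.scale_one D(7)[OF m, symmetric] ..
      also have "\<dots> = (\<Sum>k\<in>K. 1 * ?F (ract M (p k) (\<pi> k m)))"
        by (rule functional_sum[OF right_moduleD(1)[OF M] add scale])
          (assumption | rule right_moduleD(3)[OF M pm \<pi>c])+
      also have "\<dots> = (\<Sum>k\<in>K. coef r (f (p k) \<otimes>\<^bsub>A\<^esub> \<pi> k m))"
        using hom_algD(4)[OF f pm \<pi>c] by (intro sum.cong) auto
      also have "\<dots> = (\<Sum>k\<in>K. \<Sum>q\<in>{q \<in> Q. tgt q = b k}. coef q (f (p k)) * coef r (\<beta> q \<otimes>\<^bsub>A\<^esub> \<pi> k m))"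
      proof (intro sum.cong refl)
        fix k assume k: "k \<in> K"
        have "f (p k) \<otimes>\<^bsub>A\<^esub> \<pi> k m \<in> carrier A" using hom_algD(1)[OF f pm[OF k]] \<pi>c[OF k] by simp
        have "coef r (f (p k) \<otimes>\<^bsub>A\<^esub> \<pi> k m) =
            (\<Sum>s\<in>Q. \<Sum>u\<in>Q. of_bool (T s u r) * (coef s (f (p k)) * coef u (\<pi> k m)))"
          by (rule coef_mult[OF r hom_algD(1)[OF f pm[OF k]] \<pi>c[OF k]])
        also have "\<dots> = (\<Sum>s\<in>Q. coef s (f (p k)) * (\<Sum>u\<in>Q. of_bool (T s u r) * coef u (\<pi> k m)))"
          by (intro sum.cong) (auto simp: sum_distrib_left algebra_simps intro!: sum.cong)
        also have "\<dots> = (\<Sum>s\<in>Q. coef s (f (p k)) * coef r (\<beta> s \<otimes>\<^bsub>A\<^esub> \<pi> k m))"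
        proof (intro sum.cong refl)
          fix s assume s: "s \<in> Q"
          have "coef r (\<beta> s \<otimes>\<^bsub>A\<^esub> \<pi> k m) =
              (\<Sum>s'\<in>Q. \<Sum>u\<in>Q. of_bool (T s' u r) * (coef s' (\<beta> s) * coef u (\<pi> k m)))"
            by (rule coef_mult[OF r \<beta>_closed[OF s] \<pi>c[OF k]])
          also have "\<dots> = (\<Sum>s'\<in>Q. if s' = s then (\<Sum>u\<in>Q. of_bool (T s u r) * coef u (\<pi> k m)) else 0)"
            using s by (intro sum.cong) (auto simp: coef_\<beta>)
          finally show "coef s (f (p k)) * (\<Sum>u\<in>Q. of_bool (T s u r) * coef u (\<pi> k m)) =
              coef s (f (p k)) * coef r (\<beta> s \<otimes>\<^bsub>A\<^esub> \<pi> k m)" using finQ s by simp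
        qed
        also have "\<dots> = (\<Sum>q\<in>{q \<in> Q. tgt q = b k}. coef q (f (p k)) * coef r (\<beta> q \<otimes>\<^bsub>A\<^esub> \<pi> k m))"
          using finQ hom_alg_at_generator[OF f k] by (intro sum.mono_neutral_right) auto
        finally show "coef r (f (p k) \<otimes>\<^bsub>A\<^esub> \<pi> k m) =
            (\<Sum>q\<in>{q \<in> Q. tgt q = b k}. coef q (f (p k)) * coef r (\<beta> q \<otimes>\<^bsub>A\<^esub> \<pi> k m))" .
      qed
      also have "\<dots> = (\<Sum>x\<in>?X. coef (snd x) (f (p (fst x))) * coef r (\<beta> (snd x) \<otimes>\<^bsub>A\<^esub> \<pi> (fst x) m))"
        unfolding nak_idx_def using D(1) finQ by (subst sum.Sigma) (auto simp: case_prod_beta)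
      also have "\<dots> = (\<Sum>x\<in>?X. coef r (nak_dual M p x f \<odot>\<^bsub>A\<^esub> nak_hom M \<pi> x m))"
      proof (intro sum.cong refl)
        fix x assume x: "x \<in> ?X"
        have "nak_hom M \<pi> x m = \<beta> (snd x) \<otimes>\<^bsub>A\<^esub> \<pi> (fst x) m" using m by (simp add: nak_hom_def)
        then show "coef (snd x) (f (p (fst x))) * coef r (\<beta> (snd x) \<otimes>\<^bsub>A\<^esub> \<pi> (fst x) m) =
            coef r (nak_dual M p x f \<odot>\<^bsub>A\<^esub> nak_hom M \<pi> x m)"
          using coef_smult[OF r hom_algD(1)[OF nak_hom_hom[OF x] m]] f by (simp add: nak_dual_def)
      qed
      also have "\<dots> = coef r (finsum A (\<lambda>x. nak_dual M p x f \<odot>\<^bsub>A\<^esub> nak_hom M \<pi> x m) ?X)"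
        by (rule coef_finsum[OF r nak_idx_finite[OF D(1)] cl, symmetric])
      finally show "coef r (f m) = coef r (finsum A (\<lambda>x. nak_dual M p x f \<odot>\<^bsub>A\<^esub> nak_hom M \<pi> x m) ?X)" .
    qed
    then show ?thesis using m by simp
  qed
qed

lemma nakayama_expand:
  assumes \<phi>: "\<phi> \<in> elems (nakayama_obj A M)"
  shows "\<phi> = (\<Sum>x\<in>nak_idx K b. fscale (\<phi> (nak_hom M \<pi> x)) (nak_dual M p x))"
proof
  fix f
  have fX: "finite (nak_idx K b)" by (rule nak_idx_finite[OF free_basisD(1)[OF fb]])
  show "\<phi> f = (\<Sum>x\<in>nak_idx K b. fscale (\<phi> (nak_hom M \<pi> x)) (nak_dual M p x)) f"
  proof (cases "f \<in> hom_alg A M")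
    case False
    then show ?thesis using nakayama_objD(1)[OF \<phi> False] by (simp add: sum_fun_apply fscale_apply nak_dual_def)
  next
    case True
    have "\<phi> f = \<phi> (\<lambda>m\<in>elems M. finsum A (\<lambda>x. nak_dual M p x f \<odot>\<^bsub>A\<^esub> nak_hom M \<pi> x m) (nak_idx K b))"
      using hom_alg_expand[OF True] by (rule arg_cong)
    also have "\<dots> = (\<Sum>x\<in>nak_idx K b. nak_dual M p x f * \<phi> (nak_hom M \<pi> x))"
      by (rule nakayama_sum[OF M \<phi> fX nak_hom_hom, THEN conjunct2])
    finally show ?thesis unfolding sum_fun_apply fscale_apply by (simp add: mult.commute)
  qed
qed

text \<open>Evaluation at \<open>nak_hom M \<pi> y\<close> isolates the coefficient of y. Subsets X
  are allowed because the part at a vertex v is spanned by the vectors whose path starts at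
  v.\<close>

lemma nak_dual_indep:
  assumes X: "X \<subseteq> nak_idx K b" and s: "(\<Sum>x\<in>X. fscale (c x) (nak_dual M p x)) = 0" and y: "y \<in> X"
  shows "c y = 0"
proof -
  have fX: "finite X" by (rule finite_subset[OF X nak_idx_finite[OF free_basisD(1)[OF fb]]])
  have "0 = (\<Sum>x\<in>X. fscale (c x) (nak_dual M p x)) (nak_hom M \<pi> y)" unfolding s by simp
  also have "\<dots> = (\<Sum>x\<in>X. if x = y then c x else 0)"
    unfolding sum_fun_apply fscale_apply
    using nak_dual_hom[OF subsetD[OF X] subsetD[OF X y]] by (intro sum.cong) auto
  finally show ?thesis using fX y by simp
qed

lemma nakayama_fd: "fd_subspace (elems (nakayama_obj A M))"
proof (rule dim_family(2))
  show "finite (nak_idx K b)" by (rule nak_idx_finite[OF free_basisD(1)[OF fb]])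
  show "fun_vs.subspace (elems (nakayama_obj A M))" by (rule nakayama_obj_subspace)
  show "nak_dual M p x \<in> elems (nakayama_obj A M)" if "x \<in> nak_idx K b" for x
    using that by (intro nak_dual_mem) (simp_all add: nak_idx_iff)
  show "\<exists>c. \<phi> = (\<Sum>x\<in>nak_idx K b. fscale (c x) (nak_dual M p x))" if "\<phi> \<in> elems (nakayama_obj A M)" for \<phi>
    by (intro exI[of _ "\<lambda>x. \<phi> (nak_hom M \<pi> x)"] nakayama_expand[OF that])
  show "c x = 0" if "(\<Sum>x\<in>nak_idx K b. fscale (c x) (nak_dual M p x)) = 0" "x \<in> nak_idx K b" for c x
    by (rule nak_dual_indep[OF order_refl that])
qed

text \<open>The finite dimension comes from the free basis of M; the module laws come from those of
  Hom(M, A) as a left module.\<close>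

lemma nakayama_right_module: "right_module A (nakayama_obj A M)"
  unfolding right_module_def
proof (intro conjI ballI allI)
  let ?N = "nakayama_obj A M"
  note R = nakayama_obj_ract[of A M]
  have lm: "f \<in> hom_alg A M \<Longrightarrow> a \<in> carrier A \<Longrightarrow> (\<lambda>v\<in>elems M. a \<otimes>\<^bsub>A\<^esub> f v) \<in> hom_alg A M" for f a
    by (rule hom_alg_lmult[OF M])
  show "fun_vs.subspace (elems ?N)" by (rule nakayama_obj_subspace)
  show "\<exists>B. finite B \<and> elems ?N = fun_vs.span B" using nakayama_fd unfolding fd_subspace_def by blast
  fix \<phi> assume \<phi>: "\<phi> \<in> elems ?N"
  show "ract ?N \<phi> \<one>\<^bsub>A\<^esub> = \<phi>"
  proof
    fix f show "ract ?N \<phi> \<one>\<^bsub>A\<^esub> f = \<phi> f"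
    proof (cases "f \<in> hom_alg A M")
      case True
      have "(\<lambda>v\<in>elems M. \<one>\<^bsub>A\<^esub> \<otimes>\<^bsub>A\<^esub> f v) = f"
        by (rule hom_alg_ext[OF lm[OF True one_closed] True]) (simp add: hom_algD(1)[OF True])
      then show ?thesis using True by (simp only: R if_True)
    qed (simp add: R nakayama_objD(1)[OF \<phi>])
  qed
  fix a assume a: "a \<in> carrier A"
  show "ract ?N \<phi> a \<in> elems ?N"
  proof (rule nakayama_objI)
    show "ract ?N \<phi> a f = 0" if "f \<notin> hom_alg A M" for f using that by (simp add: R)
    show "ract ?N \<phi> a (\<lambda>v\<in>elems M. f v \<oplus>\<^bsub>A\<^esub> g v) = ract ?N \<phi> a f + ract ?N \<phi> a g"
      if f: "f \<in> hom_alg A M" and g: "g \<in> hom_alg A M" for f g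
    proof -
      have "(\<lambda>v\<in>elems M. a \<otimes>\<^bsub>A\<^esub> (\<lambda>v\<in>elems M. f v \<oplus>\<^bsub>A\<^esub> g v) v) =
          (\<lambda>v\<in>elems M. (\<lambda>v\<in>elems M. a \<otimes>\<^bsub>A\<^esub> f v) v \<oplus>\<^bsub>A\<^esub> (\<lambda>v\<in>elems M. a \<otimes>\<^bsub>A\<^esub> g v) v)"
        by (rule restrict_ext) (simp add: r_distr a hom_algD(1)[OF f] hom_algD(1)[OF g])
      then show ?thesis
        using nakayama_objD(2)[OF \<phi> lm[OF f a] lm[OF g a]] f g hom_alg_add[OF M f g]
        by (simp only: R if_True)
    qed
    show "ract ?N \<phi> a (\<lambda>v\<in>elems M. c \<odot>\<^bsub>A\<^esub> f v) = c * ract ?N \<phi> a f" if f: "f \<in> hom_alg A M" for c f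
    proof -
      have "(\<lambda>v\<in>elems M. a \<otimes>\<^bsub>A\<^esub> (\<lambda>v\<in>elems M. c \<odot>\<^bsub>A\<^esub> f v) v) =
          (\<lambda>v\<in>elems M. c \<odot>\<^bsub>A\<^esub> (\<lambda>v\<in>elems M. a \<otimes>\<^bsub>A\<^esub> f v) v)"
        by (rule restrict_ext) (simp add: mult_smult_right a hom_algD(1)[OF f])
      then show ?thesis
        using nakayama_objD(3)[OF \<phi> lm[OF f a]] f hom_alg_smult[OF M f] by (simp only: R if_True)
    qed
  qed
  fix c
  show "ract ?N (fscale c \<phi>) a = fscale c (ract ?N \<phi> a)"
    by (rule ext) (simp add: R fscale_apply)
  show "ract ?N \<phi> (c \<odot>\<^bsub>A\<^esub> a) = fscale c (ract ?N \<phi> a)"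
  proof
    fix f show "ract ?N \<phi> (c \<odot>\<^bsub>A\<^esub> a) f = fscale c (ract ?N \<phi> a) f"
    proof (cases "f \<in> hom_alg A M")
      case True
      have "(\<lambda>v\<in>elems M. (c \<odot>\<^bsub>A\<^esub> a) \<otimes>\<^bsub>A\<^esub> f v) = (\<lambda>v\<in>elems M. c \<odot>\<^bsub>A\<^esub> (\<lambda>v\<in>elems M. a \<otimes>\<^bsub>A\<^esub> f v) v)"
        by (rule restrict_ext) (simp add: mult_smult_left a hom_algD(1)[OF True])
      then show ?thesis using nakayama_objD(3)[OF \<phi> lm[OF True a]] True by (simp only: R if_True fscale_apply)
    qed (simp add: R fscale_apply)
  qed
next
  let ?N = "nakayama_obj A M"
  fix \<phi> \<psi> a assume "\<phi> \<in> elems ?N" "\<psi> \<in> elems ?N" "a \<in> carrier A"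
  show "ract ?N (\<phi> + \<psi>) a = ract ?N \<phi> a + ract ?N \<psi> a"
    by (rule ext) (simp add: nakayama_obj_ract)
next
  let ?N = "nakayama_obj A M"
  note R = nakayama_obj_ract[of A M] and lm = hom_alg_lmult[OF M]
  fix \<phi> a b assume \<phi>: "\<phi> \<in> elems ?N" and a: "a \<in> carrier A" and b: "b \<in> carrier A"
  show "ract ?N \<phi> (a \<oplus>\<^bsub>A\<^esub> b) = ract ?N \<phi> a + ract ?N \<phi> b"
  proof
    fix f show "ract ?N \<phi> (a \<oplus>\<^bsub>A\<^esub> b) f = (ract ?N \<phi> a + ract ?N \<phi> b) f"
    proof (cases "f \<in> hom_alg A M")
      case True
      have "(\<lambda>v\<in>elems M. (a \<oplus>\<^bsub>A\<^esub> b) \<otimes>\<^bsub>A\<^esub> f v) =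
          (\<lambda>v\<in>elems M. (\<lambda>v\<in>elems M. a \<otimes>\<^bsub>A\<^esub> f v) v \<oplus>\<^bsub>A\<^esub> (\<lambda>v\<in>elems M. b \<otimes>\<^bsub>A\<^esub> f v) v)"
        by (rule restrict_ext) (simp add: l_distr a b hom_algD(1)[OF True])
      then show ?thesis
        using nakayama_objD(2)[OF \<phi> lm[OF True a] lm[OF True b]] True by (simp only: R if_True plus_fun_apply)
    qed (simp add: R)
  qed
  show "ract ?N \<phi> (a \<otimes>\<^bsub>A\<^esub> b) = ract ?N (ract ?N \<phi> a) b"
  proof
    fix f show "ract ?N \<phi> (a \<otimes>\<^bsub>A\<^esub> b) f = ract ?N (ract ?N \<phi> a) b f"
    proof (cases "f \<in> hom_alg A M")
      case True
      have "(\<lambda>v\<in>elems M. (a \<otimes>\<^bsub>A\<^esub> b) \<otimes>\<^bsub>A\<^esub> f v) = (\<lambda>v\<in>elems M. a \<otimes>\<^bsub>A\<^esub> (\<lambda>v\<in>elems M. b \<otimes>\<^bsub>A\<^esub> f v) v)"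
        by (rule restrict_ext) (simp add: m_assoc a b hom_algD(1)[OF True])
      then show ?thesis using True lm[OF True b] by (simp only: R if_True)
    qed (simp add: R)
  qed
qed

lemma nak_dual_ract:
  assumes x: "fst x \<in> K" "snd x \<in> Q" and v: "v \<in> V"
  shows "ract (nakayama_obj A M) (nak_dual M p x) (ve v) = fscale (of_bool (src (snd x) = v)) (nak_dual M p x)"
proof
  fix f
  show "ract (nakayama_obj A M) (nak_dual M p x) (ve v) f = fscale (of_bool (src (snd x) = v)) (nak_dual M p x) f"
  proof (cases "f \<in> hom_alg A M")
    case True
    note pm = free_basis_mem[OF x(1)]
    have "ract (nakayama_obj A M) (nak_dual M p x) (ve v) f = coef (snd x) (ve v \<otimes>\<^bsub>A\<^esub> f (p (fst x)))"
      using True hom_alg_lmult[OF M True ve_closed[OF v]] pm by (simp only: nakayama_obj_ract nak_dual_def if_True restrict_apply')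
    also have "\<dots> = of_bool (src (snd x) = v) * coef (snd x) (f (p (fst x)))"
      by (rule coef_ve_left[OF x(2) v hom_algD(1)[OF True pm]])
    finally show ?thesis using True by (simp add: nak_dual_def fscale_apply)
  qed (simp add: nakayama_obj_ract nak_dual_def fscale_apply)
qed

text \<open>The dual basis vector of (k, q) sits at the source of q, and q ends at b k. Thus the
  arguments of \<open>cartan\<close> trade places in comparison with \<open>wdim_free_basis\<close>:
  on dimension vectors, P_u is sent to I_u.\<close>

lemma wdim_nakayama:
  assumes v: "v \<in> V"
  shows "wdim (nakayama_obj A M) (ve v) = (\<Sum>k\<in>K. cartan v (b k))"
proof -
  let ?N = "nakayama_obj A M"
  let ?X = "SIGMA k:K. {q \<in> Q. src q = v \<and> tgt q = b k}"
  have XI: "?X \<subseteq> nak_idx K b" by (auto simp: nak_idx_iff)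
  have fK: "finite K" by (rule free_basisD(1)[OF fb])
  have fI: "finite (nak_idx K b)" by (rule nak_idx_finite[OF fK])
  have "fun_vs.dim (wspace ?N (ve v)) = card ?X"
  proof (rule dim_family)
    show "finite ?X" by (rule finite_subset[OF XI fI])
    show "fun_vs.subspace (wspace ?N (ve v))" by (rule wspace_subspace[OF nakayama_right_module ve_closed[OF v]])
    show "nak_dual M p x \<in> wspace ?N (ve v)" if "x \<in> ?X" for x
      using that nak_dual_mem[of x] nak_dual_ract[of x v] v by (auto simp: wspace_def)
    show "\<exists>c. \<phi> = (\<Sum>x\<in>?X. fscale (c x) (nak_dual M p x))" if \<phi>: "\<phi> \<in> wspace ?N (ve v)" for \<phi>
    proof -
      have \<phi>e: "\<phi> \<in> elems ?N" "ract ?N \<phi> (ve v) = \<phi>" using \<phi> by (auto simp: wspace_def)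
      have "\<phi> = ract ?N (\<Sum>x\<in>nak_idx K b. fscale (\<phi> (nak_hom M \<pi> x)) (nak_dual M p x)) (ve v)"
        using \<phi>e(2) nakayama_expand[OF \<phi>e(1)] by simp
      also have "\<dots> = (\<Sum>x\<in>nak_idx K b. fscale (\<phi> (nak_hom M \<pi> x)) (ract ?N (nak_dual M p x) (ve v)))"
        by (rule linear_on_sum_scale[OF nakayama_obj_subspace ract_linear[OF nakayama_right_module ve_closed[OF v]]])
          (rule nak_dual_mem, simp_all add: nak_idx_iff)
      also have "\<dots> = (\<Sum>x\<in>?X. fscale (\<phi> (nak_hom M \<pi> x)) (nak_dual M p x))"
        using v by (intro sum.mono_neutral_cong_right[OF fI XI])
          (auto simp: nak_idx_iff nak_dual_ract)
      finally show ?thesis by (intro exI[of _ "\<lambda>x. \<phi> (nak_hom M \<pi> x)"])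
    qed
    show "c x = 0" if "(\<Sum>x\<in>?X. fscale (c x) (nak_dual M p x)) = 0" "x \<in> ?X" for c x
      by (rule nak_dual_indep[OF XI that])
  qed
  also have "\<dots> = (\<Sum>k\<in>K. cartan v (b k))"
    unfolding cartan_def using fK finQ by (intro card_SigmaI) auto
  finally show ?thesis unfolding wdim_def .
qed

end

section \<open>Functoriality, and the Nakayama image of a complex of projectives\<close>

lemma nakayama_map_hom:
  assumes M: "right_module A M" and N: "right_module A N" and h: "h \<in> module_hom A M N"
  shows "nakayama_map A M N h \<in> module_hom A (nakayama_obj A M) (nakayama_obj A N)"
proof (rule module_homI)
  let ?h = "nakayama_map A M N h"
  note hN = module_homD(2)[OF h] and hc = hom_alg_comp[OF M h]
  show "linear_on (elems (nakayama_obj A M)) ?h"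
    unfolding linear_on_def nakayama_map_def by (auto simp: fun_eq_iff fscale_apply)
  fix \<phi> assume \<phi>: "\<phi> \<in> elems (nakayama_obj A M)"
  show "?h \<phi> \<in> elems (nakayama_obj A N)"
  proof (rule nakayama_objI)
    show "?h \<phi> g = 0" if "g \<notin> hom_alg A N" for g using that by (simp add: nakayama_map_def)
    show "?h \<phi> (\<lambda>v\<in>elems N. f v \<oplus>\<^bsub>A\<^esub> g v) = ?h \<phi> f + ?h \<phi> g"
      if f: "f \<in> hom_alg A N" and g: "g \<in> hom_alg A N" for f g
    proof -
      have "(\<lambda>v\<in>elems M. (\<lambda>v\<in>elems N. f v \<oplus>\<^bsub>A\<^esub> g v) (h v)) =
          (\<lambda>v\<in>elems M. (\<lambda>v\<in>elems M. f (h v)) v \<oplus>\<^bsub>A\<^esub> (\<lambda>v\<in>elems M. g (h v)) v)"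
        by (rule restrict_ext) (simp add: hN)
      then show ?thesis using nakayama_objD(2)[OF \<phi> hc[OF f] hc[OF g]] f g hom_alg_add[OF N f g]
        by (simp only: nakayama_map_def if_True)
    qed
    show "?h \<phi> (\<lambda>v\<in>elems N. c \<odot>\<^bsub>A\<^esub> f v) = c * ?h \<phi> f" if f: "f \<in> hom_alg A N" for c f
    proof -
      have "(\<lambda>v\<in>elems M. (\<lambda>v\<in>elems N. c \<odot>\<^bsub>A\<^esub> f v) (h v)) =
          (\<lambda>v\<in>elems M. c \<odot>\<^bsub>A\<^esub> (\<lambda>v\<in>elems M. f (h v)) v)"
        by (rule restrict_ext) (simp add: hN)
      then show ?thesis using nakayama_objD(3)[OF \<phi> hc[OF f]] f hom_alg_smult[OF N f]
        by (simp only: nakayama_map_def if_True)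
    qed
  qed
  fix a assume a: "a \<in> carrier A"
  show "?h (ract (nakayama_obj A M) \<phi> a) = ract (nakayama_obj A N) (?h \<phi>) a"
  proof
    fix g show "?h (ract (nakayama_obj A M) \<phi> a) g = ract (nakayama_obj A N) (?h \<phi>) a g"
    proof (cases "g \<in> hom_alg A N")
      case True
      have "(\<lambda>v\<in>elems M. (\<lambda>v\<in>elems N. a \<otimes>\<^bsub>A\<^esub> g v) (h v)) = (\<lambda>v\<in>elems M. a \<otimes>\<^bsub>A\<^esub> (\<lambda>v\<in>elems M. g (h v)) v)"
        by (rule restrict_ext) (simp add: hN)
      then show ?thesis using True hc[OF True] hom_alg_lmult[OF N True a]
        by (simp only: nakayama_map_def nakayama_obj_ract if_True)
    qed (simp add: nakayama_map_def nakayama_obj_ract)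
  qed
qed

lemma nakayama_map_comp_zero:
  assumes M: "right_module A M" and N: "right_module A N" and L: "right_module A L"
    and h: "h \<in> module_hom A M N" and h': "h' \<in> module_hom A N L"
    and z: "\<And>v. v \<in> elems M \<Longrightarrow> h' (h v) = 0" and \<phi>: "\<phi> \<in> elems (nakayama_obj A M)"
  shows "nakayama_map A N L h' (nakayama_map A M N h \<phi>) = 0"
proof
  fix g show "nakayama_map A N L h' (nakayama_map A M N h \<phi>) g = 0 g"
  proof (cases "g \<in> hom_alg A L")
    case True
    have "(\<lambda>v\<in>elems M. (\<lambda>w\<in>elems N. g (h' w)) (h v)) = (\<lambda>v\<in>elems M. \<zero>\<^bsub>A\<^esub>)"
      by (rule restrict_ext) (simp add: module_homD(2)[OF h] z hom_alg_at_zero[OF L True])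
    then show ?thesis using True hom_alg_comp[OF N h' True] nakayama_at_zero[OF M \<phi>]
      by (simp only: nakayama_map_def if_True zero_fun_apply)
  qed (simp add: nakayama_map_def)
qed

lemma nakayama_zero_module:
  assumes M: "right_module A M" and z: "elems M = {0}"
  shows "elems (nakayama_obj A M) = {0}"
proof
  show "{0} \<subseteq> elems (nakayama_obj A M)" using fun_vs.subspace_0[OF nakayama_obj_subspace] by simp
  show "elems (nakayama_obj A M) \<subseteq> {0}"
  proof
    fix \<phi> assume \<phi>: "\<phi> \<in> elems (nakayama_obj A M)"
    have "\<phi> f = 0" for f
    proof (cases "f \<in> hom_alg A M")
      case True
      have "f = (\<lambda>v\<in>elems M. \<zero>\<^bsub>A\<^esub>)"
        by (rule hom_alg_ext[OF True hom_alg_zero[OF M]]) (use z hom_alg_at_zero[OF M True] in auto)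
      then show ?thesis using nakayama_at_zero[OF M \<phi>] by (simp only:)
    qed (rule nakayama_objD(1)[OF \<phi>])
    then show "\<phi> \<in> {0}" by (auto simp: fun_eq_iff)
  qed
qed

lemma projective_right_module: "projective_module A P \<Longrightarrow> right_module A P"
  unfolding projective_module_def by blast

text \<open>Projectivity of the terms supplies the free bases that make their Nakayama images
  finite-dimensional.\<close>

lemma nakayama_complex_bounded:
  fixes X :: "('k, 'a, nat) cplx"
  assumes X: "bounded_complex A X" and proj: "\<And>m. projective_module A (obj X m)"
  shows "bounded_complex A (nakayama_complex A X)"
  unfolding bounded_complex_def
proof (intro conjI allI ballI)
  note XD = bounded_complexD[OF X]
  show "right_module A (obj (nakayama_complex A X) m)" for m
    using projective_free_basis[OF proj[of m]] nakayama_right_module[OF XD(1)]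
    unfolding nakayama_complex_def by auto
  show "diff (nakayama_complex A X) m \<in> module_hom A (obj (nakayama_complex A X) m) (obj (nakayama_complex A X) (m + 1))" for m
    unfolding nakayama_complex_def cplx.simps by (rule nakayama_map_hom[OF XD(1) XD(1) XD(2)])
  show "diff (nakayama_complex A X) (m + 1) (diff (nakayama_complex A X) m \<phi>) = 0"
    if "\<phi> \<in> elems (obj (nakayama_complex A X) m)" for m \<phi>
    using that unfolding nakayama_complex_def cplx.simps
    by (intro nakayama_map_comp_zero[OF XD(1) XD(1) XD(1) XD(2) XD(2) XD(3)])
  obtain n where n: "\<And>k m. k \<ge> n \<Longrightarrow> m < - k \<or> k < m \<Longrightarrow> elems (obj X m) = {0}" "n \<ge> 0"
    using bounded_complex_bound[OF X] by blast
  show "\<exists>a b. \<forall>m. m < a \<or> b < m \<longrightarrow> elems (obj (nakayama_complex A X) m) = {0}"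
    by (rule exI[of _ "- n"], rule exI[of _ n])
      (use n(1)[of n] nakayama_zero_module[OF XD(1)] in \<open>auto simp: nakayama_complex_def\<close>)
qed

text \<open>The coefficient c u is the alternating multiplicity of P_u in X. The point is that the
  same c serves on both sides, with the rows of the Cartan matrix replaced by its columns.\<close>

theorem euler_nakayama:
  fixes X :: "('k, 'a, nat) cplx"
  assumes X: "bounded_complex A X" and proj: "\<And>m. projective_module A (obj X m)"
  shows "\<exists>c :: 'v \<Rightarrow> int. \<forall>v\<in>V. euler X (ve v) = (\<Sum>u\<in>V. c u * int (cartan u v)) \<and>
    euler (nakayama_complex A X) (ve v) = (\<Sum>u\<in>V. c u * int (cartan v u))"
proof -
  note XD = bounded_complexD[OF X]
  have "\<exists>c :: 'v \<Rightarrow> int. \<forall>v\<in>V. int (wdim (obj X m) (ve v)) = (\<Sum>u\<in>V. c u * int (cartan u v)) \<and>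
      int (wdim (nakayama_obj A (obj X m)) (ve v)) = (\<Sum>u\<in>V. c u * int (cartan v u))" for m
  proof -
    obtain K :: "((nat \<Rightarrow> 'k) \<times> 'v) set" and p \<pi> where fb: "free_basis (obj X m) K snd p \<pi>"
      using projective_free_basis[OF proj] by blast
    \<comment> \<open>The generators are sorted by their vertices; the number at u is the
      multiplicity of P_u.\<close>
    have group: "(\<Sum>k\<in>K. int (g (snd k))) = (\<Sum>u\<in>V. int (card {k \<in> K. snd k = u}) * int (g u))" for g :: "'v \<Rightarrow> nat"
    proof -
      have "(\<Sum>u\<in>V. \<Sum>k\<in>{k \<in> K. snd k = u}. int (g (snd k))) = (\<Sum>k\<in>K. int (g (snd k)))"
        by (rule sum.group[OF free_basisD(1)[OF fb] finV]) (use free_basisD(2)[OF fb] in auto)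
      moreover have "(\<Sum>k\<in>{k \<in> K. snd k = u}. int (g (snd k))) = int (card {k \<in> K. snd k = u}) * int (g u)" for u
        by simp
      ultimately show ?thesis by simp
    qed
    show ?thesis
    proof (intro exI[of _ "\<lambda>u. int (card {k \<in> K. snd k = u})"] ballI conjI)
      fix v assume v: "v \<in> V"
      show "int (wdim (obj X m) (ve v)) = (\<Sum>u\<in>V. int (card {k \<in> K. snd k = u}) * int (cartan u v))"
        unfolding wdim_free_basis[OF XD(1) fb v] of_nat_sum by (rule group)
      show "int (wdim (nakayama_obj A (obj X m)) (ve v)) =
          (\<Sum>u\<in>V. int (card {k \<in> K. snd k = u}) * int (cartan v u))"
        unfolding wdim_nakayama[OF XD(1) fb v] of_nat_sum by (rule group)
    qed
  qed
  then have "\<exists>c :: int \<Rightarrow> 'v \<Rightarrow> int. \<forall>m. \<forall>v\<in>V.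
      int (wdim (obj X m) (ve v)) = (\<Sum>u\<in>V. c m u * int (cartan u v)) \<and>
      int (wdim (nakayama_obj A (obj X m)) (ve v)) = (\<Sum>u\<in>V. c m u * int (cartan v u))"
    by (intro choice allI)
  then obtain c :: "int \<Rightarrow> 'v \<Rightarrow> int" where cc: "\<forall>m. \<forall>v\<in>V.
      int (wdim (obj X m) (ve v)) = (\<Sum>u\<in>V. c m u * int (cartan u v)) \<and>
      int (wdim (nakayama_obj A (obj X m)) (ve v)) = (\<Sum>u\<in>V. c m u * int (cartan v u))" by (rule exE)
  have c: "int (wdim (obj X m) (ve v)) = (\<Sum>u\<in>V. c m u * int (cartan u v))"
    and c': "int (wdim (nakayama_obj A (obj X m)) (ve v)) = (\<Sum>u\<in>V. c m u * int (cartan v u))"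
    if "v \<in> V" for m v
    using cc that by simp_all
  obtain n where n: "\<And>k m. k \<ge> n \<Longrightarrow> m < - k \<or> k < m \<Longrightarrow> elems (obj X m) = {0}" "n \<ge> 0"
    using bounded_complex_bound[OF X] by blast
  let ?s = "\<lambda>m::int. if even m then (1::int) else - 1"
  have swap: "(\<Sum>m\<in>{-n..n}. ?s m * (\<Sum>u\<in>V. c m u * g u)) = (\<Sum>u\<in>V. (\<Sum>m\<in>{-n..n}. ?s m * c m u) * g u)" for g
    unfolding sum_distrib_left sum_distrib_right mult.assoc by (rule sum.swap)
  have "euler X (ve v) = (\<Sum>u\<in>V. (\<Sum>m\<in>{-n..n}. ?s m * c m u) * int (cartan u v))" if v: "v \<in> V" for v
    unfolding swap[symmetric] c[OF v, symmetric]
    by (rule euler_bound, rule wdim_zero[OF XD(1) ve_closed[OF v]], rule n(1)[of n]) simp_all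
  moreover have "euler (nakayama_complex A X) (ve v) =
      (\<Sum>u\<in>V. (\<Sum>m\<in>{-n..n}. ?s m * c m u) * int (cartan v u))" if v: "v \<in> V" for v
  proof -
    have o: "obj (nakayama_complex A X) m = nakayama_obj A (obj X m)" for m by (simp add: nakayama_complex_def)
    show ?thesis
      unfolding swap[symmetric] c'[OF v, symmetric] o[symmetric]
    proof (rule euler_bound, rule wdim_zero[OF bounded_complexD(1)[OF nakayama_complex_bounded[OF X proj]] ve_closed[OF v]])
      show "elems (obj (nakayama_complex A X) m) = {0}" if "m < - n \<or> n < m" for m
        unfolding o by (rule nakayama_zero_module[OF XD(1) n(1)[OF order_refl that]])
    qed
  qed
  ultimately show ?thesis by (intro exI[of _ "\<lambda>u. \<Sum>m\<in>{-n..n}. ?s m * c m u"]) simp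
qed

end

section \<open>Indecomposable injective modules\<close>

context path_basis
begin

section \<open>Trivial paths, simple modules and the injectives I_c\<close>

lemma len_idp: assumes "v \<in> V" shows "len (idp v) = 0"
  using T_len[OF T_id_left[OF idp_Q[OF assms]]] idp_src[OF assms] by simp

lemma len_zero_T:
  assumes "T p q r" "len r = 0"
  shows "p = r" "q = r"
proof -
  note m = T_mem[OF assms(1)] and e = T_ends[OF assms(1)] and l = T_len[OF assms(1)]
  have "p = idp (src p)" "q = idp (src q)" "r = idp (src r)"
    using m l assms(2) by (auto intro: len_zero)
  moreover have "tgt p = src p" using calculation(1) idp_tgt[OF src_V] m by metis
  ultimately show "p = r" "q = r" using e by metis+
qed

lemma bas_ract_zero:
  assumes act: "path_action S act vt" and x: "x \<in> S" and q: "q \<in> Q" and n: "\<nexists>y. act x q y"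
  shows "ract (act_module S act) (bas S x) (\<beta> q) = 0"
proof (rule act_module_ext[OF act_module_ract_mem fun_vs.subspace_0[OF act_module_subspace]])
  note fin = path_actionD(1)[OF act]
  fix z assume z: "z \<in> S"
  have "ract (act_module S act) (bas S x) (\<beta> q) (to_nat_on S z) = 0"
    unfolding act_module_ract[OF fin z] using fin x n q
    by (intro sum.neutral ballI) (auto simp: bas_apply coef_\<beta>)
  then show "ract (act_module S act) (bas S x) (\<beta> q) (to_nat_on S z) = 0 (to_nat_on S z)" by simp
qed

text \<open>
  The injective hull of the simple module at \<open>c\<close> is the dual of the left module of paths ending
  at \<open>c\<close>; the dual basis vector of \<open>q = p r\<close> is mapped by \<open>p\<close> to that of \<open>r\<close>.
\<close>

definition inj_idx :: "'v \<Rightarrow> 'q set" where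
  "inj_idx c = {q \<in> Q. tgt q = c}"

definition inj_act :: "'v \<Rightarrow> 'q \<Rightarrow> 'q \<Rightarrow> 'q \<Rightarrow> bool" where
  "inj_act c q p r \<longleftrightarrow> tgt q = c \<and> T p r q"

abbreviation vinj :: "'v \<Rightarrow> ('k, 'a, nat) rmodule" where
  "vinj c \<equiv> act_module (inj_idx c) (inj_act c)"

text \<open>The action is single-valued because composition of paths can be cancelled on the left,
  and its associativity is that of \<open>T\<close> with the outer path fixed.\<close>

lemma inj_path_action: "path_action (inj_idx c) (inj_act c) src"
  unfolding path_action_def
proof (intro conjI allI impI ballI)
  show "finite (inj_idx c)" unfolding inj_idx_def using finQ by simp
  show "x \<in> inj_idx c" "q \<in> Q" "y \<in> inj_idx c" if "inj_act c x q y" for x q y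
    using that T_mem[of q y x] T_ends[of q y x] unfolding inj_act_def inj_idx_def by auto
  show "y = y'" if "inj_act c x q y \<and> inj_act c x q y'" for x q y y'
    using that T_cancel[of q y x y'] unfolding inj_act_def by blast
  show "(\<exists>y. inj_act c x p y \<and> inj_act c y q z) \<longleftrightarrow> (\<exists>r. T p q r \<and> inj_act c x r z)" for x p q z
  proof -
    have "(\<exists>y. inj_act c x p y \<and> inj_act c y q z) \<longleftrightarrow> tgt x = c \<and> (\<exists>y. T q z y \<and> T p y x)"
      unfolding inj_act_def using T_ends by metis
    also have "\<dots> \<longleftrightarrow> tgt x = c \<and> (\<exists>r. T p q r \<and> T r z x)" using T_assoc by metis
    also have "\<dots> \<longleftrightarrow> (\<exists>r. T p q r \<and> inj_act c x r z)" unfolding inj_act_def by blast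
    finally show ?thesis .
  qed
  fix x assume x: "x \<in> inj_idx c"
  then show "src x \<in> V" by (simp add: inj_idx_def src_V)
  fix v y assume v: "v \<in> V"
  show "inj_act c x (idp v) y \<longleftrightarrow> y = x \<and> v = src x"
    using x unfolding inj_act_def T_idpD(1)[OF v] inj_idx_def by auto
qed

text \<open>The simple module at c, on one point. It will embed into I_c as the line spanned by the
  dual vector of the trivial path.\<close>

definition simple_act :: "'v \<Rightarrow> 'q \<Rightarrow> 'q \<Rightarrow> 'q \<Rightarrow> bool" where
  "simple_act c x q y \<longleftrightarrow> x = idp c \<and> q = idp c \<and> y = idp c"

lemma simple_path_action:
  assumes c: "c \<in> V" shows "path_action {idp c} (simple_act c) (\<lambda>_. c)"
  unfolding path_action_def
proof (intro conjI allI impI ballI)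
  show "x \<in> {idp c}" "q \<in> Q" "y \<in> {idp c}" if "simple_act c x q y" for x q y
    using that idp_Q[OF c] unfolding simple_act_def by auto
  show "y = y'" if "simple_act c x q y \<and> simple_act c x q y'" for x q y y'
    using that unfolding simple_act_def by blast
  \<comment> \<open>Lengths add up, so a trivial path has only trivial factors.\<close>
  have t: "T p q (idp c) \<longleftrightarrow> p = idp c \<and> q = idp c" for p q
    using len_zero_T[OF _ len_idp[OF c]] T_idpD(1)[OF c] idp_Q[OF c] idp_src[OF c] by metis
  then show "(\<exists>y. simple_act c x p y \<and> simple_act c y q z) \<longleftrightarrow> (\<exists>r. T p q r \<and> simple_act c x r z)" for x p q z
    unfolding simple_act_def by blast
  show "simple_act c x (idp v) y \<longleftrightarrow> y = x \<and> v = c" if "x \<in> {idp c}" "v \<in> V" for x v y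
    using that idp_src[OF c] idp_src[OF that(2)] unfolding simple_act_def by auto
qed (use c in auto)

text \<open>Take m nonzero and a longest path that does not kill it. The resulting vector is killed
  by every nontrivial path, since composites with such paths are longer.\<close>

lemma socle_vector:
  assumes M: "right_module A M" and nz: "elems M \<noteq> {0}"
  obtains c w where "c \<in> V" "w \<in> wspace M (ve c)" "w \<noteq> 0"
    "\<And>q. q \<in> Q \<Longrightarrow> q \<noteq> idp c \<Longrightarrow> ract M w (\<beta> q) = 0"
proof -
  obtain m where m: "m \<in> elems M" "m \<noteq> 0" using nz fun_vs.subspace_0[OF right_moduleD(1)[OF M]] by blast
  let ?R = "{q \<in> Q. ract M m (\<beta> q) \<noteq> 0}"
  have "?R \<noteq> {}"
  proof
    assume e: "?R = {}"
    then have "ract M m (ve v) = 0" if "v \<in> V" for v using idp_Q[OF that] by blast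
    then have "m = 0" using vertex_decomp[OF M m(1)] by (simp add: sum.neutral)
    then show False using m(2) by simp
  qed
  moreover have "finite ?R" using finQ by simp
  ultimately have "Max (len ` ?R) \<in> len ` ?R" by (intro Max_in) simp_all
  then obtain q where q: "q \<in> ?R" "len q = Max (len ` ?R)" by (elim imageE) simp
  have qmax: "len r \<le> len q" if "r \<in> ?R" for r
    unfolding q(2) using finQ that by (intro Max_ge) simp_all
  have qQ: "q \<in> Q" using q by simp
  let ?w = "ract M m (\<beta> q)"
  have we: "?w \<in> elems M" by (rule right_moduleD(3)[OF M m(1) \<beta>_closed[OF qQ]])
  show ?thesis
  proof (rule that[of "tgt q" ?w])
    show "tgt q \<in> V" by (rule tgt_V[OF qQ])
    show "?w \<in> wspace M (ve (tgt q))"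
      using we ract_T[OF M m(1) T_id_right[OF qQ]] by (simp add: wspace_def)
    show "?w \<noteq> 0" using q by simp
    show "ract M ?w (\<beta> p) = 0" if p: "p \<in> Q" "p \<noteq> idp (tgt q)" for p
    proof (cases "\<exists>r. T q p r")
      case True
      then obtain r where r: "T q p r" by blast
      have "len p \<noteq> 0" using len_zero[OF p(1)] p(2) T_ends[OF r] by metis
      then have "len q < len r" using T_len[OF r] by simp
      then have "r \<notin> ?R" using qmax[of r] by (metis not_le)
      then have "ract M m (\<beta> r) = 0" using T_mem[OF r] by blast
      then show ?thesis unfolding ract_T[OF M m(1) r] .
    next
      case False
      then show ?thesis by (rule ract_no_T[OF M m(1) qQ p(1)])
    qed
  qed
qed

text \<open>The simple module at c maps into I_c, onto the line of the trivial path, and into J,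
  onto the line of w. The first map is injective, so injectivity of J extends the second one to
  I_c.\<close>

lemma injective_section:
  assumes J: "injective_module A J" and c: "c \<in> V" and w: "w \<in> wspace J (ve c)"
    and wz: "\<And>q. q \<in> Q \<Longrightarrow> q \<noteq> idp c \<Longrightarrow> ract J w (\<beta> q) = 0"
  obtains l where "l \<in> module_hom A (vinj c) J" "l (bas (inj_idx c) (idp c)) = w"
proof -
  let ?X = "{idp c}" and ?S = "inj_idx c"
  let ?M = "act_module ?X (simple_act c)"
  have R: "right_module A J" using J unfolding injective_module_def by (rule conjunct1)
  note Ma = simple_path_action[OF c] and Na = inj_path_action[of c]
  have M: "right_module A ?M" by (rule act_module_right_module[OF Ma])
  have N: "right_module A (vinj c)" by (rule act_module_right_module[OF Na])
  have fX: "finite ?X" "idp c \<in> ?X" by auto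
  have cS: "idp c \<in> ?S" using idp_Q[OF c] idp_tgt[OF c] by (simp add: inj_idx_def)
  let ?g = "act_hom ?X (bas ?S)" and ?h = "act_hom ?X (\<lambda>_. w)"
  have g: "?g \<in> module_hom A ?M (vinj c)"
  proof (rule act_hom_hom[OF Ma N])
    show "bas ?S x \<in> elems (vinj c)" if "x \<in> ?X" for x using that cS by (auto intro: bas_mem)
    show "ract (vinj c) (bas ?S x) (\<beta> q) = bas ?S y" if "simple_act c x q y" for x q y
    proof -
      have "inj_act c (idp c) (idp c) (idp c)"
        unfolding inj_act_def using T_idpD[OF c] idp_Q[OF c] idp_src[OF c] idp_tgt[OF c] by simp
      then show ?thesis using that bas_ract[OF Na] unfolding simple_act_def by simp
    qed
    show "ract (vinj c) (bas ?S x) (\<beta> q) = 0" if "x \<in> ?X" "q \<in> Q" "\<nexists>y. simple_act c x q y" for x q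
    proof -
      have x: "x = idp c" "q \<noteq> idp c" using that unfolding simple_act_def by auto
      have "\<nexists>y. inj_act c x q y" unfolding inj_act_def x(1) using len_zero_T(1)[OF _ len_idp[OF c]] x(2) by blast
      then show ?thesis using bas_ract_zero[OF Na _ that(2)] cS x(1) by blast
    qed
  qed
  have inj: "inj_on ?g (elems ?M)"
  proof (rule inj_onI)
    fix f f' assume f: "f \<in> elems ?M" "f' \<in> elems ?M" and eq: "?g f = ?g f'"
    have ga: "?g f (to_nat_on ?S (idp c)) = f (to_nat_on ?X (idp c))" for f
      using bas_apply[OF path_actionD(1)[OF Na] cS cS] by (simp add: act_hom_def fscale_apply)
    show "f = f'"
      by (rule act_module_ext[OF f]) (use ga[of f] ga[of f'] eq in simp)
  qed
  have h: "?h \<in> module_hom A ?M J"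
  proof (rule act_hom_hom[OF Ma R])
    show "w \<in> elems J" by (rule subsetD[OF wspace_subset w])
    show "ract J w (\<beta> q) = w" if "simple_act c x q y" for x q y
      using that w by (simp add: simple_act_def wspace_def)
    show "ract J w (\<beta> q) = 0" if "x \<in> ?X" "q \<in> Q" "\<nexists>y. simple_act c x q y" for x q
      using that by (intro wz) (auto simp: simple_act_def)
  qed
  have "right_module A ?M \<and> right_module A (vinj c) \<and> ?g \<in> module_hom A ?M (vinj c) \<and>
      inj_on ?g (elems ?M) \<and> ?h \<in> module_hom A ?M J"
    by (intro conjI M N g inj h)
  then have "\<exists>l\<in>module_hom A (vinj c) J. \<forall>v\<in>elems ?M. l (?g v) = ?h v"
    using J[unfolded injective_module_def, THEN conjunct2, rule_format] by blast
  then obtain l where l: "l \<in> module_hom A (vinj c) J" "\<And>v. v \<in> elems ?M \<Longrightarrow> l (?g v) = ?h v" by blast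
  have "l (bas ?S (idp c)) = w"
    using l(2)[OF bas_mem[OF fX(2)]] unfolding act_hom_bas[OF fX] .
  then show ?thesis using l(1) that by blast
qed

text \<open>A map from I_c to J hits the socle vector w. Its image is split off by hand: a linear
  form with value 1 at w pairs the images t q with the paths ending at c, and the elements
  orthogonal to these paths are a complementary submodule. Indecomposability makes that zero, and
  the t q form a basis of J.\<close>

theorem injective_wdim:
  assumes J: "injective_module A J" and ind: "indecomposable_module A J"
  shows "\<exists>c\<in>V. \<forall>v\<in>V. wdim J (ve v) = cartan v c"
proof -
  have R: "right_module A J" using J unfolding injective_module_def by (rule conjunct1)
  have "elems J \<noteq> {0}" using ind unfolding indecomposable_module_def by simp
  then obtain c w where c: "c \<in> V" and w: "w \<in> wspace J (ve c)" "w \<noteq> 0"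
    and wz: "\<And>q. q \<in> Q \<Longrightarrow> q \<noteq> idp c \<Longrightarrow> ract J w (\<beta> q) = 0"
    using socle_vector[OF R] by blast
  obtain l where l: "l \<in> module_hom A (vinj c) J" and lw: "l (bas (inj_idx c) (idp c)) = w"
    using injective_section[OF J c w(1) wz] by blast
  let ?S = "inj_idx c"
  let ?c = "to_nat_on ?S"
  note Na = inj_path_action[of c]
  have N: "right_module A (vinj c)" by (rule act_module_right_module[OF Na])
  have fS: "finite ?S" by (rule path_actionD(1)[OF Na])
  note Js = right_moduleD(1)[OF R]
  have SQ: "q \<in> Q" if "q \<in> ?S" for q using that by (simp add: inj_idx_def)
  define t where "t q = l (bas ?S q)" for q
  have tm: "t q \<in> elems J" if "q \<in> ?S" for q
    unfolding t_def by (rule module_homD(2)[OF l bas_mem[OF that]])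
  have tq: "ract J (t q) (\<beta> p) = l (ract (vinj c) (bas ?S q) (\<beta> p))" if "q \<in> ?S" "p \<in> Q" for q p
    unfolding t_def by (rule module_homD(3)[OF l bas_mem[OF that(1)] \<beta>_closed[OF that(2)], symmetric])
  have l0: "l 0 = 0" by (rule linear_on_zero[OF act_module_subspace module_homD(1)[OF l]])
  have lt: "l f = (\<Sum>q\<in>?S. fscale (f (?c q)) (t q))" if f: "f \<in> elems (vinj c)" for f
  proof -
    have "l f = l (\<Sum>q\<in>?S. fscale (f (?c q)) (bas ?S q))"
      by (rule arg_cong[OF act_module_expand[OF fS f]])
    also have "\<dots> = (\<Sum>q\<in>?S. fscale (f (?c q)) (l (bas ?S q)))"
      by (rule linear_on_sum_scale[OF act_module_subspace module_homD(1)[OF l] bas_mem])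
    finally show ?thesis unfolding t_def .
  qed
  obtain n where n: "w n \<noteq> 0" using w(2) by (auto simp: fun_eq_iff)
  \<comment> \<open>Any linear form with value 1 at w serves; this is a coordinate at which w is
    nonzero, normalised.\<close>
  define \<phi> where "\<phi> v = v n / w n" for v :: "nat \<Rightarrow> 'k"
  have \<phi>sum: "\<phi> (\<Sum>x\<in>X. fscale (a x) (f x)) = (\<Sum>x\<in>X. a x * \<phi> (f x))" for X :: "'q set" and a f
    unfolding \<phi>_def sum_fun_apply fscale_apply by (simp add: sum_divide_distrib)
  have \<phi>diff: "\<phi> (u - v) = \<phi> u - \<phi> v" for u v by (simp add: \<phi>_def diff_divide_distrib)
  have \<phi>0: "\<phi> 0 = 0" by (simp add: \<phi>_def)
  \<comment> \<open>If q is p followed by r and both p and q end at c, then r runs from c to c and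
    is trivial. So p sends t q to w when p = q and to zero otherwise.\<close>
  have dual: "\<phi> (ract J (t q) (\<beta> p)) = of_bool (q = p)" if q: "q \<in> ?S" and p: "p \<in> ?S" for q p
  proof (cases "\<exists>r. T p r q")
    case True
    then obtain r where r: "T p r q" by blast
    have "src r = c" "tgt r = c" using T_ends[OF r] q p by (auto simp: inj_idx_def)
    then have rc: "r = idp c" using acyclic[of r] T_mem[OF r] by simp
    then have qp: "q = p" using r T_idpD(2)[OF c] by blast
    have "inj_act c q p r" using r q by (simp add: inj_act_def inj_idx_def)
    then have "ract J (t q) (\<beta> p) = w" unfolding tq[OF q SQ[OF p]] bas_ract[OF Na] rc lw by (simp add: bas_ract[OF Na] lw)
    then show ?thesis using qp n by (simp add: \<phi>_def)
  next
    case False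
    then have "\<nexists>y. inj_act c q p y" by (simp add: inj_act_def)
    then have "ract J (t q) (\<beta> p) = 0" unfolding tq[OF q SQ[OF p]] using bas_ract_zero[OF Na q SQ[OF p]] l0 by simp
    moreover have "q \<noteq> p" using False T_id_right[OF SQ[OF p]] by blast
    ultimately show ?thesis using \<phi>0 by simp
  qed
  have \<phi>t: "\<phi> (ract J (\<Sum>q\<in>X. fscale (a q) (t q)) (\<beta> p)) = (if p \<in> X then a p else 0)"
    if X: "X \<subseteq> ?S" and p: "p \<in> ?S" for X a p
  proof -
    have "ract J (\<Sum>q\<in>X. fscale (a q) (t q)) (\<beta> p) = (\<Sum>q\<in>X. fscale (a q) (ract J (t q) (\<beta> p)))"
      by (rule linear_on_sum_scale[OF Js ract_linear[OF R \<beta>_closed[OF SQ[OF p]]] tm[OF subsetD[OF X]]])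
    then have "\<phi> (ract J (\<Sum>q\<in>X. fscale (a q) (t q)) (\<beta> p)) = (\<Sum>q\<in>X. a q * \<phi> (ract J (t q) (\<beta> p)))"
      by (simp only: \<phi>sum)
    also have "\<dots> = (\<Sum>q\<in>X. if q = p then a q else 0)"
      using dual[OF subsetD[OF X] p] by (intro sum.cong) auto
    finally show ?thesis using finite_subset[OF X fS] by simp
  qed
  let ?T = "l ` elems (vinj c)"
  \<comment> \<open>The orthogonal complement of the image under the pairing of u and p with value
    \<phi> (u p).\<close>
  let ?U = "{u \<in> elems J. \<forall>p\<in>?S. \<phi> (ract J u (\<beta> p)) = 0}"
  have Ts: "submodule A ?T J"
    unfolding submodule_def
  proof (intro conjI ballI)
    show "fun_vs.subspace ?T" by (rule subspace_image[OF act_module_subspace module_homD(1)[OF l]])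
    show "?T \<subseteq> elems J" using module_homD(2)[OF l] by (rule image_subsetI)
    fix u a assume "u \<in> ?T" and a: "a \<in> carrier A"
    then obtain f where f: "f \<in> elems (vinj c)" "u = l f" by (elim imageE)
    show "ract J u a \<in> ?T"
      unfolding f(2) module_homD(3)[OF l f(1) a, symmetric] by (intro imageI right_moduleD(3)[OF N f(1) a])
  qed
  have Uadd: "\<phi> (u + v) = \<phi> u + \<phi> v" and Uscale: "\<phi> (fscale a u) = a * \<phi> u" for u v a
    by (simp_all add: \<phi>_def add_divide_distrib fscale_apply)
  have Us: "submodule A ?U J"
    unfolding submodule_def
  proof (intro conjI ballI)
    show "fun_vs.subspace ?U"
      unfolding fun_vs.subspace_def
    proof (intro conjI ballI allI)
      show "0 \<in> ?U" using fun_vs.subspace_0[OF Js] ract_zero[OF R \<beta>_closed] SQ \<phi>0 by simp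
    next
      fix u v assume u: "u \<in> ?U" and v: "v \<in> ?U"
      have e: "u \<in> elems J" "v \<in> elems J" using u v by simp_all
      have "\<phi> (ract J (u + v) (\<beta> p)) = 0" if p: "p \<in> ?S" for p
      proof -
        have "ract J (u + v) (\<beta> p) = ract J u (\<beta> p) + ract J v (\<beta> p)"
          using ract_linear[OF R \<beta>_closed[OF SQ[OF p]], unfolded linear_on_def, THEN conjunct1, rule_format, OF e] .
        then show ?thesis using u v p by (simp only: Uadd mem_Collect_eq) simp
      qed
      then show "u + v \<in> ?U" using fun_vs.subspace_add[OF Js e] by (simp only: mem_Collect_eq) simp
    next
      fix a u assume u: "u \<in> ?U"
      have e: "u \<in> elems J" using u by simp
      have "\<phi> (ract J (fscale a u) (\<beta> p)) = 0" if p: "p \<in> ?S" for p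
      proof -
        have "ract J (fscale a u) (\<beta> p) = fscale a (ract J u (\<beta> p))"
          using ract_linear[OF R \<beta>_closed[OF SQ[OF p]], unfolded linear_on_def, THEN conjunct2, rule_format, OF e] .
        then show ?thesis using u p by (simp only: Uscale mem_Collect_eq) simp
      qed
      then show "fscale a u \<in> ?U" using fun_vs.subspace_scale[OF Js e] by (simp only: mem_Collect_eq) simp
    qed
    show "?U \<subseteq> elems J" by blast
    fix u a assume u: "u \<in> ?U" and a: "a \<in> carrier A"
    have e: "u \<in> elems J" using u by simp
    \<comment> \<open>The product of a with p involves only paths that end at c, and u is orthogonal
      to all of them.\<close>
    have "\<phi> (ract J (ract J u a) (\<beta> p)) = 0" if p: "p \<in> ?S" for p
    proof -
      have pc: "\<beta> p \<in> carrier A" by (rule \<beta>_closed[OF SQ[OF p]])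
      have "ract J (ract J u a) (\<beta> p) = ract J u (a \<otimes>\<^bsub>A\<^esub> \<beta> p)"
        by (rule right_moduleD(7)[OF R e a pc, symmetric])
      also have "\<dots> = (\<Sum>q\<in>Q. fscale (coef q (a \<otimes>\<^bsub>A\<^esub> \<beta> p)) (ract J u (\<beta> q)))"
        by (rule ract_expand[OF R e m_closed[OF a pc]])
      finally have "\<phi> (ract J (ract J u a) (\<beta> p)) = (\<Sum>q\<in>Q. coef q (a \<otimes>\<^bsub>A\<^esub> \<beta> p) * \<phi> (ract J u (\<beta> q)))"
        by (simp only: \<phi>sum)
      also have "\<dots> = 0"
      proof (intro sum.neutral ballI)
        fix q assume q: "q \<in> Q"
        show "coef q (a \<otimes>\<^bsub>A\<^esub> \<beta> p) * \<phi> (ract J u (\<beta> q)) = 0"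
        proof (cases "q \<in> ?S")
          case True
          then show ?thesis using u by simp
        next
          case False
          have "T p (idp c) p" using T_id_right[OF SQ[OF p]] p by (simp add: inj_idx_def)
          then have "a \<otimes>\<^bsub>A\<^esub> \<beta> p = (a \<otimes>\<^bsub>A\<^esub> \<beta> p) \<otimes>\<^bsub>A\<^esub> ve c"
            using \<beta>_mult_T m_assoc[OF a pc ve_closed[OF c]] by simp
          then have "coef q (a \<otimes>\<^bsub>A\<^esub> \<beta> p) = of_bool (tgt q = c) * coef q (a \<otimes>\<^bsub>A\<^esub> \<beta> p)"
            using coef_ve_right[OF q c m_closed[OF a pc]] by simp
          then show ?thesis using False q by (simp add: inj_idx_def)
        qed
      qed
      finally show ?thesis .
    qed
    then show "ract J u a \<in> ?U" using right_moduleD(3)[OF R e a] by simp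
  qed
  have Tsub: "fun_vs.subspace ?T" "?T \<subseteq> elems J" and Usub: "fun_vs.subspace ?U" "?U \<subseteq> elems J"
    by (rule Ts[unfolded submodule_def, THEN conjunct1] Us[unfolded submodule_def, THEN conjunct1]
        Ts[unfolded submodule_def, THEN conjunct2, THEN conjunct1]
        Us[unfolded submodule_def, THEN conjunct2, THEN conjunct1])+
  have int: "?T \<inter> ?U = {0}"
  proof
    show "{0} \<subseteq> ?T \<inter> ?U"
      using Tsub(1)[THEN fun_vs.subspace_0] Usub(1)[THEN fun_vs.subspace_0] by (simp only: Int_iff insert_subset empty_subsetI)
    show "?T \<inter> ?U \<subseteq> {0}"
    proof
      fix x assume x: "x \<in> ?T \<inter> ?U"
      then obtain f where f: "f \<in> elems (vinj c)" "x = l f" by blast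
      have "f (?c p) = 0" if p: "p \<in> ?S" for p
      proof -
        have "\<phi> (ract J x (\<beta> p)) = 0" using x p by simp
        then show ?thesis using \<phi>t[OF order_refl p, of "\<lambda>q. f (?c q)"] p unfolding f(2) lt[OF f(1)] by simp
      qed
      then show "x \<in> {0}" unfolding f(2) lt[OF f(1)] by (simp add: sum.neutral)
    qed
  qed
  have sum: "elems J = {u + v |u v. u \<in> ?T \<and> v \<in> ?U}"
  proof
    show "{u + v |u v. u \<in> ?T \<and> v \<in> ?U} \<subseteq> elems J"
      using fun_vs.subspace_add[OF Js subsetD[OF Tsub(2)] subsetD[OF Usub(2)]] by blast
    show "elems J \<subseteq> {u + v |u v. u \<in> ?T \<and> v \<in> ?U}"
    proof
      fix x assume x: "x \<in> elems J"
      let ?a = "\<lambda>q. \<phi> (ract J x (\<beta> q))"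
      \<comment> \<open>By \<open>dual\<close>, the pairings of x with the paths are the coordinates
        of its component in the image of I_c.\<close>
      let ?y = "\<Sum>q\<in>?S. fscale (?a q) (t q)"
      have yT: "?y \<in> ?T"
      proof (rule fun_vs.subspace_sum)
        show "fun_vs.subspace ?T" by (rule Tsub(1))
        show "fscale (?a q) (t q) \<in> ?T" if "q \<in> ?S" for q
          unfolding t_def by (intro fun_vs.subspace_scale[OF Tsub(1)] imageI bas_mem that)
      qed
      have ye: "?y \<in> elems J" by (rule subsetD[OF Tsub(2) yT])
      have "\<phi> (ract J (x - ?y) (\<beta> p)) = 0" if p: "p \<in> ?S" for p
      proof -
        have "ract J (x - ?y) (\<beta> p) = ract J x (\<beta> p) - ract J ?y (\<beta> p)"
          by (rule linear_on_diff[OF Js ract_linear[OF R \<beta>_closed[OF SQ[OF p]]] x ye])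
        then show ?thesis using \<phi>t[OF order_refl p, of ?a] p by (simp only: \<phi>diff if_True) simp
      qed
      then have "x - ?y \<in> ?U" using subspace_diff_mem[OF Js x ye] by blast
      moreover have "x = ?y + (x - ?y)" by simp
      ultimately show "x \<in> {u + v |u v. u \<in> ?T \<and> v \<in> ?U}" using yT by blast
    qed
  qed
  have "?T = {0} \<or> ?U = {0}"
    using ind[unfolded indecomposable_module_def, THEN conjunct2, THEN conjunct2, rule_format, OF conjI[OF Ts conjI[OF Us conjI[OF int sum]]]] .
  moreover have cS: "idp c \<in> ?S" using idp_Q[OF c] idp_tgt[OF c] by (simp add: inj_idx_def)
  then have "w \<in> ?T" using lw bas_mem by (intro image_eqI[of _ _ "bas ?S (idp c)"]) auto
  then have "?T \<noteq> {0}" using w(2) by blast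
  ultimately have "?U = {0}" by blast
  then have JT: "elems J \<subseteq> ?T" using sum by auto
  have "wdim J (ve v) = cartan v c" if v: "v \<in> V" for v
    unfolding wdim_def cartan_def
  proof (rule dim_family)
    let ?X = "{q \<in> Q. src q = v \<and> tgt q = c}"
    have XS: "?X \<subseteq> ?S" by (auto simp: inj_idx_def)
    have tv: "ract J (t q) (ve v) = (if src q = v then t q else 0)" if q: "q \<in> ?S" for q
    proof (cases "src q = v")
      case True
      have "inj_act c q (idp v) q" using q True T_idpD(1)[OF v] by (simp add: inj_act_def inj_idx_def)
      then show ?thesis using True bas_ract[OF Na] unfolding tq[OF q idp_Q[OF v]] by (simp add: t_def)
    next
      case False
      then have "\<nexists>y. inj_act c q (idp v) y" using T_idpD(1)[OF v] by (auto simp: inj_act_def)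
      then show ?thesis unfolding tq[OF q idp_Q[OF v]] using False bas_ract_zero[OF Na q idp_Q[OF v]] l0 by simp
    qed
    show "finite ?X" using finQ by simp
    show "fun_vs.subspace (wspace J (ve v))" by (rule wspace_subspace[OF R ve_closed[OF v]])
    show "t q \<in> wspace J (ve v)" if "q \<in> ?X" for q
      using tv[of q] tm[of q] that by (simp add: inj_idx_def wspace_def)
    show "\<exists>a. x = (\<Sum>q\<in>?X. fscale (a q) (t q))" if x: "x \<in> wspace J (ve v)" for x
    proof -
      have xe: "x \<in> elems J" "ract J x (ve v) = x" using x by (auto simp: wspace_def)
      then obtain f where f: "f \<in> elems (vinj c)" "x = l f" using JT by blast
      have "x = ract J (\<Sum>q\<in>?S. fscale (f (?c q)) (t q)) (ve v)"
        using xe(2) unfolding f(2) lt[OF f(1)] by (rule sym)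
      also have "\<dots> = (\<Sum>q\<in>?S. fscale (f (?c q)) (ract J (t q) (ve v)))"
        by (rule linear_on_sum_scale[OF Js ract_linear[OF R ve_closed[OF v]] tm])
      also have "\<dots> = (\<Sum>q\<in>?X. fscale (f (?c q)) (t q))"
        by (rule sum.mono_neutral_cong_right[OF fS XS]) (auto simp: tv inj_idx_def)
      finally show ?thesis by (intro exI[of _ "\<lambda>q. f (?c q)"])
    qed
    show "a q = 0" if s: "(\<Sum>q\<in>?X. fscale (a q) (t q)) = 0" and q: "q \<in> ?X" for a q
    proof -
      have qS: "q \<in> ?S" by (rule subsetD[OF XS q])
      show ?thesis
        using \<phi>t[OF XS qS, of a] q unfolding s using ract_zero[OF R \<beta>_closed[OF SQ[OF qS]]] \<phi>0 by simp
    qed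
  qed
  then show ?thesis using c by blast
qed

end

section \<open>The Coxeter transformation\<close>

context path_basis
begin

lemma wdim_vproj:
  assumes u: "u \<in> V" and v: "v \<in> V"
  shows "wdim (vproj u) (ve v) = cartan u v"
proof -
  let ?S = "free_idx {()} (\<lambda>_. u)"
  let ?c = "to_nat_on ?S" and ?X = "{q \<in> Q. src q = u \<and> tgt q = v}"
  have K: "finite {()}" "\<And>k. k \<in> {()} \<Longrightarrow> u \<in> V" using u by auto
  have act: "path_action ?S (free_act {()} (\<lambda>_. u)) (\<lambda>x. tgt (snd x))"
    by (rule free_path_action) (use u in auto)
  have R: "right_module A (vproj u)" by (rule act_module_right_module[OF act])
  have fS: "finite ?S" by (rule path_actionD(1)[OF act])
  have bv: "ract (vproj u) (bas ?S x) (ve v) = (if tgt (snd x) = v then bas ?S x else 0)" if x: "x \<in> ?S" for x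
  proof -
    have e: "free_act {()} (\<lambda>_. u) x (idp v) y \<longleftrightarrow> y = x \<and> v = tgt (snd x)" for y
      by (rule path_actionD(6)[OF act x v])
    show ?thesis
    proof (cases "tgt (snd x) = v")
      case True
      then show ?thesis using bas_ract[OF act e[THEN iffD2]] by simp
    next
      case False
      then show ?thesis using bas_ract_zero[OF act x idp_Q[OF v]] e by simp
    qed
  qed
  have XS: "((), q) \<in> ?S" if "q \<in> ?X" for q using that by (simp add: free_idx_iff)
  have "fun_vs.dim (wspace (vproj u) (ve v)) = card ?X"
  proof (rule dim_family)
    show "finite ?X" using finQ by simp
    show "fun_vs.subspace (wspace (vproj u) (ve v))" by (rule wspace_subspace[OF R ve_closed[OF v]])
    show "bas ?S ((), q) \<in> wspace (vproj u) (ve v)" if "q \<in> ?X" for q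
      using bv[OF XS[OF that]] bas_mem[OF XS[OF that]] that by (simp add: wspace_def)
    show "\<exists>c. f = (\<Sum>q\<in>?X. fscale (c q) (bas ?S ((), q)))" if f: "f \<in> wspace (vproj u) (ve v)" for f
    proof -
      have fe: "f \<in> elems (vproj u)" "ract (vproj u) f (ve v) = f" using f by (auto simp: wspace_def)
      have "f = ract (vproj u) (\<Sum>x\<in>?S. fscale (f (?c x)) (bas ?S x)) (ve v)"
        using fe act_module_expand[OF fS fe(1)] by simp
      also have "\<dots> = (\<Sum>x\<in>?S. fscale (f (?c x)) (ract (vproj u) (bas ?S x) (ve v)))"
        by (rule linear_on_sum_scale[OF act_module_subspace ract_linear[OF R ve_closed[OF v]] bas_mem])
      also have "\<dots> = (\<Sum>x\<in>Pair () ` ?X. fscale (f (?c x)) (bas ?S x))"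
      proof (rule sum.mono_neutral_cong_right[OF fS])
        show "Pair () ` ?X \<subseteq> ?S" using XS by blast
        show "\<forall>x\<in>?S - Pair () ` ?X. fscale (f (?c x)) (ract (vproj u) (bas ?S x) (ve v)) = 0"
        proof
          fix x assume x: "x \<in> ?S - Pair () ` ?X"
          then have "tgt (snd x) \<noteq> v" by (cases x) (auto simp: free_idx_iff)
          then show "fscale (f (?c x)) (ract (vproj u) (bas ?S x) (ve v)) = 0" using bv[of x] x by simp
        qed
        fix x assume "x \<in> Pair () ` ?X"
        then have "x \<in> ?S" "tgt (snd x) = v" by (auto simp: free_idx_iff)
        then show "fscale (f (?c x)) (ract (vproj u) (bas ?S x) (ve v)) = fscale (f (?c x)) (bas ?S x)"
          using bv[of x] by simp
      qed
      also have "\<dots> = (\<Sum>q\<in>?X. fscale (f (?c ((), q))) (bas ?S ((), q)))"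
        by (subst sum.reindex) (auto simp: inj_on_def)
      finally show ?thesis by (intro exI[of _ "\<lambda>q. f (?c ((), q))"])
    qed
    show "c q = 0" if s: "(\<Sum>q\<in>?X. fscale (c q) (bas ?S ((), q))) = 0" and q: "q \<in> ?X" for c q
    proof -
      have "0 = (\<Sum>p\<in>?X. fscale (c p) (bas ?S ((), p))) (?c ((), q))" unfolding s by simp
      also have "\<dots> = (\<Sum>p\<in>?X. if p = q then c p else 0)"
        unfolding sum_fun_apply fscale_apply
        using bas_apply[OF fS XS XS[OF q]] by (intro sum.cong) auto
      finally show ?thesis using finQ q by simp
    qed
  qed
  then show ?thesis unfolding wdim_def cartan_def .
qed

text \<open>
  On dimension vectors, \<open>\<nu>\<^sub>2\<close> is the Coxeter transformation: it replaces the class of an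
  indecomposable projective by that of the corresponding injective. Shifting by \<open>2\<close> preserves classes.
\<close>

definition coxeter_related :: "('v \<Rightarrow> int) \<Rightarrow> ('v \<Rightarrow> int) \<Rightarrow> bool" where
  "coxeter_related y w \<longleftrightarrow> (\<exists>c. \<forall>v\<in>V. y v = (\<Sum>u\<in>V. c u * int (cartan u v)) \<and>
     w v = (\<Sum>u\<in>V. c u * int (cartan v u)))"

text \<open>A projective resolution of Y shifted by -2 has the class of Y, because the shift is
  even; its Nakayama complex has the class of W.\<close>

lemma nu_coxeter:
  assumes "nu 2 A Y W"
  shows "coxeter_related (\<lambda>v. euler Y (ve v)) (\<lambda>v. euler W (ve v))"
proof -
  have d: "derived_nakayama A (shift (- 2) Y) W" using assms unfolding nu_def by simp
  then have Y: "bounded_complex A (shift (- 2) Y)" and W: "bounded_complex A W"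
    unfolding derived_nakayama_def by (rule conjunct1, rule conjunct2[THEN conjunct1])
  from d obtain X :: "('k, 'a, nat) cplx" and f where X: "bounded_complex A X"
    and proj: "\<And>m. projective_module A (obj X m)" and q: "quasi_iso A X (shift (- 2) Y) f"
    and di: "derived_iso A (nakayama_complex A X) W"
    unfolding derived_nakayama_def by blast
  obtain c where c: "\<forall>v\<in>V. euler X (ve v) = (\<Sum>u\<in>V. c u * int (cartan u v)) \<and>
      euler (nakayama_complex A X) (ve v) = (\<Sum>u\<in>V. c u * int (cartan v u))"
    using euler_nakayama[OF X proj] by blast
  have "euler X (ve v) = euler Y (ve v)" if v: "v \<in> V" for v
    using euler_quasi_iso[OF X Y q ve_closed[OF v] ve_idem[OF v]] by (simp add: euler_shift)
  moreover have "euler (nakayama_complex A X) (ve v) = euler W (ve v)" if v: "v \<in> V" for v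
    by (rule euler_derived_iso[OF nakayama_complex_bounded[OF X proj] W di ve_closed[OF v] ve_idem[OF v]])
  ultimately have "\<forall>v\<in>V. euler Y (ve v) = (\<Sum>u\<in>V. c u * int (cartan u v)) \<and>
      euler W (ve v) = (\<Sum>u\<in>V. c u * int (cartan v u))" using c by simp
  then show ?thesis unfolding coxeter_related_def by blast
qed

lemma cartan_coxeter:
  assumes c: "c \<in> V"
  shows "coxeter_related (\<lambda>v. int (cartan c v)) (\<lambda>v. int (cartan v c))"
  unfolding coxeter_related_def
proof (intro exI[of _ "\<lambda>u. of_bool (u = c)"] ballI conjI)
  fix v
  have "(\<Sum>u\<in>V. of_bool (u = c) * g u) = (\<Sum>u\<in>V. if u = c then g u else 0)" for g :: "'v \<Rightarrow> int"
    by (intro sum.cong) auto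
  then have d: "(\<Sum>u\<in>V. of_bool (u = c) * g u) = g c" for g :: "'v \<Rightarrow> int" using finV c by simp
  show "int (cartan c v) = (\<Sum>u\<in>V. of_bool (u = c) * int (cartan u v))"
    "int (cartan v c) = (\<Sum>u\<in>V. of_bool (u = c) * int (cartan v u))"
    unfolding d by simp_all
qed

text \<open>The map \<psi> plays the inverse Coxeter transformation on a quotient \<open>agg\<close>
  of the lattice of dimension vectors. The i steps of the definition lead from P_b to some I_c, and
  one further step leads from I_c to P_c. Hence the exponent is positive even when P_b is itself
  injective.\<close>

theorem coxeter_orbit:
  fixes agg :: "('v \<Rightarrow> int) \<Rightarrow> 'z" and \<psi> :: "'z \<Rightarrow> 'z"
  assumes rf: "n_representation_finite 2 A"
    and agg: "\<And>y w. (\<And>v. v \<in> V \<Longrightarrow> y v = w v) \<Longrightarrow> agg y = agg w"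
    and \<psi>: "\<And>y w. coxeter_related y w \<Longrightarrow> agg y = \<psi> (agg w)"
    and b: "b \<in> V"
  shows "\<exists>i. \<exists>c\<in>V. (\<psi> ^^ Suc i) (agg (\<lambda>v. int (cartan b v))) = agg (\<lambda>v. int (cartan c v))"
proof -
  have chain: "agg (\<lambda>v. euler Y (ve v)) = (\<psi> ^^ i) (agg (\<lambda>v. euler X (ve v)))"
    if "nu_neg_power 2 A i X Y" for i X Y
    using that
  proof (induction i arbitrary: Y)
    case 0
    then have b: "bounded_complex A X" "bounded_complex A Y" "derived_iso A X Y" by simp_all
    have e: "euler X (ve v) = euler Y (ve v)" if "v \<in> V" for v
      by (rule euler_derived_iso[OF b ve_closed[OF that] ve_idem[OF that]])
    then show ?case using agg[of "\<lambda>v. euler X (ve v)"] by simp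
  next
    case (Suc i)
    then obtain W where W: "nu_neg_power 2 A i X W" "nu 2 A Y W" by auto
    show ?case using \<psi>[OF nu_coxeter[OF W(2)]] Suc.IH[OF W(1)] by simp
  qed
  have P: "projective_module A (vproj b)" "indecomposable_module A (vproj b)"
    using b by (auto intro: free_projective vproj_indecomposable)
  then obtain i J where J: "injective_module A J" "indecomposable_module A J"
    and n: "nu_neg_power 2 A i (stalk (vproj b)) (stalk J)"
    using rf unfolding n_representation_finite_def by blast
  obtain c where c: "c \<in> V" "\<And>v. v \<in> V \<Longrightarrow> wdim J (ve v) = cartan v c"
    using injective_wdim[OF J] by blast
  have RJ: "right_module A J" using J(1) unfolding injective_module_def by (rule conjunct1)
  have RP: "right_module A (vproj b)" by (rule projective_right_module[OF P(1)])
  have "agg (\<lambda>v. int (cartan v c)) = agg (\<lambda>v. euler (stalk J) (ve v))"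
    by (rule agg) (simp add: euler_stalk[OF RJ ve_closed] c)
  also have "\<dots> = (\<psi> ^^ i) (agg (\<lambda>v. euler (stalk (vproj b)) (ve v)))" by (rule chain[OF n])
  also have "agg (\<lambda>v. euler (stalk (vproj b)) (ve v)) = agg (\<lambda>v. int (cartan b v))"
    by (rule agg) (simp add: euler_stalk[OF RP ve_closed] wdim_vproj[OF b])
  finally have "agg (\<lambda>v. int (cartan c v)) = (\<psi> ^^ Suc i) (agg (\<lambda>v. int (cartan b v)))"
    using \<psi>[OF cartan_coxeter[OF c(1)]] by simp
  then show ?thesis using c(1) by metis
qed

end

section \<open>Periodicity on a rank three lattice\<close>

text \<open>
  \<open>star_coxeter\<close> is the inverse Coxeter transformation of a semi-regular star algebra, on
  dimension vectors summed over the \<open>x\<^sub>i\<close> and over the \<open>y\<^sub>j\<close>. With \<open>t = 2 - N\<close>, where \<open>N\<close> is the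
  number to be bounded, its characteristic polynomial is \<open>(X - 1) (X\<^sup>2 - t X + 1)\<close>.
\<close>

definition star_coxeter :: "int \<Rightarrow> int \<Rightarrow> int \<Rightarrow> int \<Rightarrow> int \<times> int \<times> int \<Rightarrow> int \<times> int \<times> int" where
  "star_coxeter r s S1 S2 = (\<lambda>(x, z, y).
     let m = x - r * (z - y) - S2 * y in (m, m + (z - y), y + s * (z - y) + S1 * m))"

text \<open>
  \<open>\<psi>\<close> permutes the finite set \<open>F\<close> of orbit points. The increments \<open>d\<close> of \<open>x - z\<close> along \<open>\<psi>\<close> satisfy
  \<open>d (\<psi> (\<psi> v)) + d v = t d (\<psi> v)\<close>; multiplying by \<open>d (\<psi> v)\<close> and summing over \<open>F\<close> bounds \<open>t\<close>.
\<close>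

lemma finite_orbit_bound:
  fixes r s S1 S2 :: int and B :: "(int \<times> int \<times> int) set"
  defines "\<psi> \<equiv> star_coxeter r s S1 S2"
  assumes bal: "r * S1 = s * S2" and B: "finite B" "(0, 0, 1) \<in> B"
    and orb: "\<And>u. u \<in> B \<Longrightarrow> \<exists>i. (\<psi> ^^ Suc i) u \<in> B"
  shows "S1 * S2 + r + s - r * S1 \<in> {1, 2, 3, 4}"
proof -
  obtain n where n: "\<And>u. u \<in> B \<Longrightarrow> (\<psi> ^^ Suc (n u)) u \<in> B" using orb by metis
  \<comment> \<open>Each point of B is followed up to a positive return time to B, so F is finite
    and \<psi> maps it to itself.\<close>
  define F where "F = (\<Union>u\<in>B. (\<lambda>k. (\<psi> ^^ k) u) ` {..n u})"
  have finF: "finite F" unfolding F_def using B(1) by auto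
  have BF: "u \<in> F" if "u \<in> B" for u unfolding F_def using that by (auto intro!: bexI[of _ u] image_eqI[of _ _ 0])
  have closed: "\<psi> v \<in> F" if v: "v \<in> F" for v
  proof -
    obtain u k where u: "u \<in> B" "k \<le> n u" "v = (\<psi> ^^ k) u" using v unfolding F_def by auto
    show ?thesis
    proof (cases "k = n u")
      case True
      then have "\<psi> v \<in> B" using n[OF u(1)] u(3) by simp
      then show ?thesis by (rule BF)
    next
      case False
      then have "Suc k \<le> n u" using u(2) by simp
      moreover have "\<psi> v = (\<psi> ^^ Suc k) u" using u(3) by simp
      ultimately show ?thesis unfolding F_def using u(1) by blast
    qed
  qed
  have "inj \<psi>"
  proof (rule injI)
    fix u v assume e: "\<psi> u = \<psi> v"
    obtain a b c where u: "u = (a, b, c)" by (cases u)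
    obtain a' b' c' where v: "v = (a', b', c')" by (cases v)
    let ?m = "a - r * (b - c) - S2 * c" and ?m' = "a' - r * (b' - c') - S2 * c'"
    have e': "?m = ?m' \<and> ?m + (b - c) = ?m' + (b' - c') \<and>
        c + s * (b - c) + S1 * ?m = c' + s * (b' - c') + S1 * ?m'"
      using e unfolding \<psi>_def star_coxeter_def u v Let_def prod.case prod.inject .
    note 1 = e'[THEN conjunct1] and 2 = e'[THEN conjunct2, THEN conjunct1]
      and 3 = e'[THEN conjunct2, THEN conjunct2]
    have d: "b - c = b' - c'" using 1 2 by simp
    have "c' + s * (b' - c') + S1 * ?m' = c' + s * (b - c) + S1 * ?m"
      by (simp only: d 1[unfolded d])
    with 3 have "c + s * (b - c) + S1 * ?m = c' + s * (b - c) + S1 * ?m" by (rule trans)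
    then have "c = c'" unfolding add_right_cancel .
    moreover have "b = b'" using d calculation by simp
    moreover have "a = a'" using 1 calculation by simp
    ultimately show "u = v" unfolding u v by simp
  qed
  then have bij: "bij_betw \<psi> F F"
    using finF closed by (metis bij_betw_def endo_inj_surj image_subsetI inj_on_subset subset_UNIV)
  have inv: "(\<Sum>v\<in>F. g (\<psi> v)) = (\<Sum>v\<in>F. g v)" for g :: "int \<times> int \<times> int \<Rightarrow> int"
    by (rule sum.reindex_bij_betw[OF bij])
  define c where "c = (\<lambda>(x :: int, z :: int, y :: int). x - z)"
  define d where "d v = c (\<psi> v) - c v" for v
  define t where "t = 2 - (S1 * S2 + r + s - r * S1)"
  \<comment> \<open>This is Cayley-Hamilton for the linear form c: taking increments absorbs the
    factor X - 1 and leaves X^2 - t X + 1.\<close>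
  have rec: "d (\<psi> (\<psi> v)) + d v = t * d (\<psi> v)" for v
  proof -
    obtain x z y where v: "v = (x, z, y)" by (cases v)
    define q where "q = z - y"
    define m where "m = x - r * q - S2 * y"
    define y' where "y' = y + s * q + S1 * m"
    define q' where "q' = m + q - y'"
    define m' where "m' = m - r * q' - S2 * y'"
    have p1: "\<psi> v = (m, m + q, y')"
      unfolding \<psi>_def star_coxeter_def v Let_def prod.case q_def m_def y'_def ..
    have p2: "\<psi> (m, m + q, y') = (m', m' + q', y' + s * q' + S1 * m')"
      unfolding \<psi>_def star_coxeter_def Let_def prod.case q'_def m'_def ..
    have "d v = y - x" unfolding d_def p1 by (simp add: c_def v q_def)
    moreover have "d (\<psi> v) = y' - m"
      unfolding p1 d_def p2 c_def by (simp add: q'_def)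
    moreover have "d (\<psi> (\<psi> v)) = y' + s * q' + S1 * m' - m'"
    proof -
      have "c (\<psi> (m', m' + q', y' + s * q' + S1 * m')) = y' + s * q' + S1 * m' - (m' + q')"
        unfolding \<psi>_def star_coxeter_def Let_def prod.case c_def by simp
      then show ?thesis unfolding p1 p2 d_def by (simp add: c_def)
    qed
    \<comment> \<open>The defect of the recursion is a multiple of \<open>s * S2 - r * S1\<close>,
      so the balance of degrees is needed here.\<close>
    moreover have "y' + s * q' + S1 * m' - m' + (y - x) - t * (y' - m) = (s * S2 - r * S1) * q"
      unfolding t_def m'_def q'_def y'_def m_def by (simp add: algebra_simps)
    ultimately show ?thesis using bal by simp
  qed
  define D where "D = (\<Sum>v\<in>F. d v * d v)"
  define E where "E = (\<Sum>v\<in>F. d v * d (\<psi> v))"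
  have d1: "d (0, 0, 1) = 1" unfolding d_def c_def \<psi>_def star_coxeter_def by (simp add: Let_def)
  have "D \<ge> (\<Sum>v\<in>{(0, 0, 1)}. d v * d v)"
    unfolding D_def using BF[OF B(2)] finF by (intro sum_mono2) auto
  then have Dpos: "D \<ge> 1" using d1 by simp
  have "t * D = (\<Sum>v\<in>F. t * d (\<psi> v) * d (\<psi> v))"
    unfolding D_def inv[of "\<lambda>v. d v * d v", symmetric] by (simp add: sum_distrib_left mult.assoc)
  also have "\<dots> = (\<Sum>v\<in>F. d (\<psi> v) * d (\<psi> (\<psi> v))) + (\<Sum>v\<in>F. d v * d (\<psi> v))"
    unfolding rec[symmetric] by (simp add: sum.distrib[symmetric] algebra_simps)
  also have "\<dots> = 2 * E" unfolding inv[of "\<lambda>v. d v * d (\<psi> v)"] E_def by simp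
  finally have tD: "t * D = 2 * E" .
  \<comment> \<open>As 2 E = t D, the sums of squares of d (\<psi> v) - d v and of d (\<psi> v) + d
    v are (2 - t) D and (2 + t) D. With D positive, t lies between -2 and 2.\<close>
  have "(\<Sum>v\<in>F. (d (\<psi> v) - d v)\<^sup>2) = (\<Sum>v\<in>F. d (\<psi> v) * d (\<psi> v)) + D - 2 * E"
    unfolding D_def E_def
    by (simp add: power2_eq_square algebra_simps sum.distrib sum_subtractf sum_distrib_left)
  then have minus: "(\<Sum>v\<in>F. (d (\<psi> v) - d v)\<^sup>2) = (2 - t) * D"
    unfolding inv[of "\<lambda>v. d v * d v"] using tD by (simp add: D_def algebra_simps)
  have "(\<Sum>v\<in>F. (d (\<psi> v) + d v)\<^sup>2) = (\<Sum>v\<in>F. d (\<psi> v) * d (\<psi> v)) + D + 2 * E"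
    unfolding D_def E_def
    by (simp add: power2_eq_square algebra_simps sum.distrib sum_distrib_left)
  then have plus: "(\<Sum>v\<in>F. (d (\<psi> v) + d v)\<^sup>2) = (2 + t) * D"
    unfolding inv[of "\<lambda>v. d v * d v"] using tD by (simp add: D_def algebra_simps)
  have "(2 - t) * D \<ge> 0" "(2 + t) * D \<ge> 0"
    unfolding minus[symmetric] plus[symmetric] by (rule sum_nonneg, simp)+
  then have t2: "t \<le> 2" "- 2 \<le> t" using Dpos by (auto simp: zero_le_mult_iff)
  have "t \<noteq> 2"
  proof
    assume "t = 2"
    then have "(\<Sum>v\<in>F. (d (\<psi> v) - d v)\<^sup>2) = 0" using minus by simp
    then have eq: "d (\<psi> v) = d v" if "v \<in> F" for v using that finF by (simp add: sum_nonneg_eq_0_iff)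
    \<comment> \<open>For t = 2 the increments d are constant along orbits, so c would grow linearly
      on a finite set. Invariance of the sums under \<psi> turns this into D = 0.\<close>
    have "D = (\<Sum>v\<in>F. d v * c (\<psi> v)) - (\<Sum>v\<in>F. d v * c v)"
      unfolding D_def sum_subtractf[symmetric] by (intro sum.cong) (auto simp: d_def algebra_simps)
    also have "(\<Sum>v\<in>F. d v * c (\<psi> v)) = (\<Sum>v\<in>F. d (\<psi> v) * c (\<psi> v))" using eq by simp
    also have "\<dots> = (\<Sum>v\<in>F. d v * c v)" by (rule inv)
    finally show False using Dpos by simp
  qed
  then show ?thesis using t2 unfolding t_def by auto
qed

section \<open>Star algebras\<close>

locale star_bound =
  fixes r s :: nat and I :: "((star_vertex, star_arrow) qpath \<Rightarrow> 'k::field) set"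
  assumes adm: "admissible_ideal (star_quiver r s) I"
begin

section \<open>Paths of the star quiver and products in its path algebra\<close>

abbreviation G where "G \<equiv> star_quiver r s"

abbreviation PA :: "('k, (star_vertex, star_arrow) qpath \<Rightarrow> 'k) module" where
  "PA \<equiv> path_algebra G"

sublocale Id: ideal I PA
  using adm unfolding admissible_ideal_def by (rule conjunct1)

text \<open>The end vertex, computed along any list of arrows, so that \<open>pend_append\<close>
  needs no side condition on composability.\<close>

definition pend :: "(star_vertex, star_arrow) qpath \<Rightarrow> star_vertex" where
  "pend p = last (pre_digraph.awalk_verts G (fst p) (snd p))"

lemma pend_simps [simp]: "pend (u, []) = u" "pend (u, e # es) = pend (head G e, es)"
  by (simp_all add: pend_def pre_digraph.awalk_verts.simps pre_digraph.awalk_verts_non_Nil)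

lemma pend_append: "pend (u, p @ q) = pend (pend (u, p), q)"
  by (induction p arbitrary: u) simp_all

lemma star_simps [simp]:
  "verts G = Vx ` {1..r} \<union> {Vz} \<union> Vy ` {1..s}"
  "arcs G = Arr_a ` {1..r} \<union> Arr_b ` {1..s}"
  "tail G (Arr_a i) = Vx i" "tail G (Arr_b j) = Vz"
  "head G (Arr_a i) = Vz" "head G (Arr_b j) = Vy j"
  by (simp_all add: star_quiver_def)

text \<open>Arrows a_i start at sources and arrows b_j end at sinks, so an a_i can only come first
  and a b_j only last. No path has three arrows.\<close>

lemma qpaths_iff:
  "(u, p) \<in> qpaths G \<longleftrightarrow> (u \<in> verts G \<and> p = []) \<or> (\<exists>i\<in>{1..r}. u = Vx i \<and> p = [Arr_a i]) \<or>
     (\<exists>j\<in>{1..s}. u = Vz \<and> p = [Arr_b j]) \<or>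
     (\<exists>i\<in>{1..r}. \<exists>j\<in>{1..s}. u = Vx i \<and> p = [Arr_a i, Arr_b j])"
proof -
  have w: "(u, p) \<in> qpaths G \<longleftrightarrow> u \<in> verts G \<and> set p \<subseteq> arcs G \<and> (\<exists>v. pre_digraph.cas G u p v)"
    unfolding qpaths_def pre_digraph.awalk_def by auto
  consider "p = []" | e where "p = [e]" | e e' where "p = [e, e']"
    | e e' e'' es where "p = e # e' # e'' # es"
    by (metis list.exhaust)
  then show ?thesis
  proof cases
    case 1
    moreover have "pre_digraph.cas G u [] u" by (simp add: pre_digraph.cas.simps)
    ultimately show ?thesis unfolding w by auto
  next
    case (2 e)
    then show ?thesis unfolding w by (cases e) (auto simp: pre_digraph.cas.simps)
  next
    case (3 e e')
    then show ?thesis unfolding w by (cases e; cases e') (auto simp: pre_digraph.cas.simps)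
  next
    case (4 e e' e'' es)
    then show ?thesis unfolding w by (cases e; cases e'; cases e'') (auto simp: pre_digraph.cas.simps)
  qed
qed

lemma qpaths_finite: "finite (qpaths G)"
proof -
  have "qpaths G \<subseteq> (\<lambda>v. (v, [])) ` verts G \<union> (\<lambda>i. (Vx i, [Arr_a i])) ` {1..r} \<union>
      (\<lambda>j. (Vz, [Arr_b j])) ` {1..s} \<union> (\<lambda>(i, j). (Vx i, [Arr_a i, Arr_b j])) ` ({1..r} \<times> {1..s})"
    by (auto simp: qpaths_iff)
  then show ?thesis by (rule finite_subset) auto
qed

lemma PA_simps:
  "mult PA = path_mult G" "add PA = (+)" "zero PA = 0" "smult PA = fscale"
  "one PA = (\<lambda>(u, p). if u \<in> verts G \<and> p = [] then 1 else 0)"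
  by (simp_all only: path_algebra_def module.simps ring.simps monoid.simps)

lemma PA_carrier: "f \<in> carrier PA \<longleftrightarrow> (\<forall>x. f x \<noteq> 0 \<longrightarrow> x \<in> qpaths G)"
proof -
  have "f \<in> carrier PA \<longleftrightarrow> finite {p. f p \<noteq> 0} \<and> {p. f p \<noteq> 0} \<subseteq> qpaths G"
    by (simp add: path_algebra_def)
  also have "\<dots> \<longleftrightarrow> {p. f p \<noteq> 0} \<subseteq> qpaths G" using qpaths_finite finite_subset by blast
  finally show ?thesis by blast
qed

lemma path_mult_apply:
  "path_mult G f g (u, w) = (\<Sum>k\<le>length w. f (u, take k w) * g (pend (u, take k w), drop k w))"
  by (simp add: path_mult_def pend_def)

text \<open>The combination of trivial paths with weights a. Multiplication by it rescales each path
  by the weight of its start or end: constant weights give scalars, indicator weights cut out paths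
  with a given end point.\<close>

definition vertex_fun :: "(star_vertex \<Rightarrow> 'k) \<Rightarrow> (star_vertex, star_arrow) qpath \<Rightarrow> 'k" where
  "vertex_fun a = (\<lambda>(u, p). if u \<in> verts G \<and> p = [] then a u else 0)"

lemma vertex_fun_carrier: "vertex_fun a \<in> carrier PA"
  unfolding PA_carrier by (auto simp: vertex_fun_def qpaths_iff split: if_splits)

lemma vertex_fun_mult_left:
  assumes "f \<in> carrier PA"
  shows "path_mult G (vertex_fun a) f (u, w) = a u * f (u, w)"
proof -
  have "path_mult G (vertex_fun a) f (u, w) = (\<Sum>k\<in>{0}. vertex_fun a (u, take k w) * f (pend (u, take k w), drop k w))"
    unfolding path_mult_apply by (rule sum.mono_neutral_right) (auto simp: vertex_fun_def)
  also have "\<dots> = a u * f (u, w)"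
  proof (cases "u \<in> verts G")
    case True
    then show ?thesis by (simp add: vertex_fun_def)
  next
    case False
    then have "f (u, w) = 0" using assms unfolding PA_carrier by (auto simp: qpaths_iff)
    then show ?thesis by simp
  qed
  finally show ?thesis .
qed

lemma pend_verts: "(u, w) \<in> qpaths G \<Longrightarrow> pend (u, w) \<in> verts G"
  by (auto simp: qpaths_iff)

lemma vertex_fun_mult_right:
  assumes "f \<in> carrier PA"
  shows "path_mult G f (vertex_fun a) (u, w) = f (u, w) * a (pend (u, w))"
proof -
  have "path_mult G f (vertex_fun a) (u, w) =
      (\<Sum>k\<in>{length w}. f (u, take k w) * vertex_fun a (pend (u, take k w), drop k w))"
    unfolding path_mult_apply by (rule sum.mono_neutral_right) (auto simp: vertex_fun_def)
  also have "\<dots> = f (u, w) * a (pend (u, w))"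
  proof (cases "f (u, w) = 0")
    case False
    then have "pend (u, w) \<in> verts G" using assms pend_verts unfolding PA_carrier by blast
    then show ?thesis by (simp add: vertex_fun_def)
  qed simp
  finally show ?thesis .
qed

section \<open>The admissible ideal\<close>

lemma path_elem_carrier: "x \<in> qpaths G \<Longrightarrow> path_elem x \<in> carrier PA"
  unfolding PA_carrier by (simp add: path_elem_def)

text \<open>An ideal is only closed under ring multiplication; scaling by c is multiplication by c
  times the unit.\<close>

lemma ideal_scale:
  assumes "f \<in> I" shows "fscale c f \<in> I"
proof -
  have f: "f \<in> carrier PA" by (rule Id.Icarr[OF assms])
  have "vertex_fun (\<lambda>_. c) \<otimes>\<^bsub>PA\<^esub> f \<in> I" by (rule Id.I_l_closed[OF assms vertex_fun_carrier])
  also have "vertex_fun (\<lambda>_. c) \<otimes>\<^bsub>PA\<^esub> f = fscale c f"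
  proof
    fix x show "(vertex_fun (\<lambda>_. c) \<otimes>\<^bsub>PA\<^esub> f) x = fscale c f x"
      unfolding PA_simps(1) by (cases x) (simp add: vertex_fun_mult_left[OF f] fscale_apply)
  qed
  finally show ?thesis .
qed

text \<open>The elements without components at trivial paths form an ideal containing the arrow
  ideal. A product of two such elements has no component of length at most 1, and I lies in the
  square of the arrow ideal.\<close>

lemma ideal_short_path:
  assumes f: "f \<in> I" and p: "length p \<le> 1"
  shows "f (u, p) = 0"
proof -
  let ?J = "{f \<in> carrier PA. \<forall>u. f (u, []) = 0}"
  have inv: "(\<ominus>\<^bsub>PA\<^esub> g) x = - g x" if "g \<in> carrier PA" for g x
  proof -
    have "(\<ominus>\<^bsub>PA\<^esub> g) + g = 0" using Id.l_neg[OF that] unfolding PA_simps .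
    then have "((\<ominus>\<^bsub>PA\<^esub> g) + g) x = 0" by simp
    then show ?thesis by (simp add: eq_neg_iff_add_eq_0)
  qed
  have Jid: "ideal ?J PA"
  proof (rule idealI)
    show "ring PA" by (rule Id.ring_axioms)
    show "subgroup ?J (add_monoid PA)"
    proof (rule subgroup.intro)
      show "?J \<subseteq> carrier (add_monoid PA)" by auto
      fix g h assume g: "g \<in> ?J" and h: "h \<in> ?J"
      have "g \<oplus>\<^bsub>PA\<^esub> h \<in> carrier PA" using g h by (intro Id.a_closed) auto
      then show "g \<otimes>\<^bsub>add_monoid PA\<^esub> h \<in> ?J" using g h by (simp add: PA_simps)
    next
      have "\<zero>\<^bsub>PA\<^esub> \<in> carrier PA" by simp
      then show "\<one>\<^bsub>add_monoid PA\<^esub> \<in> ?J" by (simp add: PA_simps)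
    next
      fix g assume g: "g \<in> ?J"
      have "\<ominus>\<^bsub>PA\<^esub> g \<in> carrier PA" using g by simp
      then show "inv\<^bsub>add_monoid PA\<^esub> g \<in> ?J" using g inv by (simp add: a_inv_def[symmetric])
    qed
    fix g x assume g: "g \<in> ?J" and x: "x \<in> carrier PA"
    have "x \<otimes>\<^bsub>PA\<^esub> g \<in> carrier PA" "g \<otimes>\<^bsub>PA\<^esub> x \<in> carrier PA" using g x by auto
    then show "x \<otimes>\<^bsub>PA\<^esub> g \<in> ?J" "g \<otimes>\<^bsub>PA\<^esub> x \<in> ?J"
      using g by (simp_all add: PA_simps path_mult_apply)
  qed
  have J: "arrow_ideal G \<subseteq> ?J"
    unfolding arrow_ideal_def
  proof (rule Id.genideal_minimal[OF Jid], rule subsetI)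
    fix h :: "(star_vertex, star_arrow) qpath \<Rightarrow> 'k"
    assume "h \<in> {path_elem (tail G e, [e]) |e. e \<in> arcs G}"
    then obtain e where e: "h = path_elem (tail G e, [e])" "e \<in> arcs G" by blast
    have "(tail G e, [e]) \<in> qpaths G" using e(2) by (auto simp: qpaths_iff)
    then show "h \<in> ?J" unfolding e(1) using path_elem_carrier by (simp add: path_elem_def)
  qed
  have "f \<in> arrow_ideal G [^]\<^bsub>ideals_set PA\<^esub> (2::nat)"
    using f adm unfolding admissible_ideal_def by blast
  \<comment> \<open>The power starts from the unit ideal, so the square is a product of three
    ideals, and the left factor needs an induction of its own.\<close>
  then have "f \<in> ideal_prod PA (ideal_prod PA (carrier PA) (arrow_ideal G)) (arrow_ideal G)"
    by (simp add: ideals_set_def nat_pow_def numeral_2_eq_2)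
  then show ?thesis
    using p
  proof (induction f rule: ideal_prod.induct)
    case (prod g h)
    have "g' \<in> ?J" if "g' \<in> ideal_prod PA (carrier PA) (arrow_ideal G)" for g'
      using that
    proof (induction g' rule: ideal_prod.induct)
      case (prod a b)
      then show ?case using ideal.I_l_closed[OF Jid] J by blast
    next
      case (sum a b)
      then show ?case using additive_subgroup.a_closed[OF ideal.axioms(1)[OF Jid]] by blast
    qed
    then have g: "g \<in> ?J" and h: "h \<in> ?J" using prod J by auto
    consider "p = []" | e where "p = [e]" using prod.prems by (cases p) auto
    then show ?case
    proof cases
      case 1
      then show ?thesis using g by (simp add: PA_simps path_mult_apply)
    next
      case (2 e)
      then show ?thesis using g h by (simp add: PA_simps path_mult_apply)
    qed
  next
    case (sum g h)
    then show ?case by (simp add: PA_simps)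
  qed
qed

definition Q :: "(star_vertex, star_arrow) qpath set" where
  "Q = {x \<in> qpaths G. path_elem x \<notin> I}"

definition linked :: "nat \<Rightarrow> nat \<Rightarrow> bool" where
  "linked i j \<longleftrightarrow> path_elem (Vx i, [Arr_a i, Arr_b j]) \<notin> I"

lemma Q_iff:
  "(u, p) \<in> Q \<longleftrightarrow> (u \<in> verts G \<and> p = []) \<or> (\<exists>i\<in>{1..r}. u = Vx i \<and> p = [Arr_a i]) \<or>
     (\<exists>j\<in>{1..s}. u = Vz \<and> p = [Arr_b j]) \<or>
     (\<exists>i\<in>{1..r}. \<exists>j\<in>{1..s}. linked i j \<and> u = Vx i \<and> p = [Arr_a i, Arr_b j])"
proof -
  have "path_elem (u, p) \<notin> I" if "length p \<le> 1"
    using ideal_short_path[OF _ that, of "path_elem (u, p)" u] by (auto simp: path_elem_def)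
  then show ?thesis unfolding Q_def linked_def using qpaths_iff[of u p] by (cases "length p \<le> 1") auto
qed

lemma Q_finite: "finite Q"
  unfolding Q_def using qpaths_finite by simp

text \<open>
  An admissible ideal is spanned by the paths it contains: there is at most one path of length two
  between two given vertices, so it is cut out of an element by the two trivial paths.
\<close>

lemma ideal_vanish:
  assumes f: "f \<in> I" and x: "x \<in> Q"
  shows "f x = 0"
proof (rule ccontr)
  assume nz: "f x \<noteq> 0"
  obtain u p where up: "x = (u, p)" by (cases x)
  have "length p > 1" using ideal_short_path[OF f, of p u] nz up by (cases "length p \<le> 1") auto
  then obtain i j where ij: "u = Vx i" "p = [Arr_a i, Arr_b j]" using x unfolding up Q_iff by auto
  have fc: "f \<in> carrier PA" by (rule Id.Icarr[OF f])
  \<comment> \<open>The left factor cuts out the paths starting at x_i and also divides by the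
    coefficient f x.\<close>
  let ?l = "vertex_fun (\<lambda>v. if v = Vx i then inverse (f x) else 0)"
  let ?r = "vertex_fun (\<lambda>v. if v = Vy j then 1 else 0)"
  have lf: "?l \<otimes>\<^bsub>PA\<^esub> f \<in> I" by (rule Id.I_l_closed[OF f vertex_fun_carrier])
  have lfr: "(?l \<otimes>\<^bsub>PA\<^esub> f) \<otimes>\<^bsub>PA\<^esub> ?r \<in> I" by (rule Id.I_r_closed[OF lf vertex_fun_carrier])
  have "((?l \<otimes>\<^bsub>PA\<^esub> f) \<otimes>\<^bsub>PA\<^esub> ?r) y = path_elem x y" for y
  proof -
    obtain v w where y: "y = (v, w)" by (cases y)
    have "((?l \<otimes>\<^bsub>PA\<^esub> f) \<otimes>\<^bsub>PA\<^esub> ?r) y =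
        (if v = Vx i then inverse (f x) else 0) * f (v, w) * (if pend (v, w) = Vy j then 1 else 0)"
      using Id.Icarr[OF lf] unfolding PA_simps y
      by (subst vertex_fun_mult_right) (simp_all add: vertex_fun_mult_left[OF fc])
    also have "\<dots> = path_elem x y"
    proof (cases "v = Vx i \<and> pend (v, w) = Vy j \<and> f (v, w) \<noteq> 0")
      case True
      then have "(v, w) \<in> qpaths G" using fc unfolding PA_carrier by blast
      then have "w = p" using True ij by (auto simp: qpaths_iff)
      then show ?thesis using True ij nz up y by (simp add: path_elem_def)
    next
      case False
      then have "y \<noteq> x" using nz up ij y by auto
      then show ?thesis using False by (auto simp: path_elem_def)
    qed
    finally show ?thesis .
  qed
  then have "(?l \<otimes>\<^bsub>PA\<^esub> f) \<otimes>\<^bsub>PA\<^esub> ?r = path_elem x" by (rule ext)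
  then show False using lfr x unfolding Q_def by simp
qed

text \<open>An element without components in Q is a combination of paths that belong to I. Together
  with \<open>ideal_vanish\<close> this makes Q a basis of the quotient.\<close>

lemma ideal_mem:
  assumes f: "f \<in> carrier PA" and z: "\<And>x. x \<in> Q \<Longrightarrow> f x = 0"
  shows "f \<in> I"
proof -
  let ?S = "qpaths G - Q"
  have "(\<Sum>x\<in>S. fscale (f x) (path_elem x)) \<in> I" if "finite S" "S \<subseteq> ?S" for S
    using that
  proof (induction S rule: finite_induct)
    case empty
    then show ?case using additive_subgroup.zero_closed[OF Id.additive_subgroup_axioms] by (simp only: PA_simps sum.empty)
  next
    case (insert x S)
    have "fscale (f x) (path_elem x) \<in> I" using insert.prems by (intro ideal_scale) (auto simp: Q_def)
    moreover have "(\<Sum>x\<in>S. fscale (f x) (path_elem x)) \<in> I"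
      by (rule insert.IH) (use insert.prems in simp)
    ultimately have "fscale (f x) (path_elem x) \<oplus>\<^bsub>PA\<^esub> (\<Sum>x\<in>S. fscale (f x) (path_elem x)) \<in> I"
      by (rule additive_subgroup.a_closed[OF Id.additive_subgroup_axioms])
    then show ?case unfolding sum.insert[OF insert.hyps] PA_simps .
  qed
  from this[OF finite_Diff[OF qpaths_finite] order_refl]
  have "(\<Sum>x\<in>?S. fscale (f x) (path_elem x)) \<in> I" .
  also have "(\<Sum>x\<in>?S. fscale (f x) (path_elem x)) = f"
  proof
    fix y
    have "(\<Sum>x\<in>?S. fscale (f x) (path_elem x)) y = (\<Sum>x\<in>?S. if x = y then f x else 0)"
      unfolding sum_fun_apply fscale_apply by (intro sum.cong) (auto simp: path_elem_def)
    also have "\<dots> = (if y \<in> ?S then f y else 0)" using qpaths_finite by simp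
    also have "\<dots> = f y" using z[of y] f unfolding PA_carrier by (cases y) auto
    finally show "(\<Sum>x\<in>?S. fscale (f x) (path_elem x)) y = f y" .
  qed
  finally show ?thesis .
qed

section \<open>The quotient algebra and its basis of nonzero paths\<close>

abbreviation \<Lambda> :: "('k, ((star_vertex, star_arrow) qpath \<Rightarrow> 'k) set) module" where
  "\<Lambda> \<equiv> bound_quiver_algebra G I"

abbreviation cls :: "((star_vertex, star_arrow) qpath \<Rightarrow> 'k) \<Rightarrow> ((star_vertex, star_arrow) qpath \<Rightarrow> 'k) set" where
  "cls f \<equiv> I +>\<^bsub>PA\<^esub> f"

text \<open>The coefficient is read off from an arbitrary representative; by
  \<open>ideal_vanish\<close> the choice does not matter for x in Q.\<close>

definition coef :: "(star_vertex, star_arrow) qpath \<Rightarrow> ((star_vertex, star_arrow) qpath \<Rightarrow> 'k) set \<Rightarrow> 'k" where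
  "coef x C = (SOME f. f \<in> C) x"

lemma cls_mem: "g \<in> cls f \<longleftrightarrow> (\<exists>h\<in>I. g = h + f)"
  unfolding a_r_coset_def' PA_simps by auto

lemma coef_cls:
  assumes f: "f \<in> carrier PA" and x: "x \<in> Q"
  shows "coef x (cls f) = f x"
proof -
  have "f \<in> cls f" by (rule Id.a_rcos_self[OF f])
  then have "(SOME g. g \<in> cls f) \<in> cls f" by (rule someI[of "\<lambda>g. g \<in> cls f"])
  then obtain h where h: "h \<in> I" "(SOME g. g \<in> cls f) = h + f"
    unfolding cls_mem by (elim bexE)
  show ?thesis unfolding coef_def h(2) using ideal_vanish[OF h(1) x] by simp
qed

lemma cls_eqI:
  assumes f: "f \<in> carrier PA" and g: "g \<in> cls f"
  shows "cls g = cls f"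
  by (rule Id.a_repr_independence[OF g f Id.a_subgroup, symmetric])

lemma Lambda_simps:
  "carrier \<Lambda> = cls ` carrier PA" "mult \<Lambda> = rcoset_mult PA I" "add \<Lambda> = set_add PA"
  "one \<Lambda> = cls \<one>\<^bsub>PA\<^esub>" "smult \<Lambda> = (\<lambda>c C. \<Union>x\<in>C. cls (fscale c x))"
  unfolding bound_quiver_algebra_def Let_def FactRing_def A_RCOSETS_def' by auto

lemma Lambda_mult: "f \<in> carrier PA \<Longrightarrow> g \<in> carrier PA \<Longrightarrow> cls f \<otimes>\<^bsub>\<Lambda>\<^esub> cls g = cls (f \<otimes>\<^bsub>PA\<^esub> g)"
  unfolding Lambda_simps by (rule Id.rcoset_mult_add)

lemma Lambda_add: "f \<in> carrier PA \<Longrightarrow> g \<in> carrier PA \<Longrightarrow> cls f \<oplus>\<^bsub>\<Lambda>\<^esub> cls g = cls (f \<oplus>\<^bsub>PA\<^esub> g)"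
  unfolding Lambda_simps by (rule Id.a_rcos_sum)

lemma fscale_carrier: "f \<in> carrier PA \<Longrightarrow> fscale c f \<in> carrier PA"
  unfolding PA_carrier by (simp add: fscale_apply)

lemma Lambda_smult: assumes f: "f \<in> carrier PA" shows "c \<odot>\<^bsub>\<Lambda>\<^esub> cls f = cls (fscale c f)"
proof -
  have "cls (fscale c g) = cls (fscale c f)" if g: "g \<in> cls f" for g
  proof (rule cls_eqI[OF fscale_carrier[OF f]])
    obtain h where h: "h \<in> I" "g = h + f" using g unfolding cls_mem by (elim bexE)
    have "fscale c g = fscale c h + fscale c f" unfolding h(2) by (rule fun_vs.scale_right_distrib)
    then show "fscale c g \<in> cls (fscale c f)" unfolding cls_mem by (rule bexI[OF _ ideal_scale[OF h(1)]])
  qed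
  moreover have "f \<in> cls f" by (rule Id.a_rcos_self[OF f])
  ultimately show ?thesis unfolding Lambda_simps by blast
qed

text \<open>Concatenation of paths, defined only when the result is nonzero in the quotient.\<close>

definition comp :: "(star_vertex, star_arrow) qpath \<Rightarrow> (star_vertex, star_arrow) qpath \<Rightarrow>
    (star_vertex, star_arrow) qpath \<Rightarrow> bool" where
  "comp p q x \<longleftrightarrow> p \<in> Q \<and> q \<in> Q \<and> x \<in> Q \<and> fst q = pend p \<and> x = (fst p, snd p @ snd q)"

lemma Q_subpaths:
  assumes "(u, p @ q) \<in> Q"
  shows "(u, p) \<in> Q" "(pend (u, p), q) \<in> Q"
  using assms by (auto simp: Q_iff append_eq_Cons_conv append_eq_append_conv2)

text \<open>The product in the path algebra sums over the positions at which the path x can be cut.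
  A cut corresponds to the pair of its pieces, and the pieces of a path in Q lie in Q.\<close>

lemma coef_mult_cls:
  assumes f: "f \<in> carrier PA" and g: "g \<in> carrier PA" and x: "x \<in> Q"
  shows "path_mult G f g x = (\<Sum>p\<in>Q. \<Sum>q\<in>Q. of_bool (comp p q x) * (f p * g q))"
proof -
  obtain u w where x': "x = (u, w)" by (cases x)
  let ?S = "{y \<in> Q \<times> Q. comp (fst y) (snd y) x}"
  have "path_mult G f g x = (\<Sum>y\<in>?S. f (fst y) * g (snd y))"
    unfolding x' path_mult_apply
  proof (rule sum.reindex_bij_witness[where i = "\<lambda>y. length (snd (fst y))"
        and j = "\<lambda>k. ((u, take k w), (pend (u, take k w), drop k w))"])
    fix k assume k: "k \<in> {..length w}"
    then show "length (snd (fst ((u, take k w), pend (u, take k w), drop k w))) = k" by simp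
    have "(u, take k w @ drop k w) \<in> Q" using x x' by simp
    from Q_subpaths[OF this]
    show "((u, take k w), pend (u, take k w), drop k w) \<in> {y \<in> Q \<times> Q. comp (fst y) (snd y) (u, w)}"
      using x x' by (simp add: comp_def)
  next
    fix y assume y: "y \<in> {y \<in> Q \<times> Q. comp (fst y) (snd y) (u, w)}"
    obtain a p b q where yy: "y = ((a, p), (b, q))" by (cases y) auto
    have c: "u = a" "w = p @ q" "b = pend (a, p)" using y yy by (auto simp: comp_def)
    show "length (snd (fst y)) \<in> {..length w}" unfolding yy c by simp
    show "((u, take (length (snd (fst y))) w), pend (u, take (length (snd (fst y))) w), drop (length (snd (fst y))) w) = y"
      unfolding yy c by simp
  qed simp
  also have "\<dots> = (\<Sum>y\<in>Q \<times> Q. of_bool (comp (fst y) (snd y) x) * (f (fst y) * g (snd y)))"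
    using Q_finite by (intro sum.mono_neutral_cong_left) auto
  also have "\<dots> = (\<Sum>p\<in>Q. \<Sum>q\<in>Q. of_bool (comp p q x) * (f p * g q))"
    unfolding sum.cartesian_product by (simp add: case_prod_beta)
  finally show ?thesis .
qed

lemma star_path_basis:
  assumes fd: "fd_algebra \<Lambda>"
  shows "path_basis \<Lambda> Q coef (\<lambda>x. cls (path_elem x)) (verts G) (\<lambda>v. (v, [])) fst pend comp (\<lambda>p. length (snd p))"
proof
  have QP: "x \<in> Q \<Longrightarrow> x \<in> qpaths G" for x by (simp add: Q_def)
  show "fd_algebra \<Lambda>" by (rule fd)
  show "finite Q" by (rule Q_finite)
  show "finite (verts G)" by simp
  show "cls (path_elem q) \<in> carrier \<Lambda>" if "q \<in> Q" for q
    unfolding Lambda_simps by (intro imageI path_elem_carrier QP that)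
  show "coef p (cls (path_elem q)) = of_bool (p = q)" if "p \<in> Q" "q \<in> Q" for p q
    unfolding coef_cls[OF path_elem_carrier[OF QP[OF that(2)]] that(1)] by (simp add: path_elem_def)
  show "coef q (a \<oplus>\<^bsub>\<Lambda>\<^esub> b) = coef q a + coef q b"
    if q: "q \<in> Q" and a: "a \<in> carrier \<Lambda>" and b: "b \<in> carrier \<Lambda>" for q a b
  proof -
    obtain f g where f: "f \<in> carrier PA" "a = cls f" and g: "g \<in> carrier PA" "b = cls g"
      using a b unfolding Lambda_simps by blast
    have "f \<oplus>\<^bsub>PA\<^esub> g \<in> carrier PA" by (rule Id.a_closed[OF f(1) g(1)])
    from coef_cls[OF this q] show ?thesis
      unfolding f(2) g(2) Lambda_add[OF f(1) g(1)] coef_cls[OF f(1) q] coef_cls[OF g(1) q]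
      by (simp add: PA_simps)
  qed
  show "coef q (c \<odot>\<^bsub>\<Lambda>\<^esub> a) = c * coef q a" if q: "q \<in> Q" and a: "a \<in> carrier \<Lambda>" for q c a
  proof -
    obtain f where f: "f \<in> carrier PA" "a = cls f" using a unfolding Lambda_simps by blast
    show ?thesis
      unfolding f(2) Lambda_smult[OF f(1)] coef_cls[OF f(1) q] coef_cls[OF fscale_carrier[OF f(1)] q]
      by (rule fscale_apply)
  qed
  show "coef x (a \<otimes>\<^bsub>\<Lambda>\<^esub> b) = (\<Sum>p\<in>Q. \<Sum>q\<in>Q. of_bool (comp p q x) * (coef p a * coef q b))"
    if x: "x \<in> Q" and a: "a \<in> carrier \<Lambda>" and b: "b \<in> carrier \<Lambda>" for x a b
  proof -
    obtain f g where f: "f \<in> carrier PA" "a = cls f" and g: "g \<in> carrier PA" "b = cls g"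
      using a b unfolding Lambda_simps by blast
    have "coef x (a \<otimes>\<^bsub>\<Lambda>\<^esub> b) = path_mult G f g x"
      using coef_cls[OF Id.m_closed[OF f(1) g(1)] x]
      unfolding f(2) g(2) Lambda_mult[OF f(1) g(1)] PA_simps .
    then show ?thesis
      unfolding coef_mult_cls[OF f(1) g(1) x] f(2) g(2)
      using coef_cls[OF f(1)] coef_cls[OF g(1)] by (simp cong: sum.cong)
  qed
  show "coef q \<one>\<^bsub>\<Lambda>\<^esub> = of_bool (q \<in> (\<lambda>v. (v, [])) ` verts G)" if q: "q \<in> Q" for q
  proof -
    have "coef q \<one>\<^bsub>\<Lambda>\<^esub> = \<one>\<^bsub>PA\<^esub> q"
      unfolding Lambda_simps by (rule coef_cls[OF Id.one_closed q])
    also have "\<dots> = of_bool (q \<in> (\<lambda>v. (v, [])) ` verts G)"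
      unfolding PA_simps by (cases q) (auto simp del: star_simps)
    finally show ?thesis .
  qed
  show "a = b" if a: "a \<in> carrier \<Lambda>" and b: "b \<in> carrier \<Lambda>" and e: "\<And>q. q \<in> Q \<Longrightarrow> coef q a = coef q b" for a b
  proof -
    obtain f g where f: "f \<in> carrier PA" "a = cls f" and g: "g \<in> carrier PA" "b = cls g"
      using a b unfolding Lambda_simps by blast
    have "f - g \<in> I"
    proof (rule ideal_mem)
      show "f - g \<in> carrier PA" using f(1) g(1) unfolding PA_carrier by (metis diff_zero minus_apply)
      show "(f - g) x = 0" if "x \<in> Q" for x
        using e[OF that] unfolding f(2) g(2) coef_cls[OF f(1) that] coef_cls[OF g(1) that] by simp
    qed
    then have "f \<in> cls g" unfolding cls_mem by (intro bexI[of _ "f - g"]) simp_all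
    then show ?thesis unfolding f(2) g(2) by (rule cls_eqI[OF g(1)])
  qed
  show "fst q \<in> verts G" "pend q \<in> verts G" if "q \<in> Q" for q
    using that by (cases q; auto simp: Q_iff)+
  show "(v, []) \<in> Q" "fst (v, [] :: star_arrow list) = v" "pend (v, []) = v" if "v \<in> verts G" for v
    using that by (simp_all add: Q_iff)
  show "p \<in> Q \<and> q \<in> Q \<and> x \<in> Q" if "comp p q x" for p q x
    using that unfolding comp_def by blast
  show "pend p = fst q \<and> fst x = fst p \<and> pend x = pend q" if "comp p q x" for p q x
    using that pend_append[of "fst p" "snd p" "snd q"] by (simp add: comp_def) (metis prod.collapse)
  show "length (snd x) = length (snd p) + length (snd q)" if "comp p q x" for p q x
    using that by (simp add: comp_def)
  show "x = x'" if "comp p q x" "comp p q x'" for p q x x'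
    using that by (simp add: comp_def)
  show "q = q'" if "comp p q x" "comp p q' x" for p q q' x
    using that by (simp add: comp_def prod_eq_iff)
  show "comp (fst q, []) q q" if "q \<in> Q" for q
    using that by (cases q) (auto simp: comp_def Q_iff)
  show "comp q (pend q, []) q" if "q \<in> Q" for q
    using that by (cases q) (auto simp: comp_def Q_iff)
  show "(\<exists>u. comp p q u \<and> comp u x y) \<longleftrightarrow> (\<exists>u. comp q x u \<and> comp p u y)" for p q x y
  proof
    assume "\<exists>u. comp p q u \<and> comp u x y"
    then obtain u where u: "comp p q u" "comp u x y" by blast
    have y: "y = (fst p, snd p @ snd q @ snd x)" "y \<in> Q" using u by (auto simp: comp_def)
    have "(pend p, snd q @ snd x) \<in> Q" using Q_subpaths(2)[of "fst p" "snd p" "snd q @ snd x"] y by simp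
    moreover have "fst q = pend p" "p \<in> Q" "q \<in> Q" "x \<in> Q" using u by (auto simp: comp_def)
    moreover have "fst x = pend q"
    proof -
      have "fst x = pend u" "u = (fst p, snd p @ snd q)" using u by (auto simp: comp_def)
      then show ?thesis using pend_append[of "fst p" "snd p" "snd q"] \<open>fst q = pend p\<close> by simp (metis prod.collapse)
    qed
    ultimately have "comp q x (fst q, snd q @ snd x) \<and> comp p (fst q, snd q @ snd x) y"
      using y by (simp add: comp_def)
    then show "\<exists>u. comp q x u \<and> comp p u y" by blast
  next
    assume "\<exists>u. comp q x u \<and> comp p u y"
    then obtain u where u: "comp q x u" "comp p u y" by blast
    have y: "y = (fst p, (snd p @ snd q) @ snd x)" "y \<in> Q" using u by (auto simp: comp_def)
    have e: "fst q = pend p" "p \<in> Q" "q \<in> Q" "x \<in> Q" "fst x = pend q" using u by (auto simp: comp_def)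
    have "(fst p, snd p @ snd q) \<in> Q" using Q_subpaths(1)[of "fst p" "snd p @ snd q" "snd x"] y by simp
    moreover have "pend (fst p, snd p @ snd q) = pend q"
      using pend_append[of "fst p" "snd p" "snd q"] e(1) by simp (metis prod.collapse)
    ultimately have "comp p q (fst p, snd p @ snd q) \<and> comp (fst p, snd p @ snd q) x y"
      using y e by (simp add: comp_def)
    then show "\<exists>u. comp p q u \<and> comp u x y" by blast
  qed
  show "q = (fst q, [])" if "q \<in> Q" "fst q = pend q" for q
    using that by (cases q) (auto simp: Q_iff)
  show "q = (fst q, [])" if "q \<in> Q" "length (snd q) = 0" for q
    using that by (cases q) auto
qed


section \<open>The Coxeter transformation of a semi-regular star algebra\<close>

lemma sum_verts:
  "(\<Sum>v\<in>verts G. g v) = (\<Sum>i\<in>{1..r}. g (Vx i)) + g Vz + (\<Sum>j\<in>{1..s}. g (Vy j) :: int)"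
proof -
  have "(\<Sum>v\<in>verts G. g v) = (\<Sum>v\<in>Vx ` {1..r} \<union> {Vz}. g v) + (\<Sum>v\<in>Vy ` {1..s}. g v)"
    unfolding star_simps by (rule sum.union_disjoint) auto
  also have "(\<Sum>v\<in>Vx ` {1..r} \<union> {Vz}. g v) = (\<Sum>v\<in>Vx ` {1..r}. g v) + (\<Sum>v\<in>{Vz}. g v)"
    by (rule sum.union_disjoint) auto
  finally show ?thesis by (simp add: sum.reindex inj_on_def)
qed

definition agg :: "(star_vertex \<Rightarrow> int) \<Rightarrow> int \<times> int \<times> int" where
  "agg y = (\<Sum>i\<in>{1..r}. y (Vx i), y Vz, \<Sum>j\<in>{1..s}. y (Vy j))"

theorem semi_regular_bound:
  assumes rf: "n_representation_finite 2 \<Lambda>" and s1: "s \<ge> 1"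
    and d1: "\<And>i. i \<in> {1..r} \<Longrightarrow> card {j \<in> {1..s}. linked i j} = S1"
    and d2: "\<And>j. j \<in> {1..s} \<Longrightarrow> card {i \<in> {1..r}. linked i j} = S2"
  shows "r * S1 = s * S2" "int S1 * int S2 + int r + int s - int r * int S1 \<in> {1, 2, 3, 4}"
proof -
  have "fd_algebra \<Lambda>" using rf unfolding n_representation_finite_def by (rule conjunct1)
  then interpret PB: path_basis \<Lambda> Q coef "\<lambda>x. cls (path_elem x)" "verts G" "\<lambda>v. (v, [])" fst pend comp
    "\<lambda>p. length (snd p)" by (rule star_path_basis)
  define L where "L i j = (of_bool (linked i j) :: int)" for i j
  have count: "(\<Sum>k\<in>A. of_bool (P k) :: int) = int (card {k \<in> A. P k})" if "finite A" for A and P :: "nat \<Rightarrow> bool"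
  proof -
    have "{k \<in> A. P k} = A \<inter> Collect P" by auto
    then show ?thesis using that by simp
  qed
  have L1: "(\<Sum>j\<in>{1..s}. L i j) = int S1" if "i \<in> {1..r}" for i
    unfolding L_def count[OF finite_atLeastAtMost] d1[OF that] ..
  have L2: "(\<Sum>i\<in>{1..r}. L i j) = int S2" if "j \<in> {1..s}" for j
    unfolding L_def count[OF finite_atLeastAtMost] d2[OF that] ..
  \<comment> \<open>The nonzero paths of length two are counted by their starts and by their
    ends.\<close>
  have "int (r * S1) = (\<Sum>i\<in>{1..r}. \<Sum>j\<in>{1..s}. L i j)" using L1 by simp
  also have "\<dots> = (\<Sum>j\<in>{1..s}. \<Sum>i\<in>{1..r}. L i j)" by (rule sum.swap)
  also have "\<dots> = int (s * S2)" using L2 by simp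
  finally have bal: "int (r * S1) = int (s * S2)" .
  then show "r * S1 = s * S2" unfolding of_nat_eq_iff .
  \<comment> \<open>In the order x, z, y the Cartan matrix is block upper triangular: identity
    blocks on the diagonal, ones between z and the other vertices, and L from the x_i to the
    y_j.\<close>
  note C = PB.cartan_def
  have Cxx: "PB.cartan (Vx i) (Vx i') = of_bool (i = i')" if "i \<in> {1..r}" "i' \<in> {1..r}" for i i'
  proof -
    have "{q \<in> Q. fst q = Vx i \<and> pend q = Vx i'} = (if i = i' then {(Vx i, [])} else {})"
      using that by (auto simp: Q_iff)
    then show ?thesis unfolding C by (simp only:) simp
  qed
  have Cxz: "PB.cartan (Vx i) Vz = 1" if "i \<in> {1..r}" for i
  proof -
    have "{q \<in> Q. fst q = Vx i \<and> pend q = Vz} = {(Vx i, [Arr_a i])}" using that by (auto simp: Q_iff)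
    then show ?thesis unfolding C by (simp only:) simp
  qed
  have Cxy: "int (PB.cartan (Vx i) (Vy j)) = L i j" if "i \<in> {1..r}" "j \<in> {1..s}" for i j
  proof -
    have "{q \<in> Q. fst q = Vx i \<and> pend q = Vy j} = (if linked i j then {(Vx i, [Arr_a i, Arr_b j])} else {})"
      using that by (auto simp: Q_iff)
    then show ?thesis unfolding C L_def by (simp only:) simp
  qed
  have Czx: "PB.cartan Vz (Vx i) = 0" for i
  proof -
    have "{q \<in> Q. fst q = Vz \<and> pend q = Vx i} = {}" by (auto simp: Q_iff)
    then show ?thesis unfolding C by (simp only:) simp
  qed
  have Czz: "PB.cartan Vz Vz = 1"
  proof -
    have "{q \<in> Q. fst q = Vz \<and> pend q = Vz} = {(Vz, [])}" by (auto simp: Q_iff)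
    then show ?thesis unfolding C by (simp only:) simp
  qed
  have Czy: "PB.cartan Vz (Vy j) = 1" if "j \<in> {1..s}" for j
  proof -
    have "{q \<in> Q. fst q = Vz \<and> pend q = Vy j} = {(Vz, [Arr_b j])}" using that by (auto simp: Q_iff)
    then show ?thesis unfolding C by (simp only:) simp
  qed
  have Cyx: "PB.cartan (Vy j) (Vx i) = 0" for i j
  proof -
    have "{q \<in> Q. fst q = Vy j \<and> pend q = Vx i} = {}" by (auto simp: Q_iff)
    then show ?thesis unfolding C by (simp only:) simp
  qed
  have Cyz: "PB.cartan (Vy j) Vz = 0" for j
  proof -
    have "{q \<in> Q. fst q = Vy j \<and> pend q = Vz} = {}" by (auto simp: Q_iff)
    then show ?thesis unfolding C by (simp only:) simp
  qed
  have Cyy: "PB.cartan (Vy j) (Vy j') = of_bool (j = j')" if "j \<in> {1..s}" for j j'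
  proof -
    have "{q \<in> Q. fst q = Vy j \<and> pend q = Vy j'} = (if j = j' then {(Vy j, [])} else {})"
      using that by (auto simp: Q_iff)
    then show ?thesis unfolding C by (simp only:) simp
  qed
  have delta: "(\<Sum>k\<in>{1..n}. g k * int (of_bool (k = i))) = g i" "(\<Sum>k\<in>{1..n}. g k * int (of_bool (i = k))) = g i"
    if "i \<in> {1..n}" for i n and g :: "nat \<Rightarrow> int"
  proof -
    have "(\<Sum>k\<in>{1..n}. g k * int (of_bool (k = i))) = (\<Sum>k\<in>{1..n}. if k = i then g k else 0)"
      by (intro sum.cong) auto
    then show "(\<Sum>k\<in>{1..n}. g k * int (of_bool (k = i))) = g i" using that by simp
    then show "(\<Sum>k\<in>{1..n}. g k * int (of_bool (i = k))) = g i" by (simp only: eq_commute)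
  qed
  let ?\<psi> = "star_coxeter (int r) (int s) (int S1) (int S2)"
  have \<psi>: "agg y = ?\<psi> (agg w)" if rel: "PB.coxeter_related y w" for y w
  proof -
    obtain c where c: "\<And>v. v \<in> verts G \<Longrightarrow> y v = (\<Sum>u\<in>verts G. c u * int (PB.cartan u v))"
        "\<And>v. v \<in> verts G \<Longrightarrow> w v = (\<Sum>u\<in>verts G. c u * int (PB.cartan v u))"
      using rel unfolding PB.coxeter_related_def by blast
    \<comment> \<open>Both aggregated vectors depend on c only through these three totals, because
      the row and column sums of L are constant.\<close>
    let ?X = "\<Sum>i\<in>{1..r}. c (Vx i)" and ?Z = "c Vz" and ?Y = "\<Sum>j\<in>{1..s}. c (Vy j)"
    have vx: "Vx i \<in> verts G" if "i \<in> {1..r}" for i using that by simp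
    have vz: "Vz \<in> verts G" by simp
    have vy: "Vy j \<in> verts G" if "j \<in> {1..s}" for j using that by simp
    have yx: "y (Vx i) = c (Vx i)" if i: "i \<in> {1..r}" for i
    proof -
      have "(\<Sum>k\<in>{1..r}. c (Vx k) * int (PB.cartan (Vx k) (Vx i))) = (\<Sum>k\<in>{1..r}. c (Vx k) * int (of_bool (k = i)))"
        using Cxx[OF _ i] by (intro sum.cong) auto
      then show ?thesis unfolding c(1)[OF vx[OF i]] sum_verts Czx Cyx using delta(1)[OF i, of "\<lambda>k. c (Vx k)"] by simp
    qed
    have yz: "y Vz = ?X + ?Z"
      unfolding c(1)[OF vz] sum_verts Czz Cyz using Cxz by simp
    have yy: "y (Vy j) = (\<Sum>i\<in>{1..r}. c (Vx i) * L i j) + ?Z + c (Vy j)" if j: "j \<in> {1..s}" for j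
    proof -
      have "(\<Sum>k\<in>{1..s}. c (Vy k) * int (PB.cartan (Vy k) (Vy j))) = (\<Sum>k\<in>{1..s}. c (Vy k) * int (of_bool (k = j)))"
        using Cyy by (intro sum.cong) auto
      also have "\<dots> = c (Vy j)" by (rule delta(1)[OF j])
      moreover have "(\<Sum>k\<in>{1..r}. c (Vx k) * int (PB.cartan (Vx k) (Vy j))) = (\<Sum>k\<in>{1..r}. c (Vx k) * L k j)"
        using Cxy[OF _ j] by (intro sum.cong) auto
      ultimately show ?thesis unfolding c(1)[OF vy[OF j]] sum_verts Czy[OF j] by simp
    qed
    have wx: "w (Vx i) = c (Vx i) + ?Z + (\<Sum>j\<in>{1..s}. c (Vy j) * L i j)" if i: "i \<in> {1..r}" for i
    proof -
      have "(\<Sum>k\<in>{1..r}. c (Vx k) * int (PB.cartan (Vx i) (Vx k))) = (\<Sum>k\<in>{1..r}. c (Vx k) * int (of_bool (i = k)))"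
        using Cxx[OF i] by (intro sum.cong) auto
      also have "\<dots> = c (Vx i)" by (rule delta(2)[OF i])
      moreover have "(\<Sum>k\<in>{1..s}. c (Vy k) * int (PB.cartan (Vx i) (Vy k))) = (\<Sum>k\<in>{1..s}. c (Vy k) * L i k)"
        using Cxy[OF i] by (intro sum.cong) auto
      ultimately show ?thesis unfolding c(2)[OF vx[OF i]] sum_verts Cxz[OF i] by simp
    qed
    have wz: "w Vz = ?Z + ?Y"
      unfolding c(2)[OF vz] sum_verts Czz Czx using Czy by simp
    have wy: "w (Vy j) = c (Vy j)" if j: "j \<in> {1..s}" for j
    proof -
      have "(\<Sum>k\<in>{1..s}. c (Vy k) * int (PB.cartan (Vy j) (Vy k))) = (\<Sum>k\<in>{1..s}. c (Vy k) * int (of_bool (j = k)))"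
        using Cyy[OF j] by (intro sum.cong) auto
      then show ?thesis unfolding c(2)[OF vy[OF j]] sum_verts Cyx Cyz using delta(2)[OF j, of "\<lambda>k. c (Vy k)"] by simp
    qed
    have "(\<Sum>j\<in>{1..s}. \<Sum>i\<in>{1..r}. c (Vx i) * L i j) = (\<Sum>i\<in>{1..r}. c (Vx i) * (\<Sum>j\<in>{1..s}. L i j))"
      by (subst sum.swap) (simp only: sum_distrib_left)
    also have "\<dots> = int S1 * ?X" using L1 by (simp add: sum_distrib_left mult.commute)
    finally have "(\<Sum>j\<in>{1..s}. y (Vy j)) = int S1 * ?X + int s * ?Z + ?Y"
      using yy by (simp add: sum.distrib)
    then have y: "agg y = (?X, ?X + ?Z, ?Y + int s * ?Z + int S1 * ?X)"
      unfolding agg_def using yx yz by simp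
    have "(\<Sum>i\<in>{1..r}. \<Sum>j\<in>{1..s}. c (Vy j) * L i j) = (\<Sum>j\<in>{1..s}. c (Vy j) * (\<Sum>i\<in>{1..r}. L i j))"
      by (subst sum.swap) (simp only: sum_distrib_left)
    also have "\<dots> = int S2 * ?Y" using L2 by (simp add: sum_distrib_left mult.commute)
    finally have "(\<Sum>i\<in>{1..r}. w (Vx i)) = ?X + int r * ?Z + int S2 * ?Y"
      using wx by (simp add: sum.distrib)
    then have w: "agg w = (?X + int r * ?Z + int S2 * ?Y, ?Z + ?Y, ?Y)"
      unfolding agg_def using wy wz by simp
    \<comment> \<open>Writing \<open>agg w\<close> as (x, z, y), back substitution gives the totals
      Y = y, Z = z - y and X = x - r (z - y) - S2 y. The last is the m of
      \<open>star_coxeter\<close>, and \<open>agg y\<close> is then its value.\<close>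
    show ?thesis unfolding y w star_coxeter_def Let_def prod.case by simp
  qed
  have agg_cong: "agg y = agg w" if "\<And>v. v \<in> verts G \<Longrightarrow> y v = w v" for y w
    using that unfolding agg_def by simp
  let ?B = "(\<lambda>b. agg (\<lambda>v. int (PB.cartan b v))) ` verts G"
  show "int S1 * int S2 + int r + int s - int r * int S1 \<in> {1, 2, 3, 4}"
  proof (rule finite_orbit_bound)
    show "int r * int S1 = int s * int S2" using bal by simp
    show "finite ?B" by simp
    \<comment> \<open>The vertex y_1 is a sink, so its projective is simple with class (0, 0,
      1).\<close>
    have "(\<Sum>j\<in>{1..s}. int (PB.cartan (Vy 1) (Vy j))) = (\<Sum>j\<in>{1..s}. 1 * int (of_bool (1 = j)))"
      using Cyy[of 1] s1 by simp
    also have "\<dots> = 1" using delta(2)[of 1 s "\<lambda>_. 1"] s1 by simp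
    finally have "agg (\<lambda>v. int (PB.cartan (Vy 1) v)) = (0, 0, 1)" unfolding agg_def Cyx Cyz by simp
    then show "(0, 0, 1) \<in> ?B" using s1 by (intro image_eqI[of _ _ "Vy 1"]) auto
    fix u assume "u \<in> ?B"
    then obtain b where b: "u = agg (\<lambda>v. int (PB.cartan b v))" "b \<in> verts G" by blast
    obtain i c where "c \<in> verts G"
      "(?\<psi> ^^ Suc i) (agg (\<lambda>v. int (PB.cartan b v))) = agg (\<lambda>v. int (PB.cartan c v))"
      using PB.coxeter_orbit[where agg = agg and \<psi> = ?\<psi>, OF rf agg_cong \<psi> b(2)] by blast
    then show "\<exists>i. (?\<psi> ^^ Suc i) u \<in> ?B" unfolding b(1) by blast
  qed
qed

text \<open>All arrows of the quiver run from some y_j to some x_i, so one of in-degree and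
  out-degree is zero at each vertex and the other counts the linked partners.\<close>

lemma star_B_degree:
  "i \<in> {1..r} \<Longrightarrow> underlying_degree (star_B r s I) (Vx i) = card {j \<in> {1..s}. linked i j}"
  "j \<in> {1..s} \<Longrightarrow> underlying_degree (star_B r s I) (Vy j) = card {i \<in> {1..r}. linked i j}"
proof -
  show "underlying_degree (star_B r s I) (Vx i) = card {j \<in> {1..s}. linked i j}" if "i \<in> {1..r}"
  proof -
    have "in_arcs (star_B r s I) (Vx i) = (\<lambda>j. (j, i)) ` {j \<in> {1..s}. linked i j}"
      using that by (auto simp: in_arcs_def star_B_def linked_def)
    moreover have "out_arcs (star_B r s I) (Vx i) = {}" by (auto simp: out_arcs_def star_B_def)
    ultimately show ?thesis
      unfolding underlying_degree_def in_degree_def out_degree_def by (simp add: card_image inj_on_def)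
  qed
  show "underlying_degree (star_B r s I) (Vy j) = card {i \<in> {1..r}. linked i j}" if "j \<in> {1..s}"
  proof -
    have "out_arcs (star_B r s I) (Vy j) = (\<lambda>i. (j, i)) ` {i \<in> {1..r}. linked i j}"
      using that by (auto simp: out_arcs_def star_B_def linked_def)
    moreover have "in_arcs (star_B r s I) (Vy j) = {}" by (auto simp: in_arcs_def star_B_def)
    ultimately show ?thesis
      unfolding underlying_degree_def in_degree_def out_degree_def by (simp add: card_image inj_on_def)
  qed
qed

end

theorem theorem1p1:
  fixes I :: "((star_vertex, star_arrow) qpath \<Rightarrow> 'k::alg_closed_field) set"
    and r s \<Sigma>1 \<Sigma>2 :: nat
  assumes "r \<ge> 1" and "s \<ge> 1"
    and "admissible_ideal (star_quiver r s) I"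
    and "n_representation_finite 2 (bound_quiver_algebra (star_quiver r s) I)"
    and "semi_regular r s (star_B r s I) \<Sigma>1 \<Sigma>2"
  shows "r * \<Sigma>1 = s * \<Sigma>2 \<and>
    int \<Sigma>1 * int \<Sigma>2 + int r + int s - int r * int \<Sigma>1 \<in> {1, 2, 3, 4}"
proof -
  interpret star_bound r s I by (rule star_bound.intro[OF assms(3)])
  have 1: "card {j \<in> {1..s}. linked i j} = \<Sigma>1" if "i \<in> {1..r}" for i
    using assms(5) star_B_degree(1)[OF that] that unfolding semi_regular_def by simp
  have 2: "card {i \<in> {1..r}. linked i j} = \<Sigma>2" if "j \<in> {1..s}" for j
    using assms(5) star_B_degree(2)[OF that] that unfolding semi_regular_def by simp
  show ?thesis
    by (rule conjI[OF semi_regular_bound(1)[OF assms(4,2) 1 2] semi_regular_bound(2)[OF assms(4,2) 1 2]])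
qed

end
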